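(* Let $a,b,c$ be positive numbers with $a<b<c$, $b-a<c_0<a$, $\lfloor c/b\rfloor\ge2$ and $0<c_1<2a-b$, where $c_0=c-\lfloor c/b\rfloor b$ and $c_1=\lfloor c/b\rfloor b-\lfloor\lfloor c/b\rfloor b/a\rfloor a$. Suppose $a/b=p/q$ for coprime positive integers $p,q$ and $c\in (b/q)\mathbb Z$. Then $\mathcal G(\chi_{[0,c)},a\mathbb Z\times\mathbb Z/b)$ is not a Gabor frame if and only if one of the following holds: 6) $c_0<\gcd(a,c_1)$ and $\lfloor c/b\rfloor(\gcd(a,c_1)-c_0)\ne\gcd(a,c_1)$; 7) $b-c_0<\gcd(a,c_1+b)$ and $(\lfloor c/b\rfloor+1)(\gcd(a,c_1+b)+c_0-b)\ne\gcd(a,c_1+b)$; 8) there exist nonnegative integers $d_1,d_2,d_3,d_4$ such that, with $N=d_1+d_2+d_3+d_4+2$ and $B_d=a-(d_1+d_2+1)(b-a)$: (a) $0<B_d\in N(b/q)\mathbb Z$; (b) $Nc_1+(d_1+d_3+1)(b-a)\in a\mathbb Z$; (c) $(d_1+d_2+1)(Nc_1+(d_1+d_3+1)(b-a))-(d_1+d_3+1)a\in Na\mathbb Z$; (d) $\gcd(Nc_1+(d_1+d_3+1)(b-a),Na)=a$; (e) $\#E^d_{a,b,c}=d_1$, where $E^d_{a,b,c}=\{n\in\mathbb Z\cap[1,d_1+d_2+1]: n(Nc_1+(d_1+d_3+1)(b-a))\in(0,(d_1+d_3+1)a)+Na\mathbb Z\}$; (f) $c_0=(d_1+1)(b-a)+(d_1+d_3+1)B_d/N+\delta$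 for some $\delta$ with $-\min(a-c_0,B_d/N)<\delta<\min(c_0+a-b,B_d/N)$; (g) $|\delta|+a/(N\lfloor c/b\rfloor+d_1+d_3+1)\ne B_d/N$.
   Context: For $\phi\in L^2(\mathbb R)$ and $a,b>0$, the Gabor system is $\mathcal G(\phi,a\mathbb Z\times\mathbb Z/b)=\{e^{-2\pi i n t/b}\phi(t-ma): (m,n)\in\mathbb Z\times\mathbb Z\}$. It is called a Gabor frame if it is a frame for $L^2(\mathbb R)$: there are constants $0<A\le B<\infty$ such that $A\|f\|_2^2\le\sum_{\psi\in\mathcal G}|\langle f,\psi\rangle|^2\le B\|f\|_2^2$ for all $f\in L^2(\mathbb R)$. $\chi_E$ is the indicator function of $E$, $\lfloor x\rfloor$ the integer part, $\#$ cardinality, and $A+r\mathbb Z=\{x+rk:x\in A,k\in\mathbb Z\}$. For positive $x,y$ lying in a lattice $r\mathbb Z$ ($r>0$; here $r=b/q$), $\gcd(x,y)$ denotes the largest $d\in r\mathbb Z$, $d>0$, with $x,y\in d\mathbb Z$. *)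

theory Defs
  imports "HOL-Analysis.Analysis"
begin

definition square_integrable :: "(real \<Rightarrow> complex) \<Rightarrow> bool" where
  "square_integrable f \<longleftrightarrow> f \<in> borel_measurable lborel \<and>
     integrable lborel (\<lambda>t. (norm (f t))\<^sup>2)"

definition l2_inner :: "(real \<Rightarrow> complex) \<Rightarrow> (real \<Rightarrow> complex) \<Rightarrow> complex" where
  "l2_inner f g = (LINT t|lborel. f t * cnj (g t))"

definition l2_normsq :: "(real \<Rightarrow> complex) \<Rightarrow> real" where
  "l2_normsq f = (LINT t|lborel. (norm (f t))\<^sup>2)"

definition gabor_atom :: "(real \<Rightarrow> complex) \<Rightarrow> real \<Rightarrow> real \<Rightarrow> int \<Rightarrow> int \<Rightarrow> real \<Rightarrow> complex" where
  "gabor_atom \<phi> a b m n = (\<lambda>t. exp (- (2 * pi * real_of_int n * t / b) * \<i>) * \<phi> (t - real_of_int m * a))"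

definition gabor_frame :: "(real \<Rightarrow> complex) \<Rightarrow> real \<Rightarrow> real \<Rightarrow> bool" where
  "gabor_frame \<phi> a b \<longleftrightarrow> (\<exists>A B. 0 < A \<and> A \<le> B \<and>
     (\<forall>f. square_integrable f \<longrightarrow>
        (\<lambda>(m,n). (norm (l2_inner f (gabor_atom \<phi> a b m n)))\<^sup>2) summable_on (UNIV :: (int \<times> int) set) \<and>
        A * l2_normsq f \<le> infsum (\<lambda>(m,n). (norm (l2_inner f (gabor_atom \<phi> a b m n)))\<^sup>2) UNIV \<and>
        infsum (\<lambda>(m,n). (norm (l2_inner f (gabor_atom \<phi> a b m n)))\<^sup>2) UNIV \<le> B * l2_normsq f))"

definition in_lat :: "real \<Rightarrow> real \<Rightarrow> bool" where
  "in_lat d x \<longleftrightarrow> (\<exists>k::int. x = real_of_int k * d)"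

definition lat_gcd :: "real \<Rightarrow> real \<Rightarrow> real \<Rightarrow> real" where
  "lat_gcd r x y = (GREATEST d. d > 0 \<and> in_lat r d \<and> in_lat d x \<and> in_lat d y)"

end

(*
By periodization and Parseval's identity the frame inequality reduces to bounds for a
single 0-1 matrix: in the units b/q, with p, q, C the integers a, b, c, it maps a sequence v to the
sums of v over the windows {n. 0 <= q n - p m < C}.  When m increases by one, at most one index
leaves and at most one enters.  Linking these two indices splits the integers into chains; v is
controlled by the window sums along every chain that breaks off, and every window meets each
bi-infinite chain exactly once.  Hence the system is a frame iff at most one chain is bi-infinite.
Following q n mod p along a chain, the bi-infinite chains form the largest set of residues
invariant under a rotation of the circle of length p with one gap removed and one inserted.
The induced map on this set is cyclically order preserving, hence a shift of its enumeration, so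
the gaps between consecutive elements are rigid.  If only one branch of the map is used, the set
is a union of residue classes modulo a gcd (conditions 6 and 7); otherwise it consists of N runs
of equal length separated by gaps of two sizes (condition 8).  Counting each set gives the
number of bi-infinite chains.
*)
theory Submission
  imports Defs
begin

section \<open>Orthogonal systems and Parseval's identity\<close>

text \<open>The inequations that close conditions 6, 7 and 8 are counts. For an invariant set E of
  residues, the number L of its chains satisfies p * L = k * |E| + |E_low|, where E_low is the part
  below c0 - g and g = q - p; this comes from adding up how far all indices move while the windows
  run through one period. For the explicit sets of the three conditions the inequation says that L
  is not 1, and the inequalities before it make L positive. The directions differ in what they ask
  of E. Against the frame property any invariant set with L at least 2 will do: it carries a bounded
  kernel vector of the matrix, whose truncations grow in norm while only the boundary windows see
  them. For the frame property the shape of the largest set has to be recovered, and in the mixed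
  case maximality does this: a translated part of the set that does not cross the removed gap is
  again invariant, so it already lies in the set. The number \<delta> of condition 8 measures by how
  much c0 misses the position it would have if every run had the full length B_d / N; each run loses
  |\<delta>| points, and by maximality no more.\<close>

definition sqint :: "'a measure \<Rightarrow> ('a \<Rightarrow> complex) \<Rightarrow> bool" where
  "sqint M f \<longleftrightarrow> f \<in> borel_measurable M \<and> integrable M (\<lambda>x. (norm (f x))\<^sup>2)"

lemma norm_add_square_le:
  fixes x y :: "'a::real_normed_vector"
  shows "(norm (x + y))\<^sup>2 \<le> 2 * (norm x)\<^sup>2 + 2 * (norm y)\<^sup>2"
proof -
  have "(norm (x + y))\<^sup>2 \<le> (norm x + norm y)\<^sup>2"
    by (intro power_mono norm_triangle_ineq) auto
  also have "\<dots> \<le> 2 * (norm x)\<^sup>2 + 2 * (norm y)\<^sup>2"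
    using sum_squares_ge_zero[of "norm x - norm y" 0] by (simp add: power2_eq_square algebra_simps)
  finally show ?thesis .
qed

lemma sqint_add:
  assumes "sqint M f" "sqint M g"
  shows "sqint M (\<lambda>x. f x + g x)"
proof -
  have [measurable]: "f \<in> borel_measurable M" "g \<in> borel_measurable M"
    using assms by (auto simp: sqint_def)
  have "integrable M (\<lambda>x. (norm (f x + g x))\<^sup>2)"
    by (rule Bochner_Integration.integrable_bound[where f = "\<lambda>x. 2 * (norm (f x))\<^sup>2 + 2 * (norm (g x))\<^sup>2"])
       (use assms norm_add_square_le in \<open>auto simp: sqint_def\<close>)
  then show ?thesis by (simp add: sqint_def)
qed

lemma sqint_cmult: "sqint M f \<Longrightarrow> sqint M (\<lambda>x. c * f x)"
  by (auto simp: sqint_def norm_mult power_mult_distrib)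

lemma sqint_diff: "sqint M f \<Longrightarrow> sqint M g \<Longrightarrow> sqint M (\<lambda>x. f x - g x)"
  using sqint_add[of M f "\<lambda>x. (-1) * g x"] sqint_cmult[of M g "-1"] by simp

lemma sqint_zero [simp]: "sqint M (\<lambda>x. 0)"
  by (simp add: sqint_def)

lemma sqint_sum: "(\<And>i. i \<in> I \<Longrightarrow> sqint M (f i)) \<Longrightarrow> sqint M (\<lambda>x. \<Sum>i\<in>I. f i x)"
proof (induction I rule: infinite_finite_induct)
  case (insert i I)
  then have "sqint M (\<lambda>x. f i x + (\<Sum>i\<in>I. f i x))"
    by (intro sqint_add) auto
  then show ?case using insert.hyps by simp
qed simp_all

lemma borel_measurable_cnj [measurable (raw)]:
  "f \<in> borel_measurable M \<Longrightarrow> (\<lambda>x. cnj (f x)) \<in> borel_measurable M"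
  by (rule borel_measurable_continuous_on[where f = cnj]) (auto intro: continuous_intros)

lemma integrable_mult_cnj:
  assumes "sqint M f" "sqint M g"
  shows "integrable M (\<lambda>x. f x * cnj (g x))"
proof (rule Bochner_Integration.integrable_bound[where f = "\<lambda>x. (norm (f x))\<^sup>2 + (norm (g x))\<^sup>2"])
  have [measurable]: "f \<in> borel_measurable M" "g \<in> borel_measurable M"
    using assms by (auto simp: sqint_def)
  show "(\<lambda>x. f x * cnj (g x)) \<in> borel_measurable M" by measurable
  show "AE x in M. norm (f x * cnj (g x)) \<le> norm ((norm (f x))\<^sup>2 + (norm (g x))\<^sup>2)"
  proof (intro AE_I2)
    fix x
    have "2 * (norm (f x) * norm (g x)) \<le> (norm (f x))\<^sup>2 + (norm (g x))\<^sup>2"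
      using sum_squares_bound[of "norm (f x)" "norm (g x)"] by (simp add: algebra_simps)
    moreover have "0 \<le> norm (f x) * norm (g x)" by simp
    ultimately have "norm (f x) * norm (g x) \<le> (norm (f x))\<^sup>2 + (norm (g x))\<^sup>2" by linarith
    then show "norm (f x * cnj (g x)) \<le> norm ((norm (f x))\<^sup>2 + (norm (g x))\<^sup>2)"
      by (simp add: norm_mult)
  qed
qed (use assms in \<open>auto simp: sqint_def\<close>)

section \<open>Bessel's inequality and Parseval's identity for an orthogonal system\<close>

locale orthogonal_system =
  fixes M :: "'a measure" and e :: "'i \<Rightarrow> 'a \<Rightarrow> complex" and \<beta> :: real
  assumes pos: "0 < \<beta>"
    and sq: "sqint M (e i)"
    and ortho: "(LINT x|M. e i x * cnj (e j x)) = (if i = j then of_real \<beta> else 0)"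
begin

text \<open>Completing the square in the coefficients \<open>c\<close>. One identity serves both
  halves of Parseval: the minimizing choice of \<open>c\<close> gives Bessel's inequality, and for
  an arbitrary approximating combination the last sum is nonnegative and may be dropped. The vectors
  have squared norm \<beta> instead of 1, which suits the characters on a period of length
  \<beta>.\<close>

lemma dist_square:
  assumes f: "sqint M f" and J: "finite J"
  shows "(LINT x|M. (norm (f x - (\<Sum>j\<in>J. c j * e j x)))\<^sup>2) =
    (LINT x|M. (norm (f x))\<^sup>2) - (\<Sum>j\<in>J. (norm (LINT x|M. f x * cnj (e j x)))\<^sup>2) / \<beta>
     + \<beta> * (\<Sum>j\<in>J. (norm (c j - (LINT x|M. f x * cnj (e j x)) / \<beta>))\<^sup>2)"
proof -
  define a where "a j = (LINT x|M. f x * cnj (e j x))" for j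
  define P where "P = (\<lambda>x. \<Sum>j\<in>J. c j * e j x)"
  have P: "sqint M P" unfolding P_def by (intro sqint_sum sqint_cmult sq)
  note ints = integrable_mult_cnj[OF f f] integrable_mult_cnj[OF f P]
    integrable_mult_cnj[OF P f] integrable_mult_cnj[OF P P]
  have sqr: "of_real (LINT x|M. (norm (h x))\<^sup>2) = (LINT x|M. h x * cnj (h x))" for h :: "'a \<Rightarrow> complex"
    by (simp only: integral_complex_of_real[symmetric] complex_norm_square)
  have fP: "(LINT x|M. f x * cnj (P x)) = (\<Sum>j\<in>J. cnj (c j) * a j)"
  proof -
    have "(LINT x|M. f x * cnj (P x)) = (LINT x|M. (\<Sum>j\<in>J. cnj (c j) * (f x * cnj (e j x))))"
      by (simp add: P_def sum_distrib_left mult_ac)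
    also have "\<dots> = (\<Sum>j\<in>J. cnj (c j) * a j)"
      by (subst Bochner_Integration.integral_sum) (auto intro!: integrable_mult_right integrable_mult_cnj f sq simp: a_def)
    finally show ?thesis .
  qed
  have eP: "(LINT x|M. P x * cnj (e i x)) = (if i \<in> J then c i * \<beta> else 0)" for i
  proof -
    have "(LINT x|M. P x * cnj (e i x)) = (LINT x|M. (\<Sum>j\<in>J. c j * (e j x * cnj (e i x))))"
      by (simp only: P_def sum_distrib_right mult.assoc)
    also have "\<dots> = (\<Sum>j\<in>J. c j * (if j = i then of_real \<beta> else 0))"
      by (subst Bochner_Integration.integral_sum) (auto intro!: integrable_mult_right integrable_mult_cnj sq simp: ortho)
    also have "\<dots> = (\<Sum>j\<in>J. if j = i then c j * \<beta> else 0)" by (intro sum.cong) auto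
    also have "\<dots> = (if i \<in> J then c i * \<beta> else 0)" using J by (simp add: sum.delta)
    finally show ?thesis .
  qed
  have PP: "(LINT x|M. P x * cnj (P x)) = (\<Sum>j\<in>J. cnj (c j) * (c j * \<beta>))"
  proof -
    have "(LINT x|M. P x * cnj (P x)) = (LINT x|M. (\<Sum>j\<in>J. cnj (c j) * (P x * cnj (e j x))))"
      by (subst (2) P_def) (simp add: sum_distrib_left mult_ac)
    also have "\<dots> = (\<Sum>j\<in>J. cnj (c j) * (c j * \<beta>))"
      by (subst Bochner_Integration.integral_sum) (auto intro!: integrable_mult_right integrable_mult_cnj P sq simp: eP)
    finally show ?thesis .
  qed
  have Pf: "(LINT x|M. P x * cnj (f x)) = (\<Sum>j\<in>J. c j * cnj (a j))"
  proof -
    have "(LINT x|M. P x * cnj (f x)) = cnj (LINT x|M. f x * cnj (P x))"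
      by (subst Bochner_Integration.integral_cnj[symmetric]) (simp add: mult.commute)
    then show ?thesis by (simp add: fP)
  qed
  have "\<beta> * ((c j - a j / \<beta>) * cnj (c j - a j / \<beta>))
      = a j * cnj (a j) / \<beta> - cnj (c j) * a j - c j * cnj (a j) + cnj (c j) * (c j * \<beta>)" for j
    using pos by (simp add: field_simps)
  then have csq: "\<beta> * (\<Sum>j\<in>J. (c j - a j / \<beta>) * cnj (c j - a j / \<beta>))
      = (\<Sum>j\<in>J. a j * cnj (a j) / \<beta>) - (\<Sum>j\<in>J. cnj (c j) * a j)
      - (\<Sum>j\<in>J. c j * cnj (a j)) + (\<Sum>j\<in>J. cnj (c j) * (c j * \<beta>))"
    unfolding sum_distrib_left by (simp add: sum.distrib sum_subtractf)
  have "complex_of_real (LINT x|M. (norm (f x - P x))\<^sup>2)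
      = (LINT x|M. f x * cnj (f x) - f x * cnj (P x) - P x * cnj (f x) + P x * cnj (P x))"
    unfolding sqr by (simp add: algebra_simps)
  also have "\<dots> = (LINT x|M. f x * cnj (f x)) - (\<Sum>j\<in>J. cnj (c j) * a j)
      - (\<Sum>j\<in>J. c j * cnj (a j)) + (\<Sum>j\<in>J. cnj (c j) * (c j * \<beta>))"
    by (simp add: ints fP PP Pf)
  also have "\<dots> = (LINT x|M. f x * cnj (f x)) - (\<Sum>j\<in>J. a j * cnj (a j)) / \<beta>
      + \<beta> * (\<Sum>j\<in>J. (c j - a j / \<beta>) * cnj (c j - a j / \<beta>))"
    unfolding csq by (simp add: sum_divide_distrib)
  also have "\<dots> = complex_of_real ((LINT x|M. (norm (f x))\<^sup>2) - (\<Sum>j\<in>J. (norm (a j))\<^sup>2) / \<beta>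
      + \<beta> * (\<Sum>j\<in>J. (norm (c j - a j / \<beta>))\<^sup>2))"
    by (simp only: sqr of_real_add of_real_diff of_real_mult of_real_divide of_real_sum complex_norm_square)
  finally show ?thesis unfolding a_def P_def by (simp only: of_real_eq_iff)
qed

lemma Bessel:
  assumes f: "sqint M f" and J: "finite J"
  shows "(\<Sum>j\<in>J. (norm (LINT x|M. f x * cnj (e j x)))\<^sup>2) \<le> \<beta> * (LINT x|M. (norm (f x))\<^sup>2)"
proof -
  have "0 \<le> (LINT x|M. (norm (f x - (\<Sum>j\<in>J. (LINT x|M. f x * cnj (e j x)) / \<beta> * e j x)))\<^sup>2)"
    by simp
  then show ?thesis
    unfolding dist_square[OF f J] using pos by (simp add: field_simps)
qed

text \<open>Any approximating combination is enough, whatever its coefficients, because by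
  \<open>dist_square\<close> the optimal coefficients do at least as well.\<close>

lemma Parseval:
  assumes f: "sqint M f"
    and dense: "\<And>\<epsilon>. \<epsilon> > 0 \<Longrightarrow> \<exists>J c. finite J \<and> (LINT x|M. (norm (f x - (\<Sum>j\<in>J. c j * e j x)))\<^sup>2) < \<epsilon>"
  shows "((\<lambda>j. (norm (LINT x|M. f x * cnj (e j x)))\<^sup>2) has_sum \<beta> * (LINT x|M. (norm (f x))\<^sup>2)) UNIV"
    (is "(?a has_sum ?S) UNIV")
proof -
  have summ: "?a summable_on UNIV"
    using Bessel[OF f] by (intro nonneg_bdd_above_summable_on bdd_aboveI[where M = ?S]) auto
  have "infsum ?a UNIV \<le> ?S"
    using Bessel[OF f] by (intro infsum_le_finite_sums[OF summ]) auto
  moreover have "?S \<le> infsum ?a UNIV"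
  proof (rule field_le_epsilon)
    fix \<epsilon> :: real assume "\<epsilon> > 0"
    then have "\<epsilon> / \<beta> > 0" using pos by simp
    then obtain J c where J: "finite J"
      and lt: "(LINT x|M. (norm (f x - (\<Sum>j\<in>J. c j * e j x)))\<^sup>2) < \<epsilon> / \<beta>"
      using dense by blast
    have "(LINT x|M. (norm (f x))\<^sup>2) - sum ?a J / \<beta> < \<epsilon> / \<beta>"
      using lt unfolding dist_square[OF f J] using pos
      by (smt (verit, best) mult_nonneg_nonneg sum_nonneg zero_le_power2)
    from mult_strict_left_mono[OF this pos]
    have "?S < sum ?a J + \<epsilon>" using pos by (simp add: right_diff_distrib)
    also have "sum ?a J \<le> infsum ?a UNIV"
      by (rule finite_sum_le_infsum[OF summ J]) auto
    finally show "?S \<le> infsum ?a UNIV + \<epsilon>" by simp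
  qed
  ultimately have "infsum ?a UNIV = ?S" by (rule antisym)
  then show ?thesis using has_sum_infsum[OF summ] by simp
qed

end

section \<open>Characters and trigonometric polynomials of period b\<close>

definition fourier :: "real \<Rightarrow> int \<Rightarrow> real \<Rightarrow> complex" where
  "fourier b n t = cis (- (2 * pi * of_int n * t / b))"

lemma norm_fourier [simp]: "norm (fourier b n t) = 1"
  by (simp add: fourier_def)

lemma fourier_add: "fourier b n t * fourier b m t = fourier b (n + m) t"
  by (simp add: fourier_def cis_mult add_divide_distrib algebra_simps)

lemma continuous_fourier [continuous_intros]: "continuous_on S (fourier b n)"
  unfolding fourier_def[abs_def] divide_inverse by (intro continuous_intros)

lemma borel_measurable_fourier [measurable]: "fourier b n \<in> borel_measurable borel"
  by (intro borel_measurable_continuous_onI continuous_intros)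

text \<open>Generated inductively so that closure under products is a double induction down to
  monomials; the explicit sum over frequencies is needed only when density is handed to
  \<open>Parseval\<close>.\<close>

inductive trig_poly :: "real \<Rightarrow> (real \<Rightarrow> complex) \<Rightarrow> bool" for b where
  monom: "trig_poly b (\<lambda>t. c * fourier b n t)"
| add: "trig_poly b f \<Longrightarrow> trig_poly b g \<Longrightarrow> trig_poly b (\<lambda>t. f t + g t)"

lemma trig_poly_const: "trig_poly b (\<lambda>t. c)"
  using trig_poly.monom[of b c 0] by (simp add: fourier_def)

lemma trig_poly_mult:
  assumes "trig_poly b f" "trig_poly b g"
  shows "trig_poly b (\<lambda>t. f t * g t)"
  using assms(1)
proof induction
  case (monom c n)
  from assms(2) show ?case
  proof induction
    case (monom d m)
    have "(\<lambda>t. c * fourier b n t * (d * fourier b m t)) = (\<lambda>t. (c * d) * fourier b (n + m) t)"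
      by (simp add: fun_eq_iff flip: fourier_add)
    then show ?case by (simp only:) (rule trig_poly.monom)
  next
    case (add f g)
    then show ?case unfolding distrib_left by (intro trig_poly.add)
  qed
next
  case (add f g)
  then show ?case unfolding distrib_right by (intro trig_poly.add)
qed

lemma trig_poly_explicit:
  assumes "trig_poly b f"
  obtains J c where "finite J" "f = (\<lambda>t. \<Sum>n\<in>J. c n * fourier b n t)"
proof -
  from assms have "\<exists>J c. finite J \<and> f = (\<lambda>t. \<Sum>n\<in>J. c n * fourier b n t)"
  proof induction
    case (monom c n)
    show ?case by (intro exI[of _ "{n}"] exI[of _ "\<lambda>_. c"]) simp
  next
    case (add f g)
    then obtain J c K d where J: "finite J" "f = (\<lambda>t. \<Sum>n\<in>J. c n * fourier b n t)"
      and K: "finite K" "g = (\<lambda>t. \<Sum>n\<in>K. d n * fourier b n t)" by blast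
    have "f t = (\<Sum>n\<in>J \<union> K. (if n \<in> J then c n else 0) * fourier b n t)" for t
      unfolding J(2) using J(1) K(1) by (intro sum.mono_neutral_cong_left) auto
    moreover have "g t = (\<Sum>n\<in>J \<union> K. (if n \<in> K then d n else 0) * fourier b n t)" for t
      unfolding K(2) using J(1) K(1) by (intro sum.mono_neutral_cong_left) auto
    ultimately show ?case using J(1) K(1)
      by (intro exI[of _ "J \<union> K"] exI[of _ "\<lambda>n. (if n \<in> J then c n else 0) + (if n \<in> K then d n else 0)"])
         (simp add: distrib_right sum.distrib)
  qed
  then show thesis using that by blast
qed

text \<open>A real linear functional on the plane, evaluated on the circle, is a combination of
  cosine and sine, hence of the frequencies 1 and -1. This carries the polynomials supplied by
  Stone-Weierstrass on the circle over to trigonometric polynomials.\<close>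

lemma trig_poly_real_polynomial:
  assumes "real_polynomial_function h"
  shows "trig_poly b (\<lambda>t. complex_of_real (h (cis (2 * pi * t / b))))"
  using assms
proof induction
  case (linear h)
  define u v where "u = complex_of_real (h 1)" and "v = complex_of_real (h \<i>)"
  have "h (cis x) = cos x * h 1 + sin x * h \<i>" for x
  proof -
    interpret h: bounded_linear h by fact
    have "cis x = cos x *\<^sub>R 1 + sin x *\<^sub>R \<i>" by (simp add: complex_eq_iff)
    then show ?thesis by (simp only: h.add h.scaleR real_scaleR_def)
  qed
  note h = this
  have cs: "complex_of_real (cos x) = (cis (- x) + cis x) / 2"
    "complex_of_real (sin x) = (cis (- x) - cis x) * \<i> / 2" for x
    by (auto simp: complex_eq_iff)
  have "complex_of_real (h (cis x)) = (u + v * \<i>) / 2 * cis (- x) + (u - v * \<i>) / 2 * cis x" for x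
    unfolding h of_real_add of_real_mult cs u_def v_def
    by (simp add: algebra_simps add_divide_distrib diff_divide_distrib)
  then have "complex_of_real (h (cis (2 * pi * t / b))) =
      (u + v * \<i>) / 2 * fourier b 1 t + (u - v * \<i>) / 2 * fourier b (-1) t" for t
    by (simp add: fourier_def)
  then show ?case by (simp only:) (rule trig_poly.add[OF trig_poly.monom trig_poly.monom])
next
  case (add f g)
  then show ?case unfolding of_real_add by (intro trig_poly.add)
next
  case (mult f g)
  then show ?case unfolding of_real_mult by (intro trig_poly_mult)
qed (rule trig_poly_const)

section \<open>Density of the trigonometric polynomials on one period\<close>

context
  fixes b :: real
  assumes b: "0 < b"
begin

abbreviation "period_measure \<equiv> restrict_space lborel {0..<b}"

lemma emeasure_period: "emeasure period_measure {0..<b} = b"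
  using b by (simp add: emeasure_restrict_space)

lemma finite_measure_period: "finite_measure period_measure"
  by (rule finite_measureI) (simp add: space_restrict_space emeasure_period)

lemma borel_measurable_period: "f \<in> borel_measurable borel \<Longrightarrow> f \<in> borel_measurable period_measure"
  by (intro measurable_restrict_space1) simp

lemma sqint_bounded:
  assumes "f \<in> borel_measurable borel" "\<And>t. t \<in> {0..<b} \<Longrightarrow> norm (f t) \<le> B"
  shows "sqint period_measure f"
proof -
  interpret finite_measure period_measure by (rule finite_measure_period)
  have [measurable]: "f \<in> borel_measurable period_measure"
    by (rule borel_measurable_period) fact
  have "integrable period_measure (\<lambda>t. (norm (f t))\<^sup>2)"
    by (rule integrable_const_bound[where B = "B\<^sup>2"])
       (auto simp: space_restrict_space intro!: AE_I2 power_mono assms(2))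
  then show ?thesis by (simp add: sqint_def)
qed

lemma fourier_orthogonal: "orthogonal_system period_measure (fourier b) b"
proof
  show "sqint period_measure (fourier b n)" for n
    by (rule sqint_bounded[where B = 1]) auto
  fix i j :: int
  show "(LINT t|period_measure. fourier b i t * cnj (fourier b j t)) = (if i = j then of_real b else 0)"
  proof (cases "i = j")
    case True
    have "fourier b j t * cnj (fourier b j t) = 1" for t
      by (simp flip: complex_norm_square)
    then show ?thesis using True b
      by (simp add: space_restrict_space emeasure_period measure_def scaleR_conv_of_real)
  next
    case False
    define w where "w = - (2 * pi * of_int (i - j) / b)"
    have w: "w \<noteq> 0" using False b by (simp add: w_def)
    have eq: "fourier b i t * cnj (fourier b j t) = cis (w * t)" for t
      by (simp add: fourier_def w_def cis_cnj cis_mult diff_divide_distrib algebra_simps)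
    have "((\<lambda>t. cis (w * t)) has_integral (cis (w * b) / (\<i> * w) - cis (w * 0) / (\<i> * w))) {0..b}"
    proof (rule fundamental_theorem_of_calculus)
      fix t
      have "((\<lambda>z. exp (\<i> * w * z) / (\<i> * w)) has_field_derivative exp (\<i> * w * of_real t)) (at (of_real t))"
        using w by (auto intro!: derivative_eq_intros)
      then have "((\<lambda>t. exp (\<i> * w * of_real t) / (\<i> * w)) has_vector_derivative exp (\<i> * w * of_real t)) (at t)"
        by (rule has_vector_derivative_real_field)
      then show "((\<lambda>t. cis (w * t) / (\<i> * w)) has_vector_derivative cis (w * t)) (at t within {0..b})"
        by (simp add: cis_conv_exp has_vector_derivative_at_within mult_ac)
    qed (use b in auto)
    moreover have "w * b = 2 * pi * of_int (j - i)"
      using b by (simp add: w_def diff_divide_distrib right_diff_distrib left_diff_distrib)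
    then have "cis (w * b) = 1"
      using cis_multiple_2pi[of "of_int (j - i)"] by simp
    ultimately have hi: "((\<lambda>t. cis (w * t)) has_integral 0) {0..b}" by simp
    have si: "set_integrable lborel {0..b} (\<lambda>t. cis (w * t))"
      by (intro borel_integrable_atLeastAtMost' continuous_intros)
    have "(LINT t|period_measure. cis (w * t)) = (LINT t:{0..<b}|lborel. cis (w * t))"
      unfolding set_lebesgue_integral_def by (subst integral_restrict_space) auto
    also have "\<dots> = (LINT t:{0..b}|lborel. cis (w * t))"
      unfolding set_lebesgue_integral_def
    proof (rule integral_cong_AE)
      have "(\<lambda>t. indicator S t *\<^sub>R cis (w * t)) \<in> borel_measurable lborel" if "S \<in> sets borel" for S
        using that by (intro borel_measurable_scaleR borel_measurable_indicator)
          (auto intro!: borel_measurable_continuous_onI continuous_intros)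
      then show "(\<lambda>t. indicator {0..<b} t *\<^sub>R cis (w * t)) \<in> borel_measurable lborel"
        "(\<lambda>t. indicator {0..b} t *\<^sub>R cis (w * t)) \<in> borel_measurable lborel" by auto
      show "AE t in lborel. indicator {0..<b} t *\<^sub>R cis (w * t) = indicator {0..b} t *\<^sub>R cis (w * t)"
        using AE_lborel_singleton[of b] by eventually_elim (auto simp: indicator_def)
    qed
    also have "\<dots> = 0"
      using set_borel_integral_eq_integral(2)[OF si] hi by (simp add: integral_unique)
    finally show ?thesis using False by (simp add: eq)
  qed
qed (fact b)

text \<open>Membership in the L2 closure of the trigonometric polynomials. It is established for
  continuous functions vanishing near the ends of the period, then for bounded and for
  square-integrable ones.\<close>

definition approx_trig :: "(real \<Rightarrow> complex) \<Rightarrow> bool" where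
  "approx_trig f \<longleftrightarrow> (\<forall>\<epsilon>>0. \<exists>P. trig_poly b P \<and> (LINT t|period_measure. (norm (f t - P t))\<^sup>2) < \<epsilon>)"

lemma sqint_trig_poly: "trig_poly b P \<Longrightarrow> sqint period_measure P"
proof (induction rule: trig_poly.induct)
  case (monom c n)
  show ?case by (intro sqint_cmult sqint_bounded[where B = 1]) auto
qed (rule sqint_add)

lemma approx_trig_limit:
  assumes f: "sqint period_measure f"
    and h: "\<And>n. sqint period_measure (h n)" "\<And>n. approx_trig (h n)"
    and lim: "(\<lambda>n. LINT t|period_measure. (norm (f t - h n t))\<^sup>2) \<longlonglongrightarrow> 0"
  shows "approx_trig f"
  unfolding approx_trig_def
proof (intro allI impI)
  fix \<epsilon> :: real assume \<epsilon>: "\<epsilon> > 0"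
  then have "\<forall>\<^sub>F n in sequentially. (LINT t|period_measure. (norm (f t - h n t))\<^sup>2) < \<epsilon> / 4"
    using lim by (intro order_tendstoD(2)[OF lim]) auto
  \<comment> \<open>Two quarters suffice: \<open>norm_add_square_le\<close> doubles each squared
    distance.\<close>
  then obtain n where n: "(LINT t|period_measure. (norm (f t - h n t))\<^sup>2) < \<epsilon> / 4"
    by (auto simp: eventually_sequentially)
  obtain P where P: "trig_poly b P" "(LINT t|period_measure. (norm (h n t - P t))\<^sup>2) < \<epsilon> / 4"
    using h(2)[of n] \<epsilon> unfolding approx_trig_def by (metis divide_pos_pos zero_less_numeral)
  have i1: "integrable period_measure (\<lambda>t. (norm (f t - h n t))\<^sup>2)"
    using sqint_diff[OF f h(1)] by (simp add: sqint_def)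
  have i2: "integrable period_measure (\<lambda>t. (norm (h n t - P t))\<^sup>2)"
    using sqint_diff[OF h(1) sqint_trig_poly[OF P(1)]] by (simp add: sqint_def)
  have i3: "integrable period_measure (\<lambda>t. (norm (f t - P t))\<^sup>2)"
    using sqint_diff[OF f sqint_trig_poly[OF P(1)]] by (simp add: sqint_def)
  have "(LINT t|period_measure. (norm (f t - P t))\<^sup>2) \<le>
      (LINT t|period_measure. 2 * (norm (f t - h n t))\<^sup>2 + 2 * (norm (h n t - P t))\<^sup>2)"
  proof (intro integral_mono i3 Bochner_Integration.integrable_add integrable_mult_right i1 i2)
    fix t
    show "(norm (f t - P t))\<^sup>2 \<le> 2 * (norm (f t - h n t))\<^sup>2 + 2 * (norm (h n t - P t))\<^sup>2"
      using norm_add_square_le[of "f t - h n t" "h n t - P t"] by simp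
  qed
  also have "\<dots> = 2 * (LINT t|period_measure. (norm (f t - h n t))\<^sup>2) + 2 * (LINT t|period_measure. (norm (h n t - P t))\<^sup>2)"
    using i1 i2 by simp
  also have "\<dots> < \<epsilon>" using n P(2) by simp
  finally show "\<exists>P. trig_poly b P \<and> (LINT t|period_measure. (norm (f t - P t))\<^sup>2) < \<epsilon>"
    using P(1) by blast
qed

text \<open>Such an \<open>f\<close> descends to a continuous function on the unit circle, where the
  Stone--Weierstrass theorem applies.\<close>
lemma approx_trig_continuous:
  assumes cont: "continuous_on UNIV f" and \<eta>: "0 < \<eta>" "\<eta> < b / 2"
    and zero: "\<And>t. t \<notin> {\<eta>..b - \<eta>} \<Longrightarrow> f t = 0"
  shows "approx_trig f"
  unfolding approx_trig_def
proof (intro allI impI)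
  fix \<epsilon> :: real assume \<epsilon>: "\<epsilon> > 0"
  \<comment> \<open>The function induced on the circle: the angle 2 * pi * t / b is turned back into
    t.\<close>
  define H where "H z = f (b * Arg2pi z / (2 * pi))" for z
  have Arg: "Arg2pi (cis (2 * pi * t / b)) = 2 * pi * t / b" if "t \<in> {0..<b}" for t
    by (rule Arg2pi_unique[of 1]) (use that b in \<open>auto simp: cis_conv_exp field_simps\<close>)
  have H: "H (cis (2 * pi * t / b)) = f t" if "t \<in> {0..<b}" for t
    using that b by (simp add: H_def Arg)
  have "continuous_on (sphere 0 1) H"
    unfolding continuous_on_eq_continuous_within
  proof
    fix z :: complex assume z: "z \<in> sphere 0 1"
    show "continuous (at z within sphere 0 1) H"
    \<comment> \<open>\<open>Arg2pi\<close> jumps across the nonnegative reals, which meet the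
      circle in 1 alone. There continuity comes instead from f vanishing near both ends of the
      period, which makes \<open>H\<close> zero on the arc cut out by \<open>U\<close>.\<close>
    proof (cases "z \<in> \<real>\<^sub>\<ge>\<^sub>0")
      case False
      have "continuous (at z) H"
        unfolding H_def
        by (intro continuous_at_compose[of z "\<lambda>z. b * Arg2pi z / (2 * pi)" f, unfolded o_def]
          continuous_intros continuous_at_Arg2pi False)
          (use cont in \<open>auto simp: continuous_on_eq_continuous_at\<close>)
      then show ?thesis by (rule continuous_at_imp_continuous_at_within)
    next
      case True
      then have z1: "z = 1" using z
        by (metis dist_0_norm mem_sphere nonneg_Reals_cases norm_of_real of_real_1 abs_of_nonneg)
      define U where "U = {z. cos (2 * pi * \<eta> / b) < Re z}"
      have "open U" unfolding U_def by (rule open_halfspace_Re_gt)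
      have c1: "cos (2 * pi * \<eta> / b) < 1"
        using \<eta> b cos_monotone_0_pi[of 0 "2 * pi * \<eta> / b"] by (simp add: field_simps)
      have HU: "H y = 0" if "y \<in> U" "norm y = 1" for y
      proof -
        define \<theta> where "\<theta> = Arg2pi y"
        have \<theta>: "0 \<le> \<theta>" "\<theta> < 2 * pi" "Re y = cos \<theta>"
          using Arg2pi[of y] cos_Arg2pi[of y] that by (auto simp: \<theta>_def)
        have "\<not> (2 * pi * \<eta> / b \<le> \<theta> \<and> \<theta> \<le> 2 * pi - 2 * pi * \<eta> / b)"
        proof
          assume *: "2 * pi * \<eta> / b \<le> \<theta> \<and> \<theta> \<le> 2 * pi - 2 * pi * \<eta> / b"
          have e: "0 \<le> 2 * pi * \<eta> / b" "2 * pi * \<eta> / b \<le> pi" using \<eta> b by (auto simp: field_simps)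
          have "cos \<theta> \<le> cos (2 * pi * \<eta> / b)"
          proof (cases "\<theta> \<le> pi")
            case True
            then show ?thesis using * e by (intro cos_monotone_0_pi_le) auto
          next
            case False
            then have "cos (2 * pi - \<theta>) \<le> cos (2 * pi * \<eta> / b)"
              using * e \<theta> by (intro cos_monotone_0_pi_le) auto
            then show ?thesis by simp
          qed
          then show False using that(1) \<theta>(3) by (simp add: U_def)
        qed
        then have "b * \<theta> / (2 * pi) \<notin> {\<eta>..b - \<eta>}"
          using b by (auto simp: field_simps)
        then show ?thesis using zero by (simp add: H_def \<theta>_def)
      qed
      have "continuous (at z within sphere 0 1) (\<lambda>_. 0 :: complex)" by simp
      moreover have "\<forall>\<^sub>F y in at z within sphere 0 1. H y = 0"
        using eventually_at_in_open[OF \<open>open U\<close>, of z] c1 HU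
        unfolding eventually_at_filter by (auto simp: U_def z1 elim!: eventually_mono)
      moreover have "H z = 0" using HU[of z] c1 by (simp add: z1 U_def)
      ultimately show ?thesis
        unfolding continuous_within by (auto intro: tendsto_eventually)
    qed
  qed
  \<comment> \<open>The bound is chosen so that its square, integrated over a period of length b,
    gives \<epsilon> / 2.\<close>
  then obtain g where g: "polynomial_function g" "\<And>z. z \<in> sphere 0 1 \<Longrightarrow> norm (H z - g z) < sqrt (\<epsilon> / (2 * b))"
    using Stone_Weierstrass_polynomial_function[of "sphere 0 1" H "sqrt (\<epsilon> / (2 * b))"] \<epsilon> b by auto
  define P where "P t = g (cis (2 * pi * t / b))" for t
  have "real_polynomial_function (\<lambda>z. Re (g z))" "real_polynomial_function (\<lambda>z. Im (g z))"
    using g(1) bounded_linear_Re bounded_linear_Im unfolding polynomial_function_def o_def by blast+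
  then have "trig_poly b (\<lambda>t. complex_of_real (Re (P t)) + \<i> * complex_of_real (Im (P t)))"
    unfolding P_def by (intro trig_poly.add trig_poly_mult trig_poly_const trig_poly_real_polynomial)
  then have P: "trig_poly b P" by (simp flip: complex_eq)
  interpret finite_measure period_measure by (rule finite_measure_period)
  have "sqint period_measure f"
  proof -
    have "bounded (f ` {0..b})"
      by (intro compact_imp_bounded compact_continuous_image continuous_on_subset[OF cont]) auto
    then obtain B where "\<forall>z\<in>f ` {0..b}. norm z \<le> B" unfolding bounded_iff by blast
    then show ?thesis
      using cont by (intro sqint_bounded[where B = B] borel_measurable_continuous_onI) auto
  qed
  then have int: "integrable period_measure (\<lambda>t. (norm (f t - P t))\<^sup>2)"
    using sqint_diff[OF _ sqint_trig_poly[OF P]] by (simp add: sqint_def)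
  have "(LINT t|period_measure. (norm (f t - P t))\<^sup>2) \<le> (LINT t|period_measure. \<epsilon> / (2 * b))"
  proof (intro integral_mono int)
    fix t assume "t \<in> space period_measure"
    then have t: "t \<in> {0..<b}" by (simp add: space_restrict_space)
    have "norm (f t - P t) < sqrt (\<epsilon> / (2 * b))"
      using g(2)[of "cis (2 * pi * t / b)"] H[OF t] by (simp add: P_def)
    then have "(norm (f t - P t))\<^sup>2 \<le> (sqrt (\<epsilon> / (2 * b)))\<^sup>2"
      by (intro power_mono) auto
    then show "(norm (f t - P t))\<^sup>2 \<le> \<epsilon> / (2 * b)" using \<epsilon> b by simp
  qed auto
  also have "\<dots> = \<epsilon> / 2"
    using b by (simp add: space_restrict_space emeasure_period measure_def)
  also have "\<dots> < \<epsilon>" using \<epsilon> by simp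
  finally show "\<exists>P. trig_poly b P \<and> (LINT t|period_measure. (norm (f t - P t))\<^sup>2) < \<epsilon>"
    using P by blast
qed

text \<open>A measurable function is an almost everywhere limit of continuous ones, but these may be
  unbounded and need not vanish near the ends of the period. Both defects are repaired without
  losing continuity, after which dominated convergence applies.\<close>

lemma approx_trig_bounded:
  assumes f: "f \<in> borel_measurable borel" and B: "\<And>t. norm (f t) \<le> B"
  shows "approx_trig f"
proof -
  have B0: "0 \<le> B" using B[of 0] norm_ge_zero order_trans by blast
  have "f \<in> borel_measurable lebesgue"
    using f by (intro measurable_completion) simp
  then have "f measurable_on UNIV"
    by (subst measurable_on_iff_borel_measurable) auto
  then obtain N g where N: "negligible N" and g: "\<And>n. continuous_on UNIV (g n)"
    and lim: "\<And>x. x \<notin> N \<Longrightarrow> (\<lambda>n. g n x) \<longlonglongrightarrow> f x"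
    unfolding measurable_on_def by auto
  \<comment> \<open>Nearest-point retraction onto the ball of radius \<open>B\<close>: continuous,
    bounded by \<open>B\<close>, and the identity on the values of f.\<close>
  define clip where "clip = closest_point (cball (0::complex) B)"
  have clip_cont: "continuous_on S clip" for S
    unfolding clip_def using B0 by (intro continuous_on_closest_point) auto
  have clip_norm: "norm (clip z) \<le> B" for z
    using closest_point_in_set[of "cball (0::complex) B" z] B0 by (auto simp: clip_def)
  have clip_self: "clip (f t) = f t" for t
    unfolding clip_def using B by (intro closest_point_self) auto
  \<comment> \<open>A trapezoid: 0 within 1/n of either end of the period, 1 at distance 2/n or more
    from both.\<close>
  define \<psi> where "\<psi> n t = max 0 (min 1 (min (real n * t - 1) (real n * (b - t) - 1)))" for n t
  define h where "h n t = complex_of_real (\<psi> n t) * clip (g n t)" for n t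
  have \<psi>01: "0 \<le> \<psi> n t" "\<psi> n t \<le> 1" for n t by (auto simp: \<psi>_def)
  have h_cont: "continuous_on UNIV (h n)" for n
    unfolding h_def \<psi>_def
    by (intro continuous_intros continuous_on_compose2[OF clip_cont[of UNIV] g]) auto
  have h_norm: "norm (h n t) \<le> B" for n t
  proof -
    have "norm (h n t) \<le> 1 * B"
      unfolding h_def norm_mult using \<psi>01[of n t] clip_norm by (intro mult_mono) auto
    then show ?thesis by simp
  qed
  have h_meas: "h n \<in> borel_measurable borel" for n
    by (intro borel_measurable_continuous_onI h_cont)
  have h_sq: "sqint period_measure (h n)" for n
    using h_meas h_norm by (rule sqint_bounded)
  \<comment> \<open>Beyond this index the margins 1/n are shorter than half a period, as
    \<open>approx_trig_continuous\<close> requires.\<close>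
  obtain n0 :: nat where n0: "n0 > 2 / b" using reals_Archimedean2 by blast
  have h_app: "approx_trig (h (n + Suc n0))" for n
  proof -
    define m where "m = n + Suc n0"
    have "2 / b < real m" using n0 by (simp add: m_def)
    then have m: "real m * b > 2" "0 < m" using b by (auto simp: field_simps intro: ccontr)
    have "approx_trig (h m)"
    proof (rule approx_trig_continuous[OF h_cont, of "1 / real m"])
      fix t assume t: "t \<notin> {1 / real m..b - 1 / real m}"
      have "real m * t < 1 \<or> real m * (b - t) < 1"
        using t m(2) by (auto simp: field_simps)
      then show "h m t = 0" by (auto simp: h_def \<psi>_def)
    qed (use m in \<open>auto simp: field_simps\<close>)
    then show ?thesis by (simp add: m_def)
  qed
  have AEN: "AE t in lborel. t \<notin> N"
  proof -
    have "AE t in lebesgue. t \<notin> N" using N by (intro AE_not_in) (simp add: negligible_iff_null_sets)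
    then show ?thesis by (simp add: AE_completion_iff)
  qed
  have "(\<lambda>n. LINT t|period_measure. (norm (f t - h (n + Suc n0) t))\<^sup>2) \<longlonglongrightarrow> (LINT t|period_measure. 0)"
  proof (rule integral_dominated_convergence[where w = "\<lambda>_. (2 * B)\<^sup>2"])
    interpret finite_measure period_measure by (rule finite_measure_period)
    show "integrable period_measure (\<lambda>_. (2 * B)\<^sup>2)" by simp
    have [measurable]: "f \<in> borel_measurable period_measure" "h n \<in> borel_measurable period_measure" for n
      using f h_meas by (auto intro: borel_measurable_period)
    show "(\<lambda>t. (norm (f t - h (n + Suc n0) t))\<^sup>2) \<in> borel_measurable period_measure" for n
      by measurable
    show "AE t in period_measure. norm ((norm (f t - h (n + Suc n0) t))\<^sup>2) \<le> (2 * B)\<^sup>2" for n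
    proof (intro AE_I2)
      fix t
      have "norm (f t - h (n + Suc n0) t) \<le> B + B"
        by (rule norm_triangle_le_diff) (intro add_mono B h_norm)
      then have "(norm (f t - h (n + Suc n0) t))\<^sup>2 \<le> (2 * B)\<^sup>2" by (intro power_mono) auto
      then show "norm ((norm (f t - h (n + Suc n0) t))\<^sup>2) \<le> (2 * B)\<^sup>2" by simp
    qed
    have "AE t in lborel. t \<in> {0..<b} \<longrightarrow> (\<lambda>n. (norm (f t - h (n + Suc n0) t))\<^sup>2) \<longlonglongrightarrow> 0"
      using AEN AE_lborel_singleton[of 0]
    proof eventually_elim
      case (elim t)
      show ?case
      proof
        assume "t \<in> {0..<b}"
        then have t: "0 < t" "t < b" using elim by auto
        have "filterlim (\<lambda>n. real n * t) at_top sequentially" "filterlim (\<lambda>n. real n * (b - t)) at_top sequentially"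
          using t by (simp_all add: filterlim_at_top_mult_tendsto_pos[OF tendsto_const _ filterlim_real_sequentially])
        then have "\<forall>\<^sub>F n in sequentially. 2 \<le> real n * t" "\<forall>\<^sub>F n in sequentially. 2 \<le> real n * (b - t)"
          unfolding filterlim_at_top by blast+
        then have "\<forall>\<^sub>F n in sequentially. \<psi> n t = 1"
          by eventually_elim (auto simp: \<psi>_def)
        then have "(\<lambda>n. \<psi> n t) \<longlonglongrightarrow> 1" by (rule tendsto_eventually)
        moreover have "(\<lambda>n. clip (g n t)) \<longlonglongrightarrow> clip (f t)"
          using elim lim clip_cont[of UNIV] by (intro continuous_on_tendsto_compose[of UNIV clip]) auto
        ultimately have "(\<lambda>n. h n t) \<longlonglongrightarrow> complex_of_real 1 * clip (f t)"
          unfolding h_def by (intro tendsto_intros)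
        then have "(\<lambda>n. h n t) \<longlonglongrightarrow> f t" by (simp add: clip_self)
        then have "(\<lambda>n. (norm (f t - h n t))\<^sup>2) \<longlonglongrightarrow> (norm (f t - f t))\<^sup>2"
          by (intro tendsto_intros)
        then have "(\<lambda>n. (norm (f t - h n t))\<^sup>2) \<longlonglongrightarrow> 0" by simp
        then show "(\<lambda>n. (norm (f t - h (n + Suc n0) t))\<^sup>2) \<longlonglongrightarrow> 0"
          by (rule LIMSEQ_ignore_initial_segment)
      qed
    qed
    then show "AE t in period_measure. (\<lambda>n. (norm (f t - h (n + Suc n0) t))\<^sup>2) \<longlonglongrightarrow> 0"
      by (subst AE_restrict_space_iff) auto
  qed simp
  then show ?thesis
    using approx_trig_limit[OF sqint_bounded[OF f B], of "\<lambda>n. h (n + Suc n0)"] h_sq h_app by simp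
qed

lemma approx_trig_sqint:
  assumes f: "f \<in> borel_measurable borel" and sq: "sqint period_measure f"
  shows "approx_trig f"
proof (rule approx_trig_limit[OF sq])
  define h where "h n t = (if norm (f t) \<le> real n then f t else 0)" for n t
  have h_meas: "h n \<in> borel_measurable borel" for n
    unfolding h_def using f by measurable
  have h_norm: "norm (h n t) \<le> real n" for n t by (simp add: h_def)
  show "sqint period_measure (h n)" for n using h_meas h_norm by (rule sqint_bounded)
  show "approx_trig (h n)" for n using h_meas h_norm by (rule approx_trig_bounded)
  have "(\<lambda>n. LINT t|period_measure. (norm (f t - h n t))\<^sup>2) \<longlonglongrightarrow> (LINT t|period_measure. 0)"
  proof (rule integral_dominated_convergence[where w = "\<lambda>t. (norm (f t))\<^sup>2"])
    show "integrable period_measure (\<lambda>t. (norm (f t))\<^sup>2)" using sq by (simp add: sqint_def)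
    have [measurable]: "f \<in> borel_measurable period_measure" "h n \<in> borel_measurable period_measure" for n
      using f h_meas by (auto intro: borel_measurable_period)
    show "(\<lambda>t. (norm (f t - h n t))\<^sup>2) \<in> borel_measurable period_measure" for n
      by measurable
    show "AE t in period_measure. norm ((norm (f t - h n t))\<^sup>2) \<le> (norm (f t))\<^sup>2" for n
      by (intro AE_I2) (simp add: h_def)
    show "AE t in period_measure. (\<lambda>n. (norm (f t - h n t))\<^sup>2) \<longlonglongrightarrow> 0"
    proof (intro AE_I2)
      fix t
      obtain k :: nat where k: "norm (f t) \<le> k" using real_arch_simple by blast
      have "\<forall>\<^sub>F n in sequentially. (norm (f t - h n t))\<^sup>2 = 0"
        using eventually_ge_at_top[of k] by eventually_elim (use k in \<open>simp add: h_def\<close>)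
      then show "(\<lambda>n. (norm (f t - h n t))\<^sup>2) \<longlonglongrightarrow> 0" by (rule tendsto_eventually)
    qed
  qed simp
  then show "(\<lambda>n. LINT t|period_measure. (norm (f t - h n t))\<^sup>2) \<longlonglongrightarrow> 0" by simp
qed

theorem fourier_Parseval:
  assumes f: "f \<in> borel_measurable borel" and "integrable lborel (\<lambda>t. (norm (f t))\<^sup>2)"
    and zero: "\<And>t. t \<notin> {0..<b} \<Longrightarrow> f t = 0"
  shows "((\<lambda>n. (norm (LINT t|lborel. f t * cnj (fourier b n t)))\<^sup>2)
    has_sum b * (LINT t|lborel. (norm (f t))\<^sup>2)) UNIV"
proof -
  interpret orthogonal_system period_measure "fourier b" b by (rule fourier_orthogonal)
  have ind: "indicator {0..<b} t *\<^sub>R f t = f t" for t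
    using zero[of t] by (auto simp: indicator_def)
  have ind2: "indicat_real {0..<b} t * (norm (f t))\<^sup>2 = (norm (f t))\<^sup>2" for t
    using zero[of t] by (auto simp: indicator_def)
  have sqf: "sqint period_measure f"
    unfolding sqint_def using f assms(2)
    by (auto intro: borel_measurable_period simp: integrable_restrict_space ind2)
  have "((\<lambda>j. (norm (LINT x|period_measure. f x * cnj (fourier b j x)))\<^sup>2)
      has_sum b * (LINT x|period_measure. (norm (f x))\<^sup>2)) UNIV"
  proof (rule Parseval[OF sqf])
    fix \<epsilon> :: real assume "\<epsilon> > 0"
    then obtain P where P: "trig_poly b P" "(LINT t|period_measure. (norm (f t - P t))\<^sup>2) < \<epsilon>"
      using approx_trig_sqint[OF f sqf] unfolding approx_trig_def by blast
    from P(1) obtain J c where "finite J" "P = (\<lambda>t. \<Sum>n\<in>J. c n * fourier b n t)"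
      by (rule trig_poly_explicit)
    then show "\<exists>J c. finite J \<and> (LINT t|period_measure. (norm (f t - (\<Sum>j\<in>J. c j * fourier b j t)))\<^sup>2) < \<epsilon>"
      using P(2) by blast
  qed
  moreover have "(LINT x|period_measure. (norm (f x))\<^sup>2) = (LINT t|lborel. (norm (f t))\<^sup>2)"
    by (simp add: integral_restrict_space ind2)
  moreover have "(LINT x|period_measure. f x * cnj (fourier b j x)) = (LINT t|lborel. f t * cnj (fourier b j t))" for j
    by (simp add: integral_restrict_space ind flip: mult_scaleR_left)
  ultimately show ?thesis by simp
qed

end

section \<open>The frame operator of the indicator of an interval\<close>

lemma card_ints_between:
  fixes a x y :: real
  assumes "0 < a" "x \<le> y"
  shows "finite {m::int. x \<le> of_int m * a \<and> of_int m * a \<le> y}"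
    and "real (card {m::int. x \<le> of_int m * a \<and> of_int m * a \<le> y}) \<le> (y - x) / a + 1"
proof -
  have eq: "{m::int. x \<le> of_int m * a \<and> of_int m * a \<le> y} = {\<lceil>x / a\<rceil>..\<lfloor>y / a\<rfloor>}"
    using assms(1) by (auto simp: ceiling_le_iff le_floor_iff field_simps)
  show "finite {m::int. x \<le> of_int m * a \<and> of_int m * a \<le> y}" unfolding eq by simp
  have "real_of_int (\<lfloor>y / a\<rfloor> - \<lceil>x / a\<rceil> + 1) \<le> y / a - x / a + 1"
    using of_int_floor_le[of "y / a"] le_of_int_ceiling[of "x / a"] by simp linarith
  moreover have "0 \<le> (y - x) / a" using assms by simp
  ultimately show "real (card {m::int. x \<le> of_int m * a \<and> of_int m * a \<le> y}) \<le> (y - x) / a + 1"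
    unfolding eq by (simp add: diff_divide_distrib)
qed

lemma norm_sum_square_le:
  fixes f :: "'i \<Rightarrow> 'b::real_normed_vector"
  shows "(norm (\<Sum>i\<in>A. f i))\<^sup>2 \<le> real (card A) * (\<Sum>i\<in>A. (norm (f i))\<^sup>2)"
proof -
  have "(norm (\<Sum>i\<in>A. f i))\<^sup>2 \<le> (\<Sum>i\<in>A. norm (f i))\<^sup>2"
    by (intro power_mono norm_sum) auto
  also have "\<dots> \<le> (\<Sum>i\<in>A. (norm (f i))\<^sup>2) * real (card A)"
    by (rule sum_squared_le_sum_of_squares)
  finally show ?thesis by (simp add: mult.commute)
qed

lemma summable_on_product_nonneg:
  fixes f :: "'a \<times> 'b \<Rightarrow> real"
  assumes nonneg: "\<And>x. 0 \<le> f x"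
    and row: "\<And>x. ((\<lambda>y. f (x, y)) has_sum g x) UNIV"
    and g: "g summable_on UNIV"
  shows "f summable_on UNIV" and "infsum f UNIV = infsum g UNIV"
proof -
  have g0: "0 \<le> g x" for x
    using row[of x] nonneg by (intro has_sum_nonneg[OF row]) auto
  have bound: "sum f F \<le> infsum g UNIV" if "finite F" for F
  proof -
    have "sum f F \<le> sum f (fst ` F \<times> snd ` F)"
      using that nonneg by (intro sum_mono2) (auto intro: rev_image_eqI)
    also have "\<dots> = (\<Sum>x\<in>fst ` F. \<Sum>y\<in>snd ` F. f (x, y))"
      by (simp add: sum.cartesian_product)
    also have "\<dots> \<le> (\<Sum>x\<in>fst ` F. g x)"
      using that nonneg by (intro sum_mono finite_sum_le_has_sum[OF row]) auto
    also have "\<dots> \<le> infsum g UNIV"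
      using that g0 by (intro finite_sum_le_infsum[OF g]) auto
    finally show ?thesis .
  qed
  show s: "f summable_on UNIV"
    using nonneg bound by (intro nonneg_bdd_above_summable_on bdd_aboveI[where M = "infsum g UNIV"]) auto
  have "(f has_sum infsum g UNIV) (UNIV \<times> UNIV)"
    by (rule has_sum_SigmaI[OF row]) (use g s in \<open>auto intro: has_sum_infsum\<close>)
  then show "infsum f UNIV = infsum g UNIV" by (simp add: infsumI)
qed

section \<open>Periodization of windowed functions and the frame sum\<close>

definition chunk_count :: "real \<Rightarrow> real \<Rightarrow> nat" where
  "chunk_count b c = nat \<lceil>c / b\<rceil>"

lemma fourier_periodic:
  assumes "b \<noteq> 0"
  shows "fourier b n (t + of_int j * b) = fourier b n t"
proof -
  have "- (2 * pi * of_int n * (t + of_int j * b) / b) = 2 * pi * of_int (- n * j) + - (2 * pi * of_int n * t / b)"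
    using assms by (simp add: field_simps)
  then show ?thesis
    using cis_multiple_2pi[of "of_int (- n * j)"] unfolding fourier_def
    by (simp only: cis_mult[symmetric] Ints_of_int mult_1_left simp_thms)
qed

lemma sum_indicator_chunks:
  assumes "0 \<le> b"
  shows "(\<Sum>j<K. indicator {real j * b..<real j * b + b} s) = (indicator {0..<real K * b} s :: complex)"
proof (induction K)
  case (Suc K)
  define x where "x = real K * b"
  have x: "0 \<le> x" "real (Suc K) * b = x + b" using assms by (simp_all add: x_def distrib_right)
  then have "indicator {0..<real (Suc K) * b} s = indicator {0..<x} s + (indicator {x..<x + b} s :: complex)"
    using assms by (auto simp: indicator_def)
  then show ?case
    using Suc by (simp flip: x_def)
qed simp

lemma le_chunk_count: "0 < b \<Longrightarrow> c \<le> real (chunk_count b c) * b"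
  using of_nat_ceiling[of "c / b"] by (simp add: chunk_count_def field_simps)

text \<open>The part of f in the window \<open>[m * a, m * a + c)\<close> is moved to start at 0,
  and its pieces of length b are stacked over one period. Modulations have period b and cannot
  distinguish stacked points. The value 0 outside the period makes \<open>fourier_Parseval\<close>
  applicable on the whole line.\<close>

definition periodized :: "real \<Rightarrow> real \<Rightarrow> real \<Rightarrow> (real \<Rightarrow> complex) \<Rightarrow> int \<Rightarrow> real \<Rightarrow> complex" where
  "periodized a b c f m t = (if t \<in> {0..<b} then
     \<Sum>j<chunk_count b c. f (of_int m * a + (t + real j * b)) * indicator {0..<c} (t + real j * b) else 0)"

locale gabor_parameters =
  fixes a b c :: real
  assumes a: "0 < a" and b: "0 < b" and c: "0 < c"
begin

abbreviation "G \<equiv> periodized a b c"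
abbreviation "\<phi> \<equiv> (indicator {0..<c} :: real \<Rightarrow> complex)"

lemma borel_measurable_periodized:
  assumes [measurable]: "f \<in> borel_measurable borel"
  shows "G f m \<in> borel_measurable borel"
  unfolding periodized_def by measurable

lemma sqint_window:
  assumes "square_integrable f"
  shows "sqint lborel (\<lambda>s. f (x + s) * \<phi> s)"
proof -
  have [measurable]: "f \<in> borel_measurable borel" using assms by (simp add: square_integrable_def)
  have "integrable lborel (\<lambda>s. (norm (f (x + 1 * s)))\<^sup>2)"
    using assms unfolding square_integrable_def by (intro lborel_integrable_real_affine) auto
  then have "integrable lborel (\<lambda>s. (norm (f (x + s) * \<phi> s))\<^sup>2)"
    by (rule Bochner_Integration.integrable_bound) (auto simp: indicator_def)
  then show ?thesis by (simp add: sqint_def)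
qed

text \<open>Moving the window to the origin multiplies the inner product by a phase of modulus one,
  hence a statement about norms. Cutting the integral into \<open>K\<close> pieces of length b and
  using the period of the characters then stacks the pieces.\<close>

lemma l2_inner_atom:
  assumes f: "square_integrable f"
  shows "norm (l2_inner f (gabor_atom \<phi> a b m n)) = norm (LINT t|lborel. G f m t * cnj (fourier b n t))"
proof -
  define F where "F s = f (of_int m * a + s) * \<phi> s" for s
  have F: "sqint lborel F" unfolding F_def by (rule sqint_window[OF f])
  have per: "fourier b n (s + real j * b) = fourier b n s" for s j
    using fourier_periodic[of b n s "int j"] b by simp
  define K where "K = chunk_count b c"
  have cK: "c \<le> real K * b" unfolding K_def by (rule le_chunk_count[OF b])
  have ph: "sqint lborel (\<lambda>s. \<phi> s * fourier b n s)"
  proof -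
    have "integrable lborel (\<lambda>s. (norm (\<phi> s * fourier b n s))\<^sup>2)"
      by (rule Bochner_Integration.integrable_bound[where f = "indicat_real {0..<c}"])
         (use c in \<open>auto simp: indicator_def norm_mult intro!: integrable_real_indicator\<close>)
    then show ?thesis by (simp add: sqint_def)
  qed
  have intF: "integrable lborel (\<lambda>s. F s * cnj (fourier b n s))"
  proof -
    have "F s * cnj (\<phi> s * fourier b n s) = F s * cnj (fourier b n s)" for s
      by (auto simp: F_def indicator_def)
    then show ?thesis using integrable_mult_cnj[OF F ph] by (simp only:)
  qed
  have intFj: "integrable lborel (\<lambda>s. indicator {x..<y} s * (F s * cnj (fourier b n s)))" for x y
    by (rule Bochner_Integration.integrable_bound[OF intF])
       (use F in \<open>auto simp: sqint_def indicator_def norm_mult\<close>)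
  have "l2_inner f (gabor_atom \<phi> a b m n)
      = (LINT t|lborel. f t * (cnj (fourier b n t) * \<phi> (t - of_int m * a)))"
    unfolding l2_inner_def gabor_atom_def
    by (intro Bochner_Integration.integral_cong)
       (auto simp: fourier_def cis_conv_exp exp_cnj indicator_def mult_ac)
  also have "\<dots> = (LINT s|lborel. f (of_int m * a + 1 * s) *
      (cnj (fourier b n (of_int m * a + 1 * s)) * \<phi> (of_int m * a + 1 * s - of_int m * a)))"
    by (subst lborel_integral_real_affine[where c = 1 and t = "of_int m * a"]) auto
  also have "\<dots> = (LINT s|lborel. cnj (fourier b n (of_int m * a)) * (F s * cnj (fourier b n s)))"
    by (intro Bochner_Integration.integral_cong)
       (auto simp: F_def fourier_def cis_cnj cis_mult add_divide_distrib distrib_left add.commute)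
  also have "\<dots> = cnj (fourier b n (of_int m * a)) * (LINT s|lborel. F s * cnj (fourier b n s))"
    by simp
  also have "(LINT s|lborel. F s * cnj (fourier b n s))
      = (LINT s|lborel. (\<Sum>j<K. indicator {real j * b..<real j * b + b} s * (F s * cnj (fourier b n s))))"
  proof (intro Bochner_Integration.integral_cong refl)
    fix s
    have "(\<Sum>j<K. indicator {real j * b..<real j * b + b} s) = (1::complex)" if "F s \<noteq> 0"
      unfolding sum_indicator_chunks[OF less_imp_le[OF b]]
      using that cK by (auto simp: F_def indicator_def split: if_splits)
    then show "F s * cnj (fourier b n s)
        = (\<Sum>j<K. indicator {real j * b..<real j * b + b} s * (F s * cnj (fourier b n s)))"
      by (cases "F s = 0") (simp_all flip: sum_distrib_right)
  qed
  also have "\<dots> = (\<Sum>j<K. LINT s|lborel. indicator {real j * b..<real j * b + b} s * (F s * cnj (fourier b n s)))"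
    by (intro Bochner_Integration.integral_sum intFj)
  also have "\<dots> = (\<Sum>j<K. LINT s|lborel. indicator {0..<b} s * (F (s + real j * b) * cnj (fourier b n s)))"
  proof (intro sum.cong refl)
    fix j
    show "(LINT s|lborel. indicator {real j * b..<real j * b + b} s * (F s * cnj (fourier b n s)))
      = (LINT s|lborel. indicator {0..<b} s * (F (s + real j * b) * cnj (fourier b n s)))"
      by (subst lborel_integral_real_affine[where c = 1 and t = "real j * b"])
         (auto simp: per add.commute indicator_def intro!: Bochner_Integration.integral_cong)
  qed
  also have "\<dots> = (LINT s|lborel. (\<Sum>j<K. indicator {0..<b} s * (F (s + real j * b) * cnj (fourier b n s))))"
  proof (subst Bochner_Integration.integral_sum)
    fix j
    have "integrable lborel (\<lambda>s. (\<lambda>s. indicator {real j * b..<real j * b + b} s * (F s * cnj (fourier b n s))) (real j * b + 1 * s))"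
      by (rule lborel_integrable_real_affine[OF intFj]) simp
    moreover have "(\<lambda>s. (\<lambda>s. indicator {real j * b..<real j * b + b} s * (F s * cnj (fourier b n s))) (real j * b + 1 * s))
      = (\<lambda>s. indicator {0..<b} s * (F (s + real j * b) * cnj (fourier b n s)))"
      by (auto simp: indicator_def per add.commute fun_eq_iff)
    ultimately show "integrable lborel (\<lambda>s. indicator {0..<b} s * (F (s + real j * b) * cnj (fourier b n s)))"
      by (simp only:)
  qed simp
  also have "\<dots> = (LINT t|lborel. G f m t * cnj (fourier b n t))"
  proof (intro Bochner_Integration.integral_cong refl)
    fix t
    show "(\<Sum>j<K. indicator {0..<b} t * (F (t + real j * b) * cnj (fourier b n t))) = G f m t * cnj (fourier b n t)"
    proof (cases "t \<in> {0..<b}")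
      case True
      then show ?thesis
        by (simp only: periodized_def if_True indicator_simps F_def K_def sum_distrib_right mult_1_left)
    qed (auto simp: periodized_def)
  qed
  finally show ?thesis by (simp add: norm_mult)
qed

lemma periodized_norm_le:
  "(norm (G f m t))\<^sup>2 \<le> real (chunk_count b c) *
     (\<Sum>j<chunk_count b c. (norm (f (of_int m * a + (t + real j * b)) * \<phi> (t + real j * b)))\<^sup>2 * indicator {0..<b} t)"
proof (cases "t \<in> {0..<b}")
  case True
  show ?thesis
    using norm_sum_square_le[of "\<lambda>j. f (of_int m * a + (t + real j * b)) * \<phi> (t + real j * b)" "{..<chunk_count b c}"]
    by (simp only: periodized_def True if_True indicator_simps mult_1_right card_lessThan)
qed (auto simp: periodized_def intro!: mult_nonneg_nonneg sum_nonneg)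

text \<open>Cauchy-Schwarz over the stacked pieces costs one factor \<open>chunk_count b c\<close>;
  estimating each piece by the whole window costs the other.\<close>

lemma periodized_square:
  assumes f: "square_integrable f"
  shows "integrable lborel (\<lambda>t. (norm (G f m t))\<^sup>2)"
    and "(LINT t|lborel. (norm (G f m t))\<^sup>2) \<le> (real (chunk_count b c))\<^sup>2 *
      (LINT t|lborel. (norm (f t))\<^sup>2 * indicator {0..<c} (t - of_int m * a))"
proof -
  have [measurable]: "f \<in> borel_measurable borel" "G f m \<in> borel_measurable borel"
    using f borel_measurable_periodized by (auto simp: square_integrable_def)
  define F where "F s = f (of_int m * a + s) * \<phi> s" for s
  have F: "integrable lborel (\<lambda>s. (norm (F s))\<^sup>2)"
    using sqint_window[OF f] by (simp add: F_def sqint_def)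
  have Fs: "integrable lborel (\<lambda>s. (norm (F (real j * b + 1 * s)))\<^sup>2)" for j
    using F by (rule lborel_integrable_real_affine) simp
  have Fj: "integrable lborel (\<lambda>s. (norm (F (s + real j * b)))\<^sup>2 * indicator {0..<b} s)" for j
    by (rule Bochner_Integration.integrable_bound[OF Fs[of j]])
       (auto simp: indicator_def F_def add.commute)
  define R where "R t = real (chunk_count b c) *
     (\<Sum>j<chunk_count b c. (norm (F (t + real j * b)))\<^sup>2 * indicator {0..<b} t)" for t
  have R: "integrable lborel R" unfolding R_def
    by (intro integrable_mult_right Bochner_Integration.integrable_sum Fj)
  have GR: "(norm (G f m t))\<^sup>2 \<le> R t" for t
    using periodized_norm_le[of f m t] by (simp add: R_def F_def)
  show int: "integrable lborel (\<lambda>t. (norm (G f m t))\<^sup>2)"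
    by (rule Bochner_Integration.integrable_bound[OF R]) (use GR in \<open>auto intro: order_trans[OF _ abs_ge_self]\<close>)
  have "(LINT t|lborel. (norm (G f m t))\<^sup>2) \<le> (LINT t|lborel. R t)"
    by (intro integral_mono int R GR)
  also have "\<dots> = real (chunk_count b c) *
      (\<Sum>j<chunk_count b c. LINT t|lborel. (norm (F (t + real j * b)))\<^sup>2 * indicator {0..<b} t)"
    unfolding R_def by (simp only: integral_mult_right_zero Bochner_Integration.integral_sum[OF Fj])
  also have "\<dots> \<le> real (chunk_count b c) * (\<Sum>j<chunk_count b c. LINT s|lborel. (norm (F s))\<^sup>2)"
  proof (intro mult_left_mono sum_mono)
    fix j
    have "(LINT t|lborel. (norm (F (t + real j * b)))\<^sup>2 * indicator {0..<b} t)
        \<le> (LINT t|lborel. (norm (F (real j * b + 1 * t)))\<^sup>2)"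
      by (intro integral_mono Fj Fs) (auto simp: indicator_def add.commute)
    also have "\<dots> = (LINT s|lborel. (norm (F s))\<^sup>2)"
      by (subst (2) lborel_integral_real_affine[where c = 1 and t = "real j * b"]) auto
    finally show "(LINT t|lborel. (norm (F (t + real j * b)))\<^sup>2 * indicator {0..<b} t)
        \<le> (LINT s|lborel. (norm (F s))\<^sup>2)" .
  qed auto
  also have "\<dots> = (real (chunk_count b c))\<^sup>2 * (LINT s|lborel. (norm (F s))\<^sup>2)"
    by (simp add: power2_eq_square)
  also have "(LINT s|lborel. (norm (F s))\<^sup>2)
      = (LINT t|lborel. (norm (f t))\<^sup>2 * indicator {0..<c} (t - of_int m * a))"
    by (subst (2) lborel_integral_real_affine[where c = 1 and t = "of_int m * a"])
       (auto simp: F_def indicator_def norm_mult intro!: Bochner_Integration.integral_cong)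
  finally show "(LINT t|lborel. (norm (G f m t))\<^sup>2) \<le> (real (chunk_count b c))\<^sup>2 *
      (LINT t|lborel. (norm (f t))\<^sup>2 * indicator {0..<c} (t - of_int m * a))" .
qed

lemma atom_sum:
  assumes f: "square_integrable f"
  shows "((\<lambda>n. (norm (l2_inner f (gabor_atom \<phi> a b m n)))\<^sup>2)
    has_sum b * (LINT t|lborel. (norm (G f m t))\<^sup>2)) UNIV"
  unfolding l2_inner_atom[OF f]
  using f by (intro fourier_Parseval[OF b] borel_measurable_periodized periodized_square)
    (auto simp: square_integrable_def periodized_def)

text \<open>Each point lies in at most c / a + 1 windows, so the local masses of f add up to a
  multiple of its squared norm. This yields the upper frame bound, and only the lower one is at
  stake afterwards.\<close>

lemma periodized_sum_bound:
  assumes f: "square_integrable f" and J: "finite J"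
  shows "(\<Sum>m\<in>J. LINT t|lborel. (norm (G f m t))\<^sup>2) \<le> (real (chunk_count b c))\<^sup>2 * (c / a + 1) * l2_normsq f"
proof -
  have [measurable]: "f \<in> borel_measurable borel" using f by (auto simp: square_integrable_def)
  have sq: "integrable lborel (\<lambda>t. (norm (f t))\<^sup>2)" using f by (simp add: square_integrable_def)
  have im: "integrable lborel (\<lambda>t. (norm (f t))\<^sup>2 * indicator {0..<c} (t - of_int m * a))" for m
    by (rule Bochner_Integration.integrable_bound[OF sq]) (auto simp: indicator_def)
  have "(\<Sum>m\<in>J. LINT t|lborel. (norm (G f m t))\<^sup>2) \<le>
     (\<Sum>m\<in>J. (real (chunk_count b c))\<^sup>2 * (LINT t|lborel. (norm (f t))\<^sup>2 * indicator {0..<c} (t - of_int m * a)))"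
    by (intro sum_mono periodized_square(2) f)
  also have "\<dots> = (real (chunk_count b c))\<^sup>2 *
      (LINT t|lborel. (\<Sum>m\<in>J. (norm (f t))\<^sup>2 * indicator {0..<c} (t - of_int m * a)))"
    by (simp only: Bochner_Integration.integral_sum[OF im] sum_distrib_left)
  also have "\<dots> \<le> (real (chunk_count b c))\<^sup>2 * (LINT t|lborel. (c / a + 1) * (norm (f t))\<^sup>2)"
  proof (intro mult_left_mono integral_mono Bochner_Integration.integrable_sum im integrable_mult_right sq)
    fix t
    have "(\<Sum>m\<in>J. indicat_real {0..<c} (t - of_int m * a)) = real (card {m\<in>J. t - of_int m * a \<in> {0..<c}})"
      using J by (simp add: indicator_def sum.If_cases Int_def)
    also have "\<dots> \<le> real (card {m::int. t - c \<le> of_int m * a \<and> of_int m * a \<le> t})"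
      using a c by (intro of_nat_mono card_mono card_ints_between) auto
    also have "\<dots> \<le> c / a + 1" using card_ints_between(2)[of a "t - c" t] a c by simp
    finally have "(\<Sum>m\<in>J. indicat_real {0..<c} (t - of_int m * a)) \<le> c / a + 1" .
    then have "(norm (f t))\<^sup>2 * (\<Sum>m\<in>J. indicat_real {0..<c} (t - of_int m * a)) \<le> (norm (f t))\<^sup>2 * (c / a + 1)"
      by (intro mult_left_mono) auto
    then show "(\<Sum>m\<in>J. (norm (f t))\<^sup>2 * indicat_real {0..<c} (t - of_int m * a)) \<le> (c / a + 1) * (norm (f t))\<^sup>2"
      by (simp add: sum_distrib_left mult.commute)
  qed auto
  also have "\<dots> = (real (chunk_count b c))\<^sup>2 * (c / a + 1) * l2_normsq f"
    by (simp add: l2_normsq_def)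
  finally show ?thesis .
qed

lemma periodized_summable:
  assumes "square_integrable f"
  shows "(\<lambda>m. LINT t|lborel. (norm (G f m t))\<^sup>2) summable_on UNIV"
  using periodized_sum_bound[OF assms]
  by (intro nonneg_bdd_above_summable_on bdd_aboveI
      [where M = "(real (chunk_count b c))\<^sup>2 * (c / a + 1) * l2_normsq f"]) auto

lemma frame_sum:
  assumes f: "square_integrable f"
  shows "(\<lambda>(m,n). (norm (l2_inner f (gabor_atom \<phi> a b m n)))\<^sup>2) summable_on UNIV"
    and "infsum (\<lambda>(m,n). (norm (l2_inner f (gabor_atom \<phi> a b m n)))\<^sup>2) UNIV
      = b * infsum (\<lambda>m. LINT t|lborel. (norm (G f m t))\<^sup>2) UNIV"
  using summable_on_product_nonneg[of "\<lambda>(m,n). (norm (l2_inner f (gabor_atom \<phi> a b m n)))\<^sup>2"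
      "\<lambda>m. b * (LINT t|lborel. (norm (G f m t))\<^sup>2)"] atom_sum[OF f] periodized_summable[OF f]
  by (auto simp: infsum_cmult_right summable_on_cmult_right)

section \<open>Fibers of translates by multiples of b, and two criteria for the frame
  property\<close>

definition fiber_sum :: "(real \<Rightarrow> complex) \<Rightarrow> int \<Rightarrow> real \<Rightarrow> complex" where
  "fiber_sum h m t = (\<Sum>n | t + of_int n * b - of_int m * a \<in> {0..<c}. h (t + of_int n * b))"

text \<open>The points of the fiber of t that lie in window m give one row sum of a matrix attached
  to this fiber. Subtracting the multiple of b that brings t - m * a into the period exhibits it as
  a value of \<open>G\<close>.\<close>

lemma fiber_sum_eq_periodized:
  "fiber_sum h m t = G h m (t - of_int m * a - of_int \<lfloor>(t - of_int m * a) / b\<rfloor> * b)"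
proof -
  define l where "l = \<lfloor>(t - of_int m * a) / b\<rfloor>"
  define s where "s = t - of_int m * a - of_int l * b"
  have s: "0 \<le> s" "s < b"
    using floor_divide_lower[OF b, of "t - of_int m * a"] floor_divide_upper[OF b, of "t - of_int m * a"]
    by (auto simp: s_def l_def distrib_right)
  have cK: "c \<le> real (chunk_count b c) * b" by (rule le_chunk_count[OF b])
  have "G h m s = (\<Sum>j<chunk_count b c. if s + real j * b \<in> {0..<c} then h (of_int m * a + (s + real j * b)) else 0)"
  proof -
    have "G h m s = (\<Sum>j<chunk_count b c. h (of_int m * a + (s + real j * b)) * \<phi> (s + real j * b))"
      using s by (simp only: periodized_def atLeastLessThan_iff simp_thms if_True)
    also have "\<dots> = (\<Sum>j<chunk_count b c. if s + real j * b \<in> {0..<c} then h (of_int m * a + (s + real j * b)) else 0)"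
    proof (intro sum.cong refl)
      fix j
      show "h (of_int m * a + (s + real j * b)) * \<phi> (s + real j * b)
        = (if s + real j * b \<in> {0..<c} then h (of_int m * a + (s + real j * b)) else 0)"
        by (cases "s + real j * b \<in> {0..<c}") auto
    qed
    finally show ?thesis .
  qed
  also have "\<dots> = (\<Sum>j\<in>{j\<in>{..<chunk_count b c}. s + real j * b \<in> {0..<c}}. h (of_int m * a + (s + real j * b)))"
    by (rule sum.inter_filter[symmetric]) simp
  also have "\<dots> = fiber_sum h m t"
    unfolding fiber_sum_def
  proof (rule sum.reindex_bij_witness[where i = "\<lambda>n. nat (n + l)" and j = "\<lambda>j. int j - l"])
    fix n assume n: "n \<in> {n. t + of_int n * b - of_int m * a \<in> {0..<c}}"
    have eq: "t + of_int n * b - of_int m * a = s + of_int (n + l) * b"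
      by (simp add: s_def algebra_simps)
    have n1: "0 \<le> s + of_int (n + l) * b" "s + of_int (n + l) * b < c"
      using n by (simp_all only: eq mem_Collect_eq atLeastLessThan_iff)
    note n1(1)
    moreover have "of_int (n + l + 1) * b = of_int (n + l) * b + b" by (simp add: distrib_right)
    ultimately have "0 < of_int (n + l + 1) * b" using s by linarith
    then have nl: "0 \<le> n + l" using b by (simp add: zero_less_mult_iff)
    then have r: "real (nat (n + l)) = of_int (n + l)" by simp
    have "real (nat (n + l)) * b < real (chunk_count b c) * b"
      using n1(2) s cK unfolding r by linarith
    then have "nat (n + l) < chunk_count b c" using b by simp
    then show "nat (n + l) \<in> {j \<in> {..<chunk_count b c}. s + real j * b \<in> {0..<c}}"
      using n1 by (simp add: r del: of_int_add)
    show "int (nat (n + l)) - l = n" using nl by simp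
  qed (auto simp: s_def algebra_simps)
  finally show ?thesis by (simp add: s_def l_def)
qed

text \<open>A pointwise inverse with a uniform constant becomes a lower frame bound: square it,
  apply Cauchy-Schwarz, and integrate over t. The fixed radius \<rho> matters because it bounds the
  number of rows at each t and of translates of each \<open>G h m\<close>.\<close>

theorem frame_if_fiber_inversion:
  assumes inv: "\<And>h t. norm (h t) \<le> \<kappa> * (\<Sum>m | \<bar>of_int m * a - t\<bar> \<le> \<rho>. norm (fiber_sum h m t))"
    and \<kappa>: "0 \<le> \<kappa>" and \<rho>: "0 \<le> \<rho>"
  shows "gabor_frame \<phi> a b"
proof -
  \<comment> \<open>\<open>R\<close> bounds the number of rows within distance \<rho> of a point,
    and \<open>L\<close> the number of periods by which t - m * a can then be away from the base
    period. The summand 1 in \<open>D\<close> ensures positivity.\<close>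
  define R where "R = 2 * \<rho> / a + 1"
  define L where "L = \<lceil>\<rho> / b\<rceil> + 1"
  define D where "D = \<kappa>\<^sup>2 * R * of_int (2 * L + 1) + 1"
  define B where "B = b * ((real (chunk_count b c))\<^sup>2 * (c / a + 1))"
  have "0 \<le> \<rho> / b" using \<rho> b by simp
  then have "0 \<le> \<lceil>\<rho> / b\<rceil>" using ceiling_mono[of 0 "\<rho> / b"] by simp
  then have L0: "0 \<le> L" by (simp add: L_def)
  have R0: "0 \<le> R" using \<rho> a by (simp add: R_def)
  have D: "0 < D" using L0 R0 by (simp add: D_def add_nonneg_pos)
  have "0 < real (chunk_count b c) * b" using le_chunk_count[OF b, of c] c by linarith
  then have B: "0 < B" using a b c by (simp add: B_def zero_less_mult_iff add_pos_pos)
  have fin: "finite {m::int. \<bar>of_int m * a - t\<bar> \<le> \<rho>}"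
    and card: "real (card {m::int. \<bar>of_int m * a - t\<bar> \<le> \<rho>}) \<le> R" for t
  proof -
    have eq: "{m::int. \<bar>of_int m * a - t\<bar> \<le> \<rho>} = {m. t - \<rho> \<le> of_int m * a \<and> of_int m * a \<le> t + \<rho>}"
      by auto
    show "finite {m::int. \<bar>of_int m * a - t\<bar> \<le> \<rho>}"
      unfolding eq by (rule card_ints_between) (use a \<rho> in auto)
    show "real (card {m::int. \<bar>of_int m * a - t\<bar> \<le> \<rho>}) \<le> R"
      using card_ints_between(2)[of a "t - \<rho>" "t + \<rho>"] a \<rho> unfolding eq by (simp add: R_def)
  qed
  have pointwise: "(norm (h t))\<^sup>2 \<le> \<kappa>\<^sup>2 * R * (\<Sum>m | \<bar>of_int m * a - t\<bar> \<le> \<rho>. \<Sum>l=-L..L.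
      (norm (G h m (t - of_int m * a - of_int l * b)))\<^sup>2)" for h t
  proof -
    let ?J = "{m::int. \<bar>of_int m * a - t\<bar> \<le> \<rho>}"
    have "(norm (h t))\<^sup>2 \<le> (\<kappa> * (\<Sum>m\<in>?J. norm (fiber_sum h m t)))\<^sup>2"
      by (intro power_mono inv) auto
    also have "\<dots> \<le> \<kappa>\<^sup>2 * ((\<Sum>m\<in>?J. (norm (fiber_sum h m t))\<^sup>2) * real (card ?J))"
      unfolding power_mult_distrib by (intro mult_left_mono sum_squared_le_sum_of_squares) auto
    also have "\<dots> \<le> \<kappa>\<^sup>2 * ((\<Sum>m\<in>?J. (norm (fiber_sum h m t))\<^sup>2) * R)"
      by (intro mult_left_mono card sum_nonneg) auto
    also have "\<dots> = \<kappa>\<^sup>2 * R * (\<Sum>m\<in>?J. (norm (fiber_sum h m t))\<^sup>2)" by simp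
    \<comment> \<open>The floor in \<open>fiber_sum_eq_periodized\<close> depends on t. Summing over
      all values it may take leaves translates of \<open>G\<close> by constants, which can be
      integrated one by one.\<close>
    also have "\<dots> \<le> \<kappa>\<^sup>2 * R * (\<Sum>m\<in>?J. \<Sum>l=-L..L. (norm (G h m (t - of_int m * a - of_int l * b)))\<^sup>2)"
    proof (intro mult_left_mono sum_mono)
      fix m assume m: "m \<in> ?J"
      define l where "l = \<lfloor>(t - of_int m * a) / b\<rfloor>"
      define y where "y = (t - of_int m * a) / b"
      have "\<bar>y\<bar> \<le> \<rho> / b" using m b by (simp add: y_def abs_minus_commute divide_right_mono)
      then have "- L \<le> \<lfloor>y\<rfloor>" "\<lfloor>y\<rfloor> \<le> L" unfolding L_def by linarith+
      then have "l \<in> {-L..L}" by (simp add: l_def y_def)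
      then show "(norm (fiber_sum h m t))\<^sup>2 \<le> (\<Sum>l=-L..L. (norm (G h m (t - of_int m * a - of_int l * b)))\<^sup>2)"
        unfolding fiber_sum_eq_periodized l_def[symmetric]
        by (intro member_le_sum[of l "{-L..L}" "\<lambda>l. (norm (G h m (t - of_int m * a - of_int l * b)))\<^sup>2"]) auto
    qed (use R0 in auto)
    finally show ?thesis .
  qed
  have lower: "l2_normsq f \<le> D * infsum (\<lambda>m. LINT t|lborel. (norm (G f m t))\<^sup>2) UNIV"
    if f: "square_integrable f" for f
  proof -
    define I where "I m = (LINT t|lborel. (norm (G f m t))\<^sup>2)" for m
    define S where "S = infsum I UNIV"
    have I0: "0 \<le> I m" for m by (simp add: I_def)
    have S0: "0 \<le> S" unfolding S_def by (intro infsum_nonneg I0)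
    have sq: "integrable lborel (\<lambda>t. (norm (f t))\<^sup>2)" using f by (simp add: square_integrable_def)
    have [measurable]: "f \<in> borel_measurable borel" using f by (auto simp: square_integrable_def)
    have shift: "integrable lborel (\<lambda>t. (norm (G f m (t - of_int m * a - of_int l * b)))\<^sup>2)"
      "(LINT t|lborel. (norm (G f m (t - of_int m * a - of_int l * b)))\<^sup>2) = I m" for m l
    proof -
      have eq: "t - of_int m * a - of_int l * b = - (of_int m * a + of_int l * b) + 1 * t" for t :: real by simp
      show "integrable lborel (\<lambda>t. (norm (G f m (t - of_int m * a - of_int l * b)))\<^sup>2)"
        unfolding eq using periodized_square(1)[OF f] by (intro lborel_integrable_real_affine) auto
      show "(LINT t|lborel. (norm (G f m (t - of_int m * a - of_int l * b)))\<^sup>2) = I m"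
        unfolding eq I_def
        by (subst (2) lborel_integral_real_affine[where c = 1 and t = "- (of_int m * a + of_int l * b)"]) auto
    qed
    \<comment> \<open>On a bounded interval only the finitely many rows in \<open>J\<close> occur,
      so integral and sum may be exchanged; the interval is enlarged afterwards.\<close>
    have trunc: "(LINT t|lborel. indicator {- T..T} t * (norm (f t))\<^sup>2) \<le> D * S" if T: "0 \<le> T" for T
    proof -
      define J where "J = {m::int. - (\<rho> + T) \<le> of_int m * a \<and> of_int m * a \<le> \<rho> + T}"
      have J: "finite J" unfolding J_def by (rule card_ints_between) (use a \<rho> T in auto)
      have "(LINT t|lborel. indicator {- T..T} t * (norm (f t))\<^sup>2) \<le>
        (LINT t|lborel. \<kappa>\<^sup>2 * R * (\<Sum>m\<in>J. \<Sum>l=-L..L. (norm (G f m (t - of_int m * a - of_int l * b)))\<^sup>2))"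
      proof (intro integral_mono integrable_mult_right Bochner_Integration.integrable_sum shift)
        show "integrable lborel (\<lambda>t. indicator {- T..T} t * (norm (f t))\<^sup>2)"
          by (rule Bochner_Integration.integrable_bound[OF sq]) (auto simp: indicator_def)
        fix t
        show "indicator {- T..T} t * (norm (f t))\<^sup>2 \<le>
          \<kappa>\<^sup>2 * R * (\<Sum>m\<in>J. \<Sum>l=-L..L. (norm (G f m (t - of_int m * a - of_int l * b)))\<^sup>2)"
        proof (cases "t \<in> {- T..T}")
          case True
          note pointwise[of f t]
          also have "\<kappa>\<^sup>2 * R * (\<Sum>m | \<bar>of_int m * a - t\<bar> \<le> \<rho>. \<Sum>l=-L..L. (norm (G f m (t - of_int m * a - of_int l * b)))\<^sup>2)
            \<le> \<kappa>\<^sup>2 * R * (\<Sum>m\<in>J. \<Sum>l=-L..L. (norm (G f m (t - of_int m * a - of_int l * b)))\<^sup>2)"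
            using True R0 by (intro mult_left_mono sum_mono2 J) (auto simp: J_def intro!: sum_nonneg)
          finally show ?thesis using True by simp
        next
          case False
          then show ?thesis using R0 by (auto intro!: mult_nonneg_nonneg sum_nonneg)
        qed
      qed
      also have "\<dots> = \<kappa>\<^sup>2 * R * (\<Sum>m\<in>J. \<Sum>l=-L..L. I m)"
        by (simp only: integral_mult_right_zero Bochner_Integration.integral_sum
            Bochner_Integration.integrable_sum shift)
      also have "\<dots> = \<kappa>\<^sup>2 * R * of_int (2 * L + 1) * sum I J"
        using L0 by (simp add: mult_ac flip: sum_distrib_left sum_distrib_right)
      also have "\<dots> \<le> \<kappa>\<^sup>2 * R * of_int (2 * L + 1) * S"
        unfolding S_def using R0 L0 I0 periodized_summable[OF f] J
        by (intro mult_left_mono finite_sum_le_infsum) (auto simp: I_def[abs_def])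
      also have "\<dots> \<le> D * S" using S0 by (simp add: D_def distrib_right)
      finally show ?thesis .
    qed
    have "(\<lambda>n. LINT t|lborel. indicator {- real n..real n} t * (norm (f t))\<^sup>2) \<longlonglongrightarrow> (LINT t|lborel. (norm (f t))\<^sup>2)"
    proof (rule integral_dominated_convergence[OF _ _ sq])
      show "AE t in lborel. (\<lambda>n. indicator {- real n..real n} t * (norm (f t))\<^sup>2) \<longlonglongrightarrow> (norm (f t))\<^sup>2"
      proof (intro AE_I2)
        fix t :: real
        obtain k :: nat where k: "\<bar>t\<bar> \<le> k" using real_arch_simple by blast
        have "\<forall>\<^sub>F n in sequentially. indicator {- real n..real n} t * (norm (f t))\<^sup>2 = (norm (f t))\<^sup>2"
          using eventually_ge_at_top[of k]
        proof eventually_elim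
          case (elim n)
          then have "t \<in> {- real n..real n}" using k by auto
          then show ?case by (simp only: indicator_simps mult_1_left)
        qed
        then show "(\<lambda>n. indicator {- real n..real n} t * (norm (f t))\<^sup>2) \<longlonglongrightarrow> (norm (f t))\<^sup>2"
          by (rule tendsto_eventually)
      qed
    qed (auto simp: indicator_def)
    then have "(LINT t|lborel. (norm (f t))\<^sup>2) \<le> D * S"
      by (rule LIMSEQ_le_const2) (use trunc in auto)
    then show ?thesis by (simp add: l2_normsq_def S_def I_def[abs_def])
  qed
  show ?thesis
    unfolding gabor_frame_def
  proof (rule exI[of _ "min (b / D) B"], rule exI[of _ B], intro conjI allI impI)
    show "0 < min (b / D) B" using b D B by simp
    fix f assume f: "square_integrable f"
    let ?S = "infsum (\<lambda>m. LINT t|lborel. (norm (G f m t))\<^sup>2) UNIV"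
    show "(\<lambda>(m,n). (norm (l2_inner f (gabor_atom \<phi> a b m n)))\<^sup>2) summable_on UNIV"
      by (rule frame_sum[OF f])
    have n0: "0 \<le> l2_normsq f" by (simp add: l2_normsq_def)
    have "min (b / D) B * l2_normsq f \<le> b / D * l2_normsq f"
      using n0 by (intro mult_right_mono) auto
    also have "\<dots> \<le> b / D * (D * ?S)" using lower[OF f] b D by (intro mult_left_mono) auto
    also have "\<dots> = b * ?S" using D by simp
    finally show "min (b / D) B * l2_normsq f \<le> infsum (\<lambda>(m,n). (norm (l2_inner f (gabor_atom \<phi> a b m n)))\<^sup>2) UNIV"
      by (simp add: frame_sum[OF f])
    have "?S \<le> (real (chunk_count b c))\<^sup>2 * (c / a + 1) * l2_normsq f"
      using periodized_sum_bound[OF f] by (intro infsum_le_finite_sums periodized_summable f) auto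
    then show "infsum (\<lambda>(m,n). (norm (l2_inner f (gabor_atom \<phi> a b m n)))\<^sup>2) UNIV \<le> B * l2_normsq f"
      unfolding frame_sum[OF f] B_def using b by (simp add: mult.assoc)
  qed simp
qed

text \<open>Spread the kernel vector over cells of length r and cut it off at |n| \<le> T. The norm
  grows without bound with the number of entries of modulus 1, whereas every complete window sums to
  0. Only windows straddling a cut contribute, and their number and their sums are bounded
  independently of T.\<close>

lemma not_frame_if_kernel_vector:
  fixes v :: "int \<Rightarrow> complex"
  assumes v1: "\<And>n. norm (v n) \<le> 1" and inf: "infinite {n. norm (v n) = 1}"
    and kernel: "\<And>m. (\<Sum>n | of_int n * b - of_int m * a \<in> {0..<c}. v n) = 0"
    and r: "0 < r" "r \<le> b"
    and cell: "\<And>n m t. t \<in> {0..<r} \<Longrightarrow>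
      t + of_int n * b - of_int m * a \<in> {0..<c} \<longleftrightarrow> of_int n * b - of_int m * a \<in> {0..<c}"
  shows "\<not> gabor_frame \<phi> a b"
proof
  assume "gabor_frame \<phi> a b"
  then obtain A where A: "0 < A"
    and frame: "\<And>f. square_integrable f \<Longrightarrow> A * l2_normsq f \<le>
        infsum (\<lambda>(m,n). (norm (l2_inner f (gabor_atom \<phi> a b m n)))\<^sup>2) UNIV"
    unfolding gabor_frame_def by blast
  define f where "f T t = (\<Sum>n=-int T..int T. v n * indicator {of_int n * b..<of_int n * b + r} t)" for T :: nat and t :: real
  \<comment> \<open>The cells are translates of each other by multiples of b, which the characters
    do not notice. So one family \<open>E\<close> of Fourier coefficients serves every cell, and an
    inner product factors as \<open>w T m * E k\<close>.\<close>
  define E where "E k = (LINT t|lborel. indicator {0..<r} t * cnj (fourier b k t))" for k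
  define w where "w T m = (\<Sum>n | n \<in> {-int T..int T} \<and> of_int n * b - of_int m * a \<in> {0..<c}. v n)" for T m
  have disj: "indicator {of_int n * b..<of_int n * b + r} t * indicator {of_int n' * b..<of_int n' * b + r} t
      = (if n = n' then indicator {of_int n * b..<of_int n * b + r} t else (0::complex))" for n n' :: int and t :: real
  proof (cases "n = n'")
    case False
    have "\<not> (of_int n * b \<le> t \<and> t < of_int n * b + r \<and> of_int n' * b \<le> t \<and> t < of_int n' * b + r)"
    proof
      assume *: "of_int n * b \<le> t \<and> t < of_int n * b + r \<and> of_int n' * b \<le> t \<and> t < of_int n' * b + r"
      then have "of_int n * b < of_int (n' + 1) * b" "of_int n' * b < of_int (n + 1) * b"
        using r by (simp_all add: distrib_right)
      then show False using b False by simp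
    qed
    then show ?thesis using False by (auto simp: indicator_def)
  qed (simp add: indicator_def)
  have norm_f: "complex_of_real ((norm (f T t))\<^sup>2) =
      (\<Sum>n=-int T..int T. of_real ((norm (v n))\<^sup>2) * indicator {of_int n * b..<of_int n * b + r} t)" for T t
  proof -
    let ?i = "\<lambda>n. indicator {real_of_int n * b..<real_of_int n * b + r} t :: complex"
    have "complex_of_real ((norm (f T t))\<^sup>2) = f T t * cnj (f T t)" by (rule complex_norm_square)
    also have "cnj (f T t) = (\<Sum>n=-int T..int T. cnj (v n) * ?i n)"
      by (simp add: f_def indicator_def if_distrib cong: if_cong)
    also have "f T t * (\<Sum>n=-int T..int T. cnj (v n) * ?i n)
      = (\<Sum>n=-int T..int T. \<Sum>n'=-int T..int T. v n * cnj (v n') * (?i n * ?i n'))"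
      unfolding f_def sum_product by (intro sum.cong refl) (simp only: mult_ac)
    also have "\<dots> = (\<Sum>n=-int T..int T. \<Sum>n'=-int T..int T. if n = n' then v n * cnj (v n') * ?i n else 0)"
      unfolding disj by (intro sum.cong refl) auto
    also have "\<dots> = (\<Sum>n=-int T..int T. v n * cnj (v n) * ?i n)"
      by (intro sum.cong refl) (subst sum.delta', auto)
    finally show ?thesis by (simp only: complex_norm_square)
  qed
  have int_cell: "integrable lborel (indicat_real {of_int n * b..<of_int n * b + r})"
    "(LINT t|lborel. indicat_real {of_int n * b..<of_int n * b + r} t) = r" for n :: int
    using r by (auto intro!: integrable_real_indicator)
  have norm_f': "(norm (f T t))\<^sup>2 = (\<Sum>n=-int T..int T. (norm (v n))\<^sup>2 * indicator {of_int n * b..<of_int n * b + r} t)" for T t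
  proof -
    have "complex_of_real ((norm (f T t))\<^sup>2) = complex_of_real (\<Sum>n=-int T..int T. (norm (v n))\<^sup>2 * indicator {of_int n * b..<of_int n * b + r} t)"
      unfolding norm_f of_real_sum of_real_mult
      by (intro sum.cong arg_cong2[where f = "(*)"] refl) (simp add: indicator_def)
    then show ?thesis by (simp only: of_real_eq_iff)
  qed
  have f_sq: "square_integrable (f T)" for T
  proof -
    have "f T \<in> borel_measurable borel" unfolding f_def by measurable
    moreover have "integrable lborel (\<lambda>t. (norm (f T t))\<^sup>2)"
      unfolding norm_f' by (intro Bochner_Integration.integrable_sum integrable_mult_right int_cell)
    ultimately show ?thesis by (simp add: square_integrable_def)
  qed
  have f_norm: "l2_normsq (f T) = r * (\<Sum>n=-int T..int T. (norm (v n))\<^sup>2)" for T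
    unfolding l2_normsq_def norm_f'
    by (simp only: Bochner_Integration.integral_sum[OF integrable_mult_right[OF int_cell(1)]]
        integral_mult_right_zero int_cell(2)) (simp add: sum_distrib_left mult.commute)
  have E_int: "integrable lborel (\<lambda>t. indicator {of_int n * b..<of_int n * b + r} t * cnj (fourier b k t))" for n k
    by (rule Bochner_Integration.integrable_bound[OF int_cell(1)[of n]]) (auto simp: indicator_def)
  have E_shift: "(LINT t|lborel. indicator {of_int n * b..<of_int n * b + r} t * cnj (fourier b k t)) = E k" for n k
    unfolding E_def
    by (subst lborel_integral_real_affine[where c = 1 and t = "of_int n * b"])
       (use b in \<open>auto simp: indicator_def add.commute[of "of_int n * b"] fourier_periodic intro!: Bochner_Integration.integral_cong\<close>)
  have inner: "l2_inner (f T) (gabor_atom \<phi> a b m k) = w T m * E k" for T m k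
  proof -
    have atom: "cnj (gabor_atom \<phi> a b m k t) = \<phi> (t - of_int m * a) * cnj (fourier b k t)" for t
      by (simp add: gabor_atom_def fourier_def cis_conv_exp exp_cnj indicator_def mult_ac)
    have cellwise: "indicator {of_int n * b..<of_int n * b + r} t * \<phi> (t - of_int m * a)
      = (if of_int n * b - of_int m * a \<in> {0..<c} then indicator {of_int n * b..<of_int n * b + r} t else (0::complex))" for n t
      using cell[of "t - of_int n * b" n m] by (auto simp: indicator_def)
    have "l2_inner (f T) (gabor_atom \<phi> a b m k) = (LINT t|lborel. (\<Sum>n=-int T..int T.
        (if of_int n * b - of_int m * a \<in> {0..<c} then v n else 0) *
        (indicator {of_int n * b..<of_int n * b + r} t * cnj (fourier b k t))))"
      unfolding l2_inner_def
    proof (intro Bochner_Integration.integral_cong refl)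
      fix t
      have "f T t * cnj (gabor_atom \<phi> a b m k t) = (\<Sum>n=-int T..int T.
        v n * ((indicator {of_int n * b..<of_int n * b + r} t * \<phi> (t - of_int m * a)) * cnj (fourier b k t)))"
        unfolding atom f_def sum_distrib_right by (simp only: mult.assoc)
      also have "\<dots> = (\<Sum>n=-int T..int T. (if of_int n * b - of_int m * a \<in> {0..<c} then v n else 0) *
        (indicator {of_int n * b..<of_int n * b + r} t * cnj (fourier b k t)))"
        unfolding cellwise by (intro sum.cong refl) simp
      finally show "f T t * cnj (gabor_atom \<phi> a b m k t) = \<dots>" .
    qed
    also have "\<dots> = (\<Sum>n=-int T..int T. (if of_int n * b - of_int m * a \<in> {0..<c} then v n else 0) * E k)"
      by (simp only: Bochner_Integration.integral_sum[OF integrable_mult_right[OF E_int]]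
          integral_mult_right_zero E_shift)
    also have "\<dots> = (\<Sum>n=-int T..int T. (if of_int n * b - of_int m * a \<in> {0..<c} then v n else 0)) * E k"
      by (simp only: sum_distrib_right)
    also have "(\<Sum>n=-int T..int T. (if of_int n * b - of_int m * a \<in> {0..<c} then v n else 0)) = w T m"
      unfolding w_def by (simp add: sum.inter_filter[symmetric])
    finally show ?thesis .
  qed
  have E_sum: "((\<lambda>k. (norm (E k))\<^sup>2) has_sum b * r) UNIV"
  proof -
    have "((\<lambda>k. (norm (LINT t|lborel. indicator {0..<r} t * cnj (fourier b k t)))\<^sup>2)
      has_sum b * (LINT t|lborel. (norm (indicator {0..<r} t :: complex))\<^sup>2)) UNIV"
    proof (rule fourier_Parseval[OF b])
      show "integrable lborel (\<lambda>t. (norm (indicator {0..<r} t :: complex))\<^sup>2)"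
        by (rule Bochner_Integration.integrable_bound[OF int_cell(1)[of 0]]) (auto simp: indicator_def)
    qed (use r in \<open>auto simp: indicator_def\<close>)
    moreover have "(LINT t|lborel. (norm (indicator {0..<r} t :: complex))\<^sup>2) = r"
    proof -
      have "(norm (indicator {0..<r} t :: complex))\<^sup>2 = indicat_real {0..<r} t" for t
        by (simp add: indicator_def)
      then show ?thesis using int_cell(2)[of 0] by (simp only: of_int_0 mult_zero_left add_0_left)
    qed
    ultimately show ?thesis by (simp add: E_def)
  qed
  have win_fin: "finite {n::int. of_int n * b - of_int m * a \<in> {0..<c}}"
    and win_card: "real (card {n::int. of_int n * b - of_int m * a \<in> {0..<c}}) \<le> c / b + 1" for m :: int
  proof -
    let ?S = "{n::int. of_int m * a \<le> of_int n * b \<and> of_int n * b \<le> of_int m * a + c}"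
    have S: "finite ?S" "real (card ?S) \<le> c / b + 1"
      using card_ints_between[OF b, of "of_int m * a" "of_int m * a + c"] c by auto
    have sub: "{n::int. of_int n * b - of_int m * a \<in> {0..<c}} \<subseteq> ?S" by auto
    show "finite {n::int. of_int n * b - of_int m * a \<in> {0..<c}}" by (rule finite_subset[OF sub S(1)])
    show "real (card {n::int. of_int n * b - of_int m * a \<in> {0..<c}}) \<le> c / b + 1"
      using card_mono[OF S(1) sub] S(2) by linarith
  qed
  define W where "W = c / b + 1"
  have w_norm: "norm (w T m) \<le> W" for T m
  proof -
    have "norm (w T m) \<le> (\<Sum>n | n \<in> {-int T..int T} \<and> of_int n * b - of_int m * a \<in> {0..<c}. 1)"
      unfolding w_def by (rule sum_norm_le) (rule v1)
    also have "\<dots> \<le> real (card {n::int. of_int n * b - of_int m * a \<in> {0..<c}})"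
      using win_fin[of m] by (simp, intro card_mono) auto
    finally show ?thesis using win_card[of m] by (simp add: W_def)
  qed
  \<comment> \<open>Rows whose closed window contains T * b, the last kept position on the right, or
    (- T - 1) * b, the first dropped one on the left. The index set of any other window lies
    entirely inside or entirely outside the truncation.\<close>
  define J where "J T = {m::int. of_int T * b - c \<le> of_int m * a \<and> of_int m * a \<le> of_int T * b}
      \<union> {m::int. of_int (- T - 1) * b - c \<le> of_int m * a \<and> of_int m * a \<le> of_int (- T - 1) * b}" for T :: int
  have J: "finite (J T)" "real (card (J T)) \<le> 2 * (c / a + 1)" for T
  proof -
    let ?J = "\<lambda>T. {m::int. of_int T * b - c \<le> of_int m * a \<and> of_int m * a \<le> of_int T * b}"
    have *: "finite (?J T)" "real (card (?J T)) \<le> c / a + 1" for T :: int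
      using card_ints_between[OF a, of "of_int T * b - c" "of_int T * b"] c by auto
    show "finite (J T)" unfolding J_def using *(1)[of T] *(1)[of "- T - 1"] by simp
    have "card (J T) \<le> card (?J T) + card (?J (- T - 1))" unfolding J_def by (rule card_Un_le)
    then have "real (card (J T)) \<le> real (card (?J T)) + real (card (?J (- T - 1)))"
      unfolding of_nat_add[symmetric] by (rule of_nat_mono)
    also have "\<dots> \<le> (c / a + 1) + (c / a + 1)" by (intro add_mono *(2))
    finally show "real (card (J T)) \<le> 2 * (c / a + 1)" by simp
  qed
  have w_zero: "w T m = 0" if m: "m \<notin> J (int T)" for T m
  proof -
    let ?W = "{n::int. of_int n * b - of_int m * a \<in> {0..<c}}"
    have T1: "n \<le> int T \<Longrightarrow> of_int n * b \<le> of_int (int T) * b" "int T < n \<Longrightarrow> of_int (int T) * b \<le> of_int n * b"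
      "n \<le> - int T - 1 \<Longrightarrow> of_int n * b \<le> of_int (- int T - 1) * b"
      "- int T - 1 < n \<Longrightarrow> of_int (- int T - 1) * b \<le> of_int n * b" for n :: int
      using b by (intro mult_right_mono; simp)+
    have m': "\<not> (of_int (int T) * b - c \<le> of_int m * a \<and> of_int m * a \<le> of_int (int T) * b)"
       "\<not> (of_int (- int T - 1) * b - c \<le> of_int m * a \<and> of_int m * a \<le> of_int (- int T - 1) * b)"
      using m by (simp_all only: J_def Un_iff mem_Collect_eq de_Morgan_disj simp_thms)
    have same: "n \<le> int T \<longleftrightarrow> n' \<le> int T" "n \<le> - int T - 1 \<longleftrightarrow> n' \<le> - int T - 1" if "n \<in> ?W" "n' \<in> ?W" for n n'
    proof -
      have nn: "of_int m * a \<le> of_int n * b" "of_int n * b < of_int m * a + c"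
        "of_int m * a \<le> of_int n' * b" "of_int n' * b < of_int m * a + c"
        using that by auto
      show "n \<le> int T \<longleftrightarrow> n' \<le> int T"
        using T1(1,2)[of n] T1(1,2)[of n'] nn m'(1) by linarith
      show "n \<le> - int T - 1 \<longleftrightarrow> n' \<le> - int T - 1"
        using T1(3,4)[of n] T1(3,4)[of n'] nn m'(2) by linarith
    qed
    have "?W \<subseteq> {-int T..int T} \<or> ?W \<inter> {-int T..int T} = {}"
    proof (rule disjCI)
      assume "?W \<inter> {-int T..int T} \<noteq> {}"
      then obtain n where "n \<in> ?W \<inter> {-int T..int T}" by blast
      then have n: "n \<in> ?W" "- int T \<le> n" "n \<le> int T" by simp_all
      show "?W \<subseteq> {-int T..int T}"
      proof
        fix n' assume "n' \<in> ?W"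
        from same[OF n(1) this] show "n' \<in> {-int T..int T}"
          using n(2,3) unfolding atLeastAtMost_iff by linarith
      qed
    qed
    then show ?thesis
    proof
      assume "?W \<subseteq> {-int T..int T}"
      then have "{n. n \<in> {-int T..int T} \<and> of_int n * b - of_int m * a \<in> {0..<c}} = ?W" by auto
      then show ?thesis unfolding w_def using kernel[of m] by simp
    next
      assume "?W \<inter> {-int T..int T} = {}"
      then have "{n. n \<in> {-int T..int T} \<and> of_int n * b - of_int m * a \<in> {0..<c}} = {}" by auto
      then show ?thesis unfolding w_def by (simp only: sum.empty)
    qed
  qed
  \<comment> \<open>The number of cut rows, times the square of the largest possible row sum, times
    the total energy of \<open>E\<close>; none depends on \<open>T\<close>.\<close>
  define C where "C = 2 * (c / a + 1) * W\<^sup>2 * (b * r)"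
  have upper: "infsum (\<lambda>(m,k). (norm (l2_inner (f T) (gabor_atom \<phi> a b m k)))\<^sup>2) UNIV \<le> C" for T
  proof -
    have g: "((\<lambda>m. (norm (w T m))\<^sup>2 * (b * r)) has_sum (\<Sum>m\<in>J (int T). (norm (w T m))\<^sup>2 * (b * r))) UNIV"
      using w_zero J(1) by (intro has_sum_finite_neutralI) auto
    have row: "((\<lambda>k. (\<lambda>(m,k). (norm (l2_inner (f T) (gabor_atom \<phi> a b m k)))\<^sup>2) (m, k)) has_sum (norm (w T m))\<^sup>2 * (b * r)) UNIV" for m
      by (simp add: inner norm_mult power_mult_distrib has_sum_cmult_right E_sum)
    have "infsum (\<lambda>(m,k). (norm (l2_inner (f T) (gabor_atom \<phi> a b m k)))\<^sup>2) UNIV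
      = infsum (\<lambda>m. (norm (w T m))\<^sup>2 * (b * r)) UNIV"
      using g by (intro summable_on_product_nonneg(2) row) (auto intro: has_sum_imp_summable)
    also have "\<dots> = (\<Sum>m\<in>J (int T). (norm (w T m))\<^sup>2 * (b * r))" by (rule infsumI[OF g])
    also have "\<dots> \<le> (\<Sum>m\<in>J (int T). W\<^sup>2 * (b * r))"
      using b r w_norm by (intro sum_mono mult_right_mono power_mono) auto
    also have "\<dots> = real (card (J (int T))) * (W\<^sup>2 * (b * r))" by simp
    also have "\<dots> \<le> (2 * (c / a + 1)) * (W\<^sup>2 * (b * r))"
      using b r J(2) by (intro mult_right_mono) auto
    finally show ?thesis by (simp add: C_def mult.assoc)
  qed
  obtain N :: nat where N: "C / (A * r) < real N" using reals_Archimedean2 by blast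
  obtain S where S: "S \<subseteq> {n. norm (v n) = 1}" "finite S" "card S = N"
    using infinite_arbitrarily_large[OF inf] by blast
  obtain T :: nat where T: "\<And>n. n \<in> S \<Longrightarrow> \<bar>n\<bar> \<le> int T"
  proof -
    have "finite (abs ` S)" using S(2) by simp
    then obtain B where "\<And>n. n \<in> S \<Longrightarrow> \<bar>n\<bar> \<le> B"
      by (metis bdd_above_finite bdd_above.E imageI)
    then show thesis using that[of "nat B"] by fastforce
  qed
  have "real N = (\<Sum>n\<in>S. (norm (v n))\<^sup>2)" using S(1) S(3) by (subst sum.cong[OF refl, of S _ "\<lambda>_. 1"]) auto
  also have "\<dots> \<le> (\<Sum>n=-int T..int T. (norm (v n))\<^sup>2)"
    using T by (intro sum_mono2) (auto simp: abs_le_iff, metis minus_le_iff)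
  finally have "A * (r * real N) \<le> A * l2_normsq (f T)"
    unfolding f_norm using A r by (intro mult_left_mono) auto
  also have "\<dots> \<le> C" using frame[OF f_sq] upper order_trans by blast
  finally show False using N A r by (simp add: divide_less_eq mult_ac)
qed

end

section \<open>The window matrix and its chains\<close>

locale window_system =
  fixes p q k c0 :: int
  assumes p_pos: "0 < p" and p_less: "p < q" and c0_gt: "q - p < c0" and c0_less: "c0 < p"
    and k_ge: "1 \<le> k" and coprime: "coprime p q"
begin

definition C :: int where "C = k * q + c0"

text \<open>Row \<open>m\<close> of the matrix that decides the frame property has its ones exactly at \<open>win m\<close>.\<close>
definition win :: "int \<Rightarrow> int set" where
  "win m = {n. 0 \<le> q * n - p * m \<and> q * n - p * m < C}"

text \<open>Here y is \<open>q * n\<close> for an index n about to leave, and y mod p is its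
  distance from the left end of its last window. Below \<open>c0 - (q - p)\<close> the entering
  index is n + k + 1, from c0 on it is n + k, and in the gap of length q - p between them nothing
  enters.\<close>

definition low :: "int \<Rightarrow> bool" where
  "low y \<longleftrightarrow> y mod p < c0 - (q - p)"

definition good :: "int \<Rightarrow> bool" where
  "good y \<longleftrightarrow> low y \<or> c0 \<le> y mod p"

definition pr :: "int \<Rightarrow> int" where
  "pr n = n + k + of_bool (low (q * n))"

lemma q_pos: "0 < q" using p_pos p_less by simp

lemma C_gt: "p < C"
proof -
  have "1 * q \<le> k * q" using k_ge q_pos by (intro mult_right_mono) auto
  then show ?thesis using p_less c0_gt by (simp add: C_def)
qed

lemma low_cong: "y mod p = z mod p \<Longrightarrow> low y = low z" by (simp add: low_def)
lemma good_cong: "y mod p = z mod p \<Longrightarrow> good y = good z" by (simp add: good_def low_def)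

lemma pr_add: "pr (n + p * t) = pr n + p * t"
proof -
  have "(q * (n + p * t)) mod p = (q * n) mod p" by (simp add: algebra_simps)
  from low_cong[OF this] show ?thesis by (simp add: pr_def)
qed

lemma win_interval: "win m = {- ((- (p * m)) div q)..<- ((- (p * m + C)) div q)}"
proof -
  have "z \<le> q * n \<longleftrightarrow> - ((- z) div q) \<le> n" for z n
  proof -
    have "- ((- z) div q) \<le> n \<longleftrightarrow> - n \<le> (- z) div q" by linarith
    also have "\<dots> \<longleftrightarrow> q * (- n) \<le> - z"
    proof
      assume "- n \<le> (- z) div q"
      then have "q * (- n) \<le> q * ((- z) div q)" using q_pos by (intro mult_left_mono) auto
      also have "\<dots> \<le> - z"
        using q_pos pos_mod_sign[of q "- z"] mult_div_mod_eq[of q "- z"] by linarith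
      finally show "q * (- n) \<le> - z" .
    next
      assume "q * (- n) \<le> - z"
      then have "(q * (- n)) div q \<le> (- z) div q" using q_pos by (rule zdiv_mono1)
      then show "- n \<le> (- z) div q" using q_pos by (simp del: mult_minus_right)
    qed
    finally show ?thesis by auto
  qed
  from this[of "p * m"] this[of "p * m + C"] show ?thesis
    unfolding win_def by (auto simp: not_le[symmetric] algebra_simps)
qed

lemma finite_win: "finite (win m)" by (simp add: win_interval)

lemma win_add: "win (m + q * t) = (\<lambda>n. n + p * t) ` win m"
proof (rule set_eqI)
  fix n
  have eq: "q * n - p * (m + q * t) = q * (n - p * t) - p * m" by (simp add: algebra_simps)
  have "n \<in> win (m + q * t) \<longleftrightarrow> n - p * t \<in> win m" by (simp only: win_def mem_Collect_eq eq)
  also have "\<dots> \<longleftrightarrow> n \<in> (\<lambda>n. n + p * t) ` win m" by force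
  finally show "n \<in> win (m + q * t) \<longleftrightarrow> n \<in> (\<lambda>n. n + p * t) ` win m" .
qed

text \<open>The last row whose window still contains n.\<close>

definition exit_row :: "int \<Rightarrow> int" where "exit_row n = (q * n) div p"

lemma exit_row: "q * n = p * exit_row n + (q * n) mod p"
  by (simp add: exit_row_def)

lemma leave_iff: "n \<in> win m - win (m + 1) \<longleftrightarrow> m = exit_row n"
proof -
  have "n \<in> win m - win (m + 1) \<longleftrightarrow> 0 \<le> q * n - p * m \<and> q * n - p * m < p"
    using C_gt p_pos by (auto simp: win_def algebra_simps)
  also have "\<dots> \<longleftrightarrow> m = exit_row n"
  proof
    assume "0 \<le> q * n - p * m \<and> q * n - p * m < p"
    then show "m = exit_row n" unfolding exit_row_def
      by (intro int_div_pos_eq[symmetric, where r = "q * n - p * m"]) auto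
  next
    assume "m = exit_row n"
    then show "0 \<le> q * n - p * m \<and> q * n - p * m < p"
      using exit_row[of n] pos_mod_bound[OF p_pos, of "q * n"] pos_mod_sign[OF p_pos, of "q * n"] by simp
  qed
  finally show ?thesis .
qed

lemma leave_set: "win (exit_row n) - win (exit_row n + 1) = {n}"
proof -
  have "n' = n" if "exit_row n' = exit_row n" for n'
  proof -
    have "\<bar>q * n' - q * n\<bar> < p"
      using exit_row[of n] exit_row[of n', unfolded that] pos_mod_bound[OF p_pos, of "q * n"] pos_mod_sign[OF p_pos, of "q * n"]
        pos_mod_bound[OF p_pos, of "q * n'"] pos_mod_sign[OF p_pos, of "q * n'"] by linarith
    then have "q * \<bar>n' - n\<bar> < p" using q_pos by (simp add: abs_mult flip: right_diff_distrib)
    then have "q * \<bar>n' - n\<bar> < q * 1" using p_less by linarith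
    then have "\<bar>n' - n\<bar> < 1" using q_pos by (simp only: mult_less_cancel_left_pos)
    then show ?thesis by simp
  qed
  then have "n' \<in> win (exit_row n) - win (exit_row n + 1) \<longleftrightarrow> n' = n" for n'
    unfolding leave_iff by metis
  then show ?thesis by blast
qed

text \<open>If anything comes in at the step at which \<open>n\<close> drops out of the windows, then it is \<open>pr n\<close>;
  this links \<open>n\<close> to \<open>pr n\<close> in a chain.\<close>
lemma enter_set: "win (exit_row n + 1) - win (exit_row n) = (if good (q * n) then {pr n} else {})"
proof -
  define e where "e = (q * n) mod p"
  have e: "0 \<le> e" "e < p" "q * n = p * exit_row n + e" using p_pos exit_row[of n] by (simp_all add: e_def)
  have iff: "n' \<in> win (exit_row n + 1) - win (exit_row n) \<longleftrightarrow>
      c0 - e \<le> q * (n' - n - k) \<and> q * (n' - n - k) < c0 - e + p" for n'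
  proof -
    have "n' \<in> win (exit_row n + 1) - win (exit_row n) \<longleftrightarrow> C - p \<le> q * n' - p * (exit_row n + 1) \<and> q * n' - p * (exit_row n + 1) < C"
      using C_gt p_pos by (auto simp: win_def algebra_simps)
    also have "\<dots> \<longleftrightarrow> c0 - e \<le> q * (n' - n - k) \<and> q * (n' - n - k) < c0 - e + p"
      using e(3) by (auto simp: C_def algebra_simps)
    finally show ?thesis .
  qed
  have cmp: "q * j < q * i \<longleftrightarrow> j < i" "q * j \<le> q * i \<longleftrightarrow> j \<le> i" for i j using q_pos by auto
  consider "low (q * n)" "good (q * n)" | "\<not> low (q * n)" "good (q * n)" | "\<not> good (q * n)"
    by blast
  then show ?thesis
  proof cases
    case 1
    then have el: "e < c0 - (q - p)" by (simp add: low_def e_def)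
    have "c0 - e \<le> q * j \<and> q * j < c0 - e + p \<longleftrightarrow> j = 1" for j
    proof
      assume "c0 - e \<le> q * j \<and> q * j < c0 - e + p"
      then have "q * 0 < q * j" "q * j < q * 2" using el e p_less c0_less by linarith+
      then show "j = 1" unfolding cmp by linarith
    next
      assume "j = 1"
      then show "c0 - e \<le> q * j \<and> q * j < c0 - e + p" using el e p_less c0_less by auto
    qed
    note J = this
    have "n' \<in> win (exit_row n + 1) - win (exit_row n) \<longleftrightarrow> n' = pr n" for n'
      unfolding iff J pr_def using 1(1) by auto
    then have "win (exit_row n + 1) - win (exit_row n) = {pr n}" by blast
    then show ?thesis using 1 by simp
  next
    case 2
    then have el: "c0 \<le> e" by (simp add: good_def e_def)
    have "c0 - e \<le> q * j \<and> q * j < c0 - e + p \<longleftrightarrow> j = 0" for j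
    proof
      assume "c0 - e \<le> q * j \<and> q * j < c0 - e + p"
      then have "q * (- 1) < q * j" "q * j < q * 1" using el e p_less c0_less c0_gt by linarith+
      then show "j = 0" unfolding cmp by linarith
    next
      assume "j = 0"
      then show "c0 - e \<le> q * j \<and> q * j < c0 - e + p" using el e p_less c0_less c0_gt by auto
    qed
    note J = this
    have "n' \<in> win (exit_row n + 1) - win (exit_row n) \<longleftrightarrow> n' = pr n" for n'
      unfolding iff J pr_def using 2(1) by auto
    then have "win (exit_row n + 1) - win (exit_row n) = {pr n}" by blast
    then show ?thesis using 2 by simp
  next
    case 3
    then have el: "c0 - (q - p) \<le> e" "e < c0" by (auto simp: good_def low_def e_def)
    have "\<not> (c0 - e \<le> q * j \<and> q * j < c0 - e + p)" for j
    proof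
      assume "c0 - e \<le> q * j \<and> q * j < c0 - e + p"
      then have "q * 0 < q * j" "q * j < q * 1" using el e by linarith+
      then show False unfolding cmp by linarith
    qed
    then have "win (exit_row n + 1) - win (exit_row n) = {}" using iff by blast
    then show ?thesis using 3 by simp
  qed
qed

section \<open>Recovering a vector from its window sums\<close>

definition winsum :: "(int \<Rightarrow> complex) \<Rightarrow> int \<Rightarrow> complex" where
  "winsum v m = (\<Sum>n\<in>win m. v n)"

lemma winsum_diff: "winsum v m - winsum v m' = (\<Sum>n\<in>win m - win m'. v n) - (\<Sum>n\<in>win m' - win m. v n)"
proof -
  have "winsum v m = (\<Sum>n\<in>win m - win m'. v n) + (\<Sum>n\<in>win m \<inter> win m'. v n)"
    unfolding winsum_def using finite_win
    by (subst sum.union_disjoint[symmetric]) (auto intro!: sum.cong)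
  moreover have "winsum v m' = (\<Sum>n\<in>win m' - win m. v n) + (\<Sum>n\<in>win m \<inter> win m'. v n)"
    unfolding winsum_def using finite_win
    by (subst sum.union_disjoint[symmetric]) (auto intro!: sum.cong)
  ultimately show ?thesis by simp
qed

lemma winsum_step:
  "winsum v (exit_row n) - winsum v (exit_row n + 1) = v n - (if good (q * n) then v (pr n) else 0)"
  unfolding winsum_diff leave_set enter_set by simp

text \<open>Estimates on a fiber must involve boundedly many nearby rows in order to survive
  integration over t; K measures how far they reach.\<close>

definition nearsum :: "(int \<Rightarrow> complex) \<Rightarrow> int \<Rightarrow> int \<Rightarrow> real" where
  "nearsum v n K = (\<Sum>m | \<bar>p * m - q * n\<bar> \<le> K. norm (winsum v m))"

lemma finite_near: "finite {m. \<bar>p * m - z\<bar> \<le> K}"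
proof (rule finite_subset)
  show "{m. \<bar>p * m - z\<bar> \<le> K} \<subseteq> {- (K + \<bar>z\<bar>)..K + \<bar>z\<bar>}"
  proof
    fix m assume "m \<in> {m. \<bar>p * m - z\<bar> \<le> K}"
    then have "\<bar>p * m\<bar> \<le> K + \<bar>z\<bar>" unfolding mem_Collect_eq by linarith
    then have "p * \<bar>m\<bar> \<le> K + \<bar>z\<bar>" using p_pos by (simp add: abs_mult)
    moreover have "1 * \<bar>m\<bar> \<le> p * \<bar>m\<bar>" using p_pos by (intro mult_right_mono) auto
    ultimately show "m \<in> {- (K + \<bar>z\<bar>)..K + \<bar>z\<bar>}" by auto
  qed
qed simp

lemma nearsum_mono:
  assumes "K + \<bar>q * n - q * n'\<bar> \<le> K'"
  shows "nearsum v n K \<le> nearsum v n' K'"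
  unfolding nearsum_def using assms by (intro sum_mono2 finite_near) auto

lemma nearsum_nonneg: "0 \<le> nearsum v n K"
  unfolding nearsum_def by (intro sum_nonneg) auto

lemma winsum_step_bound: "norm (winsum v (exit_row n) - winsum v (exit_row n + 1)) \<le> nearsum v n p"
proof -
  have "norm (winsum v (exit_row n) - winsum v (exit_row n + 1)) \<le> (\<Sum>m\<in>{exit_row n, exit_row n + 1}. norm (winsum v m))"
    by (simp add: norm_triangle_ineq4)
  also have "\<dots> \<le> nearsum v n p"
    unfolding nearsum_def
  proof (intro sum_mono2 finite_near)
    show "{exit_row n, exit_row n + 1} \<subseteq> {m. \<bar>p * m - q * n\<bar> \<le> p}"
      using exit_row[of n] pos_mod_bound[OF p_pos, of "q * n"] pos_mod_sign[OF p_pos, of "q * n"]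
      by (auto simp: distrib_left)
  qed auto
  finally show ?thesis .
qed

text \<open>Telescoping \<open>winsum_step\<close> along the chain from n: where the chain breaks
  off, the entry itself is a difference of two window sums. Each link moves the position
  \<open>q * n\<close> by at most \<open>q * (k + 1)\<close>, which is the rate at which the
  neighbourhood grows.\<close>

lemma dead_bound:
  assumes "\<not> good (q * (pr ^^ i) n)"
  shows "norm (v n) \<le> (real i + 1) * nearsum v n (p + int i * (q * (k + 1)))"
  using assms
proof (induction i arbitrary: n)
  case 0
  then have "v n = winsum v (exit_row n) - winsum v (exit_row n + 1)" using winsum_step[of v n] by simp
  then show ?case using winsum_step_bound[of v n] by simp
next
  case (Suc i)
  let ?s = "q * (k + 1)"
  have s: "0 \<le> ?s" using q_pos k_ge by simp
  have "norm (v n) \<le> nearsum v n p + (real i + 1) * nearsum v n (p + int (Suc i) * ?s)"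
  proof (cases "good (q * n)")
    case True
    have "norm (v (pr n)) \<le> (real i + 1) * nearsum v (pr n) (p + int i * ?s)"
      using Suc.prems by (intro Suc.IH) (simp add: funpow_swap1)
    also have "\<dots> \<le> (real i + 1) * nearsum v n (p + int (Suc i) * ?s)"
    proof (intro mult_left_mono nearsum_mono)
      have "\<bar>q * pr n - q * n\<bar> \<le> ?s"
        unfolding right_diff_distrib[symmetric] abs_mult using q_pos k_ge
        by (intro mult_mono) (auto simp: pr_def)
      then show "p + int i * ?s + \<bar>q * pr n - q * n\<bar> \<le> p + int (Suc i) * ?s" by (simp add: distrib_right)
    qed auto
    finally have 1: "norm (v (pr n)) \<le> (real i + 1) * nearsum v n (p + int (Suc i) * ?s)" .
    have "v n = (winsum v (exit_row n) - winsum v (exit_row n + 1)) + v (pr n)"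
      using winsum_step[of v n] True by simp
    then have "norm (v n) \<le> norm (winsum v (exit_row n) - winsum v (exit_row n + 1)) + norm (v (pr n))"
      by (metis norm_triangle_ineq)
    then show ?thesis using 1 winsum_step_bound[of v n] by linarith
  next
    \<comment> \<open>The chain may break off before the given link; here n is already its last
      index.\<close>
    case False
    then have "v n = winsum v (exit_row n) - winsum v (exit_row n + 1)" using winsum_step[of v n] by simp
    then have "norm (v n) \<le> nearsum v n p" using winsum_step_bound[of v n] by simp
    then show ?thesis using nearsum_nonneg by (simp add: add_increasing2)
  qed
  moreover have "nearsum v n p \<le> nearsum v n (p + int (Suc i) * ?s)"
    using s by (intro nearsum_mono) simp
  ultimately show ?case by (simp add: algebra_simps)
qed

definition invariant :: "int set \<Rightarrow> bool" where
  "invariant \<Lambda> \<longleftrightarrow> (\<forall>n t. n + p * t \<in> \<Lambda> \<longleftrightarrow> n \<in> \<Lambda>) \<and> (\<forall>n\<in>\<Lambda>. good (q * n) \<and> pr n \<in> \<Lambda>)"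

text \<open>Forward survival is the defining demand. Since \<open>pr\<close> is injective on good
  indices and there are finitely many residues, every element of an invariant set also has a
  predecessor in it (\<open>invariant_surj\<close>), so these chains are infinite in both
  directions.\<close>

definition live :: "int set" where
  "live = {n. \<forall>i. good (q * (pr ^^ i) n)}"

lemma funpow_pr_add: "(pr ^^ i) (n + p * t) = (pr ^^ i) n + p * t"
  by (induction i) (simp_all add: pr_add)

lemma good_add: "good (q * (n + p * t)) = good (q * n)"
  by (rule good_cong) (simp add: algebra_simps)

lemma invariant_live: "invariant live"
  unfolding invariant_def
proof (intro conjI allI ballI)
  fix n t show "n + p * t \<in> live \<longleftrightarrow> n \<in> live"
    by (simp add: live_def funpow_pr_add good_add)
next
  fix n assume n: "n \<in> live"
  then have *: "good (q * (pr ^^ i) n)" for i by (simp add: live_def)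
  show "good (q * n)" using *[of 0] by simp
  show "pr n \<in> live" using *[of "Suc _"] by (simp add: live_def funpow_swap1)
qed

text \<open>Survival depends on n only modulo p, so finitely many waiting times have a
  maximum.\<close>

lemma uniform_death: "\<exists>I. \<forall>n. n \<notin> live \<longrightarrow> (\<exists>i\<le>I. \<not> good (q * (pr ^^ i) n))"
proof -
  define d where "d n = (SOME i. \<not> good (q * (pr ^^ i) n))" for n
  have d: "\<not> good (q * (pr ^^ d n) n)" if "n \<notin> live" for n
    unfolding d_def using that by (intro someI_ex[of "\<lambda>i. \<not> good (q * (pr ^^ i) n)"]) (simp add: live_def)
  have "\<exists>i\<le>Max (d ` {0..<p}). \<not> good (q * (pr ^^ i) n)" if n: "n \<notin> live" for n
  proof -
    have eq: "n = n mod p + p * (n div p)" by simp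
    have "n mod p \<notin> live" using n invariant_live eq unfolding invariant_def by metis
    then have "\<not> good (q * (pr ^^ d (n mod p)) (n mod p))" by (rule d)
    then have "\<not> good (q * (pr ^^ d (n mod p)) n)" using eq funpow_pr_add good_add by metis
    moreover have "d (n mod p) \<le> Max (d ` {0..<p})" using p_pos by (intro Max_ge) auto
    ultimately show ?thesis by blast
  qed
  then show ?thesis by blast
qed

text \<open>Dead entries are recovered along their chains. A live entry n has only dead companions
  in the window of row \<open>exit_row n\<close>, so it is that window sum minus recovered
  entries.\<close>

lemma winsum_inversion:
  assumes "\<And>m. card (live \<inter> win m) \<le> 1"
  shows "\<exists>K\<ge>0. \<forall>v n. norm (v n) \<le> of_int K * nearsum v n K"
proof -
  obtain I where I: "\<And>n. n \<notin> live \<Longrightarrow> \<exists>i\<le>I. \<not> good (q * (pr ^^ i) n)" using uniform_death by blast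
  define s where "s = q * (k + 1)"
  have s: "0 \<le> s" using q_pos k_ge by (simp add: s_def)
  define K where "K = p + int I * s"
  have dead: "norm (v n) \<le> (real I + 1) * nearsum v n K" if nl: "n \<notin> live" for v n
  proof -
    obtain i where i: "i \<le> I" "\<not> good (q * (pr ^^ i) n)" using I[OF nl] by auto
    have "int i * s \<le> int I * s" using i(1) s by (intro mult_right_mono) auto
    then have "nearsum v n (p + int i * s) \<le> nearsum v n K" unfolding K_def by (intro nearsum_mono) simp
    then have "(real i + 1) * nearsum v n (p + int i * s) \<le> (real I + 1) * nearsum v n K"
      using i(1) nearsum_nonneg by (intro mult_mono) auto
    then show ?thesis using dead_bound[OF i(2), of v] by (simp add: s_def)
  qed
  \<comment> \<open>Positions in one window are less than \<open>C\<close> apart, so estimates at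
    the companions of n become estimates near n once K is enlarged by \<open>C\<close>.
    \<open>N\<close> accounts for one window sum and at most \<open>C\<close> companions at cost I +
    1 each.\<close>
  define K' where "K' = K + C"
  define N where "N = 1 + C * (int I + 1)"
  have C0: "0 < C" using C_gt p_pos by simp
  have K0: "0 \<le> K" using s p_pos by (simp add: K_def)
  have main: "norm (v n) \<le> of_int N * nearsum v n K'" for v n
  proof (cases "n \<in> live")
    case False
    have "norm (v n) \<le> (real I + 1) * nearsum v n K" by (rule dead[OF False])
    also have "\<dots> \<le> of_int N * nearsum v n K'"
    proof (intro mult_mono nearsum_mono nearsum_nonneg)
      have "int I + 1 = 1 * (int I + 1)" by simp
      also have "\<dots> \<le> C * (int I + 1)" using C0 by (intro mult_right_mono) auto
      also have "\<dots> \<le> N" by (simp add: N_def)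
      finally have "int I + 1 \<le> N" .
      then have "real_of_int (int I + 1) \<le> of_int N" by (rule of_int_le_iff[THEN iffD2])
      then show "real I + 1 \<le> of_int N" by simp
      show "K + \<bar>q * n - q * n\<bar> \<le> K'" using C0 by (simp add: K'_def)
      show "0 \<le> real_of_int N" using C0 by (simp add: N_def)
    qed
    finally show ?thesis .
  next
    case True
    define m where "m = exit_row n"
    have nm: "n \<in> win m" using leave_set[of n] by (auto simp: m_def)
    have dist: "\<bar>q * n' - q * n\<bar> \<le> C" if "n' \<in> win m" for n' using that nm by (auto simp: win_def)
    have notlive: "n' \<notin> live" if "n' \<in> win m - {n}" for n'
    proof
      assume "n' \<in> live"
      then have "{n, n'} \<subseteq> live \<inter> win m" using that True nm by auto
      then have "card {n, n'} \<le> card (live \<inter> win m)" using finite_win by (intro card_mono) auto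
      then show False using assms[of m] that by auto
    qed
    have cardw: "card (win m - {n}) \<le> nat C"
    proof -
      have "card (win m) \<le> card {0..<C}"
      proof (rule card_inj_on_le[where f = "\<lambda>n. q * n - p * m"])
        show "inj_on (\<lambda>n. q * n - p * m) (win m)" using q_pos by (auto simp: inj_on_def)
      qed (auto simp: win_def)
      then show ?thesis using card_mono[OF finite_win, of "win m - {n}" m] by auto
    qed
    have "norm (v n') \<le> (real I + 1) * nearsum v n K'" if "n' \<in> win m - {n}" for n'
    proof -
      have "norm (v n') \<le> (real I + 1) * nearsum v n' K" by (rule dead[OF notlive[OF that]])
      also have "\<dots> \<le> (real I + 1) * nearsum v n K'"
        using dist[of n'] that by (intro mult_left_mono nearsum_mono) (auto simp: K'_def)
      finally show ?thesis .
    qed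
    then have "norm (\<Sum>n'\<in>win m - {n}. v n') \<le> real (card (win m - {n})) * ((real I + 1) * nearsum v n K')"
      by (intro order_trans[OF norm_sum] sum_bounded_above) auto
    also have "\<dots> \<le> of_int C * ((real I + 1) * nearsum v n K')"
    proof (intro mult_right_mono)
      have "real (card (win m - {n})) \<le> real (nat C)" using cardw by (rule of_nat_mono)
      then show "real (card (win m - {n})) \<le> of_int C" using C0 by simp
    qed (use nearsum_nonneg in auto)
    finally have rest: "norm (\<Sum>n'\<in>win m - {n}. v n') \<le> of_int C * ((real I + 1) * nearsum v n K')" .
    have "winsum v m = v n + (\<Sum>n'\<in>win m - {n}. v n')"
      unfolding winsum_def using nm finite_win by (simp add: sum.remove)
    then have "v n = winsum v m - (\<Sum>n'\<in>win m - {n}. v n')" by simp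
    then have "norm (v n) \<le> norm (winsum v m) + norm (\<Sum>n'\<in>win m - {n}. v n')"
      by (simp add: norm_triangle_ineq4)
    moreover have "norm (winsum v m) \<le> nearsum v n K'"
      unfolding nearsum_def
    proof (rule member_le_sum)
      show "m \<in> {m. \<bar>p * m - q * n\<bar> \<le> K'}"
        using nm K0 by (auto simp: win_def K'_def)
    qed (auto simp: finite_near)
    ultimately show ?thesis using rest by (simp add: N_def algebra_simps)
  qed
  define M where "M = max N K'"
  have M: "N \<le> M" "K' \<le> M" by (auto simp: M_def)
  have N0: "0 \<le> N" using C0 by (simp add: N_def)
  show ?thesis
  proof (intro exI[of _ M] conjI allI)
    show "0 \<le> M" using M N0 by linarith
    fix v n
    have "real_of_int N * nearsum v n K' \<le> of_int M * nearsum v n M"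
      using M N0 by (intro mult_mono nearsum_mono nearsum_nonneg) auto
    then show "norm (v n) \<le> of_int M * nearsum v n M" using main[of v n] by linarith
  qed
qed

section \<open>Counting an invariant set in windows, and its kernel vector\<close>

lemma enter_unique:
  assumes "x \<in> win (m + 1) - win m" "x \<in> win (m' + 1) - win m'"
  shows "m = m'"
proof -
  have "C - p \<le> q * x - p * (m + 1)" "q * x - p * (m + 1) < C"
    "C - p \<le> q * x - p * (m' + 1)" "q * x - p * (m' + 1) < C"
    using assms C_gt p_pos by (auto simp: win_def algebra_simps)
  then have "\<bar>p * m - p * m'\<bar> < p" unfolding distrib_left by linarith
  then have "p * \<bar>m - m'\<bar> < p" using p_pos by (simp add: abs_mult flip: right_diff_distrib)
  then have "p * \<bar>m - m'\<bar> < p * 1" by linarith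
  then have "\<bar>m - m'\<bar> < 1" using p_pos by (simp only: mult_less_cancel_left_pos)
  then show ?thesis by simp
qed

lemma exit_row_inj: "exit_row n = exit_row n' \<Longrightarrow> n = n'"
  by (metis leave_set singleton_inject)

text \<open>\<open>pr n\<close> is the index entering right after row \<open>exit_row n\<close>;
  each index enters only once, and each row is left by at most one index.\<close>

lemma pr_inj:
  assumes "good (q * n)" "good (q * n')" "pr n = pr n'"
  shows "n = n'"
proof -
  have "pr n \<in> win (exit_row n + 1) - win (exit_row n)" using enter_set[of n] assms(1) by simp
  moreover have "pr n \<in> win (exit_row n' + 1) - win (exit_row n')" using enter_set[of n'] assms(2,3) by simp
  ultimately have "exit_row n = exit_row n'" by (rule enter_unique)
  then show ?thesis by (rule exit_row_inj)
qed

lemma exit_row_range: "exit_row n \<in> {0..<q} \<longleftrightarrow> n \<in> {0..<p}"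
proof -
  have "0 \<le> exit_row n \<longleftrightarrow> 0 \<le> n"
    unfolding exit_row_def using p_pos q_pos by (simp add: pos_imp_zdiv_nonneg_iff zero_le_mult_iff)
  moreover have "exit_row n < q \<longleftrightarrow> n < p"
  proof
    assume "n < p"
    then have "q * n < p * q" using q_pos by (simp add: mult.commute)
    moreover have "p * exit_row n \<le> q * n" using exit_row[of n] pos_mod_sign[OF p_pos, of "q * n"] by linarith
    ultimately have "p * exit_row n < p * q" by linarith
    then show "exit_row n < q" using p_pos by simp
  next
    assume "exit_row n < q"
    then have "p * (exit_row n + 1) \<le> p * q" using p_pos by simp
    moreover have "q * n < p * (exit_row n + 1)"
      using exit_row[of n] pos_mod_bound[OF p_pos, of "q * n"] by (simp add: distrib_left)
    ultimately have "q * n < q * p" by (simp add: mult.commute)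
    then show "n < p" using q_pos by simp
  qed
  ultimately show ?thesis by simp
qed

context
  fixes \<Lambda>
  assumes inv: "invariant \<Lambda>"
begin

lemma invariant_add: "n + p * t \<in> \<Lambda> \<longleftrightarrow> n \<in> \<Lambda>"
  using inv by (simp add: invariant_def)

lemma invariant_good: "n \<in> \<Lambda> \<Longrightarrow> good (q * n)"
  and invariant_pr: "n \<in> \<Lambda> \<Longrightarrow> pr n \<in> \<Lambda>"
  using inv by (auto simp: invariant_def)

lemma invariant_mod: "n mod p \<in> \<Lambda> \<longleftrightarrow> n \<in> \<Lambda>"
  using invariant_add[of "n mod p" "n div p"] by simp

text \<open>Modulo p, \<open>pr\<close> is an injective self-map of a finite set.\<close>

lemma invariant_surj:
  assumes "n' \<in> \<Lambda>"
  obtains n where "n \<in> \<Lambda>" "pr n = n'"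
proof -
  define S where "S = \<Lambda> \<inter> {0..<p}"
  have S: "finite S" by (simp add: S_def)
  have "inj_on (\<lambda>n. pr n mod p) S"
  proof (rule inj_onI)
    fix n m assume nm: "n \<in> S" "m \<in> S" "pr n mod p = pr m mod p"
    then obtain t where "pr n = pr m + p * t" by (metis mod_eqE)
    then have "pr n = pr (m + p * t)" by (simp add: pr_add)
    moreover have "good (q * n)" "good (q * (m + p * t))"
      using nm(1,2) by (simp_all only: S_def Int_iff good_add invariant_good)
    ultimately have "n = m + p * t" by (rule pr_inj[rotated 2])
    then have "n mod p = m mod p" by simp
    then show "n = m" using nm by (simp add: S_def)
  qed
  moreover have "(\<lambda>n. pr n mod p) ` S \<subseteq> S"
    using p_pos by (auto simp: S_def invariant_mod invariant_pr)
  ultimately have "(\<lambda>n. pr n mod p) ` S = S" using S by (simp add: endo_inj_surj)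
  moreover have "n' mod p \<in> S" using assms p_pos by (simp add: S_def invariant_mod)
  ultimately have "n' mod p \<in> (\<lambda>n. pr n mod p) ` S" by (simp only:)
  then obtain n where n: "n \<in> S" "n' mod p = pr n mod p" by (rule imageE)
  from n(2) obtain t where "n' = pr n + p * t" by (metis mod_eqE)
  then have "pr (n + p * t) = n'" by (simp add: pr_add)
  moreover have "n + p * t \<in> \<Lambda>" using n(1) by (simp add: S_def invariant_add)
  ultimately show thesis using that by blast
qed

text \<open>Between consecutive windows a leaving element of the invariant set is replaced by its
  image under \<open>pr\<close>, and nothing else of the set enters because every element has a
  predecessor. The weight 1 gives constant cardinality, the identity gives
  \<open>card_win_count\<close>.\<close>

lemma sum_step:
  fixes h :: "int \<Rightarrow> int"
  shows "(\<Sum>n\<in>\<Lambda> \<inter> win (m + 1). h n) - (\<Sum>n\<in>\<Lambda> \<inter> win m. h n) = (\<Sum>n | n \<in> \<Lambda> \<and> exit_row n = m. h (pr n) - h n)"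
proof -
  let ?A = "\<Lambda> \<inter> (win m - win (m + 1))" and ?B = "\<Lambda> \<inter> (win (m + 1) - win m)"
  let ?I = "\<Lambda> \<inter> (win m \<inter> win (m + 1))"
  have A: "?A = {n. n \<in> \<Lambda> \<and> exit_row n = m}"
    by (rule set_eqI) (simp only: Int_iff mem_Collect_eq leave_iff eq_commute[of m])
  have fin: "finite ?A" "finite ?B" "finite ?I" using finite_win by auto
  have "(\<Sum>n\<in>\<Lambda> \<inter> win m. h n) = sum h ?A + sum h ?I"
    using fin by (subst sum.union_disjoint[symmetric]) (auto intro!: sum.cong)
  moreover have "(\<Sum>n\<in>\<Lambda> \<inter> win (m + 1). h n) = sum h ?B + sum h ?I"
    using fin by (subst sum.union_disjoint[symmetric]) (auto intro!: sum.cong)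
  moreover have "sum h ?B = (\<Sum>n\<in>?A. h (pr n))"
  proof (rule sum.reindex_cong)
    show "inj_on pr ?A" by (intro inj_onI) (rule pr_inj, auto intro: invariant_good)
    show "?B = pr ` ?A"
    proof (intro equalityI subsetI)
      fix x assume x: "x \<in> ?B"
      then obtain n where n: "n \<in> \<Lambda>" "pr n = x" using invariant_surj by blast
      have "x \<in> win (exit_row n + 1) - win (exit_row n)" using enter_set[of n] invariant_good[OF n(1)] n(2) by simp
      then have "m = exit_row n" using x enter_unique by blast
      then show "x \<in> pr ` ?A" using n unfolding A by auto
    next
      fix x assume "x \<in> pr ` ?A"
      then obtain n where n: "n \<in> \<Lambda>" "exit_row n = m" "x = pr n" using A by blast
      then show "x \<in> ?B" using enter_set[of n] invariant_good[OF n(1)] invariant_pr[OF n(1)] by auto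
    qed
  qed simp
  ultimately show ?thesis by (simp add: A sum_subtractf)
qed

lemma card_win_const: "card (\<Lambda> \<inter> win m) = card (\<Lambda> \<inter> win 0)"
proof -
  have step: "card (\<Lambda> \<inter> win (m + 1)) = card (\<Lambda> \<inter> win m)" for m
    using sum_step[of "\<lambda>_. 1" m] by simp
  show ?thesis
  proof (induction m rule: int_induct[of _ 0])
    case (step2 i)
    then show ?case using step[of "i - 1"] by simp
  qed (simp_all add: step)
qed

text \<open>The change over q rows in the sum of the elements of \<Lambda> in a window is computed
  in two ways. The window is translated by p, which adds p per element; and every residue leaves
  exactly once, contributing its displacement k or k + 1.\<close>

lemma card_win_count:
  "p * int (card (\<Lambda> \<inter> win m)) =
    k * int (card (\<Lambda> \<inter> {0..<p})) + int (card {n \<in> \<Lambda> \<inter> {0..<p}. low (q * n)})"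
proof -
  define \<Phi> where "\<Phi> m = (\<Sum>n\<in>\<Lambda> \<inter> win m. n)" for m
  define S where "S = \<Lambda> \<inter> {0..<p}"
  have S: "finite S" by (simp add: S_def)
  have "\<Phi> q - \<Phi> 0 = (\<Sum>i<nat q. \<Phi> (int (Suc i)) - \<Phi> (int i))"
    using q_pos by (subst sum_lessThan_telescope) simp
  also have "\<dots> = (\<Sum>i<nat q. \<Sum>n | n \<in> \<Lambda> \<and> exit_row n = int i. pr n - n)"
    unfolding \<Phi>_def by (intro sum.cong refl) (simp add: sum_step add.commute flip: sum_step[of "\<lambda>n. n"])
  also have "\<dots> = (\<Sum>i<nat q. \<Sum>n\<in>{n \<in> S. nat (exit_row n) = i}. pr n - n)"
  proof (intro sum.cong refl set_eqI)
    fix i n assume "i \<in> {..<nat q}"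
    then show "n \<in> {n. n \<in> \<Lambda> \<and> exit_row n = int i} \<longleftrightarrow> n \<in> {n \<in> S. nat (exit_row n) = i}"
      using exit_row_range[of n] unfolding S_def by auto
  qed
  also have "\<dots> = (\<Sum>n\<in>S. pr n - n)"
  proof (rule sum.group)
    show "(\<lambda>n. nat (exit_row n)) ` S \<subseteq> {..<nat q}"
    proof (rule image_subsetI)
      fix n assume "n \<in> S"
      then show "nat (exit_row n) \<in> {..<nat q}" using exit_row_range[of n] unfolding S_def by auto
    qed
  qed (auto simp: S)
  also have "\<dots> = k * int (card S) + int (card {n \<in> S. low (q * n)})"
    using S by (simp add: pr_def sum.distrib of_bool_def sum.If_cases Int_def)
  finally have 1: "\<Phi> q - \<Phi> 0 = k * int (card S) + int (card {n \<in> S. low (q * n)})" .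
  have "\<Lambda> \<inter> win q = (\<lambda>n. n + p) ` (\<Lambda> \<inter> win 0)"
    using win_add[of 0 1] invariant_add[of _ 1] by auto
  then have "\<Phi> q = (\<Sum>n\<in>\<Lambda> \<inter> win 0. n + p)"
    unfolding \<Phi>_def by (subst sum.reindex_cong[of "\<lambda>n. n + p" "\<Lambda> \<inter> win 0" _ _ "\<lambda>n. n + p"]) auto
  then have "\<Phi> q - \<Phi> 0 = p * int (card (\<Lambda> \<inter> win 0))"
    by (simp add: \<Phi>_def sum.distrib)
  then show ?thesis using 1 card_win_const[of m] by (simp add: S_def)
qed

text \<open>Along the increasing enumeration of \<open>\<Lambda>\<close>, the vector runs through the powers of a primitive
  \<open>L\<close>-th root of unity, and every window contains \<open>L\<close> consecutive elements of \<open>\<Lambda>\<close>.\<close>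
lemma kernel_vector:
  assumes two: "2 \<le> card (\<Lambda> \<inter> win 0)"
  obtains v where "\<And>n. norm (v n) \<le> 1" "infinite {n. norm (v n) = 1}" "\<And>m. winsum v m = 0"
proof -
  define L where "L = card (\<Lambda> \<inter> win 0)"
  \<comment> \<open>Signed counting function of \<Lambda>, normalised to 0 at n = 0; it increases by
    one exactly when an element is passed.\<close>
  define N where "N n = int (card (\<Lambda> \<inter> {0..<n})) - int (card (\<Lambda> \<inter> {n..<0}))" for n
  define \<theta> where "\<theta> = 2 * pi / real L"
  define v where "v n = (if n \<in> \<Lambda> then cis (\<theta> * of_int (N n)) else 0)" for n
  have L: "2 \<le> L" using two by (simp add: L_def)
  have N_Suc: "N (n + 1) = N n + of_bool (n \<in> \<Lambda>)" for n
  proof (cases "0 \<le> n")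
    case True
    then have "{0..<n + 1} = insert n {0..<n}" "{n + 1..<0} = {}" "{n..<0} = {}" by auto
    then show ?thesis by (simp add: N_def Int_insert_right)
  next
    case False
    then have "{n..<0} = insert n {n + 1..<0}" "{0..<n + 1} = {}" "{0..<n} = {}" by auto
    then show ?thesis by (simp add: N_def Int_insert_right)
  qed
  \<comment> \<open>Geometric series: the factor \<open>cis \<theta> - 1\<close> makes a sum over an
    interval telescope, and with \<open>L\<close> elements inside the two end phases agree.
    \<open>L\<close> at least 2 keeps the factor nonzero.\<close>
  have tele: "(\<Sum>n\<in>{x..<y}. v n) * (cis \<theta> - 1) = cis (\<theta> * of_int (N y)) - cis (\<theta> * of_int (N x))
      \<and> N y = N x + int (card (\<Lambda> \<inter> {x..<y}))" if "x \<le> y" for x y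
    using that
  proof (induction y rule: int_ge_induct)
    case (step y)
    have ins: "{x..<y + 1} = insert y {x..<y}" using step.hyps by auto
    have "v y * (cis \<theta> - 1) = cis (\<theta> * of_int (N (y + 1))) - cis (\<theta> * of_int (N y))"
      by (simp add: v_def N_Suc right_diff_distrib cis_mult distrib_left)
    then show ?case using step.IH unfolding ins by (auto simp: N_Suc distrib_right Int_insert_right)
  qed simp
  have "cis \<theta> \<noteq> 1"
  proof
    assume "cis \<theta> = 1"
    then have c1: "cos \<theta> = 1" by (metis cis.simps(1) one_complex.simps(1))
    have t: "0 < \<theta>" "\<theta> \<le> pi" using L by (auto simp: \<theta>_def field_simps)
    then have "cos \<theta> < cos 0" by (intro cos_monotone_0_pi) auto
    then show False using c1 by simp
  qed
  moreover have "winsum v m * (cis \<theta> - 1) = 0" for m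
  proof -
    obtain x y where xy: "win m = {x..<y}" using win_interval by blast
    have cL: "card (\<Lambda> \<inter> {x..<y}) = L" using card_win_const[of m] by (simp add: L_def xy)
    have "x \<le> y"
    proof (rule ccontr)
      assume "\<not> x \<le> y"
      then have "card (\<Lambda> \<inter> {x..<y}) = 0" by simp
      then show False using cL L by simp
    qed
    then have t: "winsum v m * (cis \<theta> - 1) = cis (\<theta> * of_int (N y)) - cis (\<theta> * of_int (N x))" "N y = N x + int L"
      using tele cL unfolding winsum_def xy by auto
    have "\<theta> * of_int (N y) = \<theta> * of_int (N x) + 2 * pi" using t(2) L by (simp add: \<theta>_def field_simps)
    then have "cis (\<theta> * of_int (N y)) = cis (\<theta> * of_int (N x))" by (simp flip: cis_mult)
    then show ?thesis using t(1) by simp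
  qed
  ultimately have zero: "winsum v m = 0" for m by simp
  obtain n0 where n0: "n0 \<in> \<Lambda>" using two by (metis IntD1 card.empty ex_in_conv not_numeral_le_zero)
  have "range (\<lambda>t. n0 + p * t) \<subseteq> {n. norm (v n) = 1}"
    using n0 by (auto simp: v_def invariant_add)
  moreover have "infinite (range (\<lambda>t. n0 + p * t))"
    using finite_imageD[of "\<lambda>t. n0 + p * t" UNIV] infinite_UNIV_int p_pos by (auto simp: inj_on_def)
  ultimately have "infinite {n. norm (v n) = 1}" using infinite_super by blast
  then show thesis using that[of v] zero by (auto simp: v_def)
qed

end

end

section \<open>From the integer matrix back to the Gabor system\<close>

locale lattice_window_system = window_system +
  fixes r :: real
  assumes r_pos: "0 < r"
begin

sublocale gabor_parameters "of_int p * r" "of_int q * r" "of_int C * r"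
  using p_pos q_pos C_gt r_pos by unfold_locales auto

text \<open>All three lengths are multiples of r, so an offset below r never changes which points
  lie in a half-open window.\<close>

lemma lattice_window:
  assumes "t \<in> {0..<r}"
  shows "t + of_int n * (of_int q * r) - of_int m * (of_int p * r) \<in> {0..<of_int C * r} \<longleftrightarrow> n \<in> win m"
proof -
  define z where "z = q * n - p * m"
  have eq: "t + of_int n * (of_int q * r) - of_int m * (of_int p * r) = t + of_int z * r"
    by (simp add: z_def algebra_simps)
  have t: "0 \<le> t" "t < r" using assms by auto
  have "0 \<le> t + of_int z * r \<longleftrightarrow> 0 \<le> z"
  proof
    assume "0 \<le> t + of_int z * r"
    then have "0 < (of_int z + 1) * r" using t by (simp add: distrib_right)
    then have "0 < real_of_int z + 1" using r_pos by (simp add: zero_less_mult_iff)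
    then show "0 \<le> z" by linarith
  qed (use t r_pos in simp)
  moreover have "t + of_int z * r < of_int C * r \<longleftrightarrow> z < C"
  proof
    assume "t + of_int z * r < of_int C * r"
    then have "of_int z * r < of_int C * r" using t by linarith
    then show "z < C" using r_pos by simp
  next
    assume "z < C"
    then have "of_int (z + 1) * r \<le> of_int C * r" using r_pos by (intro mult_right_mono) auto
    then show "t + of_int z * r < of_int C * r" using t by (simp add: distrib_right)
  qed
  ultimately show ?thesis unfolding eq by (simp add: win_def z_def)
qed

lemma not_frame:
  assumes "invariant \<Lambda>" "2 \<le> card (\<Lambda> \<inter> win 0)"
  shows "\<not> gabor_frame \<phi> (of_int p * r) (of_int q * r)"
proof -
  obtain v where v: "\<And>n. norm (v n) \<le> 1" "infinite {n. norm (v n) = 1}" "\<And>m. winsum v m = 0"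
    using kernel_vector[OF assms] by blast
  have win0: "of_int n * (of_int q * r) - of_int m * (of_int p * r) \<in> {0..<of_int C * r} \<longleftrightarrow> n \<in> win m" for n m
    using lattice_window[of 0 n m] r_pos by simp
  show ?thesis
  proof (rule not_frame_if_kernel_vector[OF v(1,2) _ r_pos])
    show "(\<Sum>n | of_int n * (of_int q * r) - of_int m * (of_int p * r) \<in> {0..<of_int C * r}. v n) = 0" for m
      using v(3)[of m] unfolding win0 winsum_def by simp
    show "r \<le> of_int q * r" using q_pos r_pos by simp
    show "(t + of_int n * (of_int q * r) - of_int m * (of_int p * r) \<in> {0..<of_int C * r})
      = (of_int n * (of_int q * r) - of_int m * (of_int p * r) \<in> {0..<of_int C * r})" if "t \<in> {0..<r}" for n m t
      unfolding win0 by (rule lattice_window[OF that])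
  qed
qed

lemma frame:
  assumes "card (live \<inter> win 0) \<le> 1"
  shows "gabor_frame \<phi> (of_int p * r) (of_int q * r)"
proof -
  have "card (live \<inter> win m) \<le> 1" for m using assms card_win_const[OF invariant_live, of m] by linarith
  then obtain K where K: "0 \<le> K" "\<And>v n. norm (v n) \<le> of_int K * nearsum v n K" using winsum_inversion by blast
  show ?thesis
  proof (rule frame_if_fiber_inversion)
    fix h :: "real \<Rightarrow> complex" and t :: real
    define l where "l = \<lfloor>t / r\<rfloor>"
    define \<tau> where "\<tau> = t - of_int l * r"
    have \<tau>: "\<tau> \<in> {0..<r}"
      using floor_divide_lower[OF r_pos, of t] floor_divide_upper[OF r_pos, of t]
      by (auto simp: \<tau>_def l_def distrib_right)
    \<comment> \<open>By coprimality every multiple of r has the form (q * n - p * m) * r. So the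
      fiber through t is, up to relabelling rows and columns, the fiber through the offset \<tau> in
      [0, r).\<close>
    obtain x y where xy: "p * x + q * y = 1" using coprime bezout_int[of p q] by (metis coprime_iff_gcd_eq_1 mult.commute)
    define n0 m0 where "n0 = y * l" and "m0 = - x * l"
    have l: "l = q * n0 - p * m0"
    proof -
      have "l = (p * x + q * y) * l" by (simp add: xy)
      then show ?thesis by (simp add: n0_def m0_def algebra_simps)
    qed
    define v where "v n = h (t + of_int (n - n0) * (of_int q * r))" for n
    have ws: "winsum v m = fiber_sum h (m - m0) t" for m
      unfolding winsum_def fiber_sum_def
    proof (rule sum.reindex_bij_witness[where i = "\<lambda>n. n + n0" and j = "\<lambda>n. n - n0"])
      have eq: "t + of_int (n - n0) * (of_int q * r) - of_int (m - m0) * (of_int p * r)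
          = \<tau> + of_int n * (of_int q * r) - of_int m * (of_int p * r)" for n
        unfolding \<tau>_def l by (simp add: algebra_simps)
      show "n - n0 \<in> {n. t + of_int n * (of_int q * r) - of_int (m - m0) * (of_int p * r) \<in> {0..<of_int C * r}}"
        if "n \<in> win m" for n
        unfolding mem_Collect_eq eq using lattice_window[OF \<tau>] that by simp
      show "n + n0 \<in> win m"
        if "n \<in> {n. t + of_int n * (of_int q * r) - of_int (m - m0) * (of_int p * r) \<in> {0..<of_int C * r}}" for n
        using that eq[of "n + n0"] lattice_window[OF \<tau>, of "n + n0" m] by simp
    qed (auto simp: v_def)
    have "norm (h t) = norm (v n0)" by (simp add: v_def)
    also have "\<dots> \<le> of_int K * nearsum v n0 K" by (rule K(2))
    \<comment> \<open>\<open>K\<close> units come from the rows near \<open>n0\<close>, one more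
      from the offset \<tau>.\<close>
    also have "\<dots> \<le> of_int K * (\<Sum>m | \<bar>of_int m * (of_int p * r) - t\<bar> \<le> of_int (K + 1) * r. norm (fiber_sum h m t))"
    proof (intro mult_left_mono)
      let ?A = "{m. \<bar>p * m - q * n0\<bar> \<le> K}"
      let ?B = "{m::int. \<bar>of_int m * (of_int p * r) - t\<bar> \<le> of_int (K + 1) * r}"
      have "nearsum v n0 K = (\<Sum>m\<in>(\<lambda>m. m - m0) ` ?A. norm (fiber_sum h m t))"
        unfolding nearsum_def ws by (subst sum.reindex) (auto simp: inj_on_def)
      also have "\<dots> \<le> (\<Sum>m\<in>?B. norm (fiber_sum h m t))"
      proof (rule sum_mono2)
        have "?B = {m. t - of_int (K + 1) * r \<le> of_int m * (of_int p * r) \<and> of_int m * (of_int p * r) \<le> t + of_int (K + 1) * r}"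
          by auto
        then show "finite ?B" using card_ints_between(1)[OF a, of "t - of_int (K + 1) * r" "t + of_int (K + 1) * r"] K(1) r_pos
          by simp
        show "(\<lambda>m. m - m0) ` ?A \<subseteq> ?B"
        proof
          fix x assume "x \<in> (\<lambda>m. m - m0) ` ?A"
          then obtain m where m: "x = m - m0" "\<bar>p * m - q * n0\<bar> \<le> K" by auto
          have "of_int x * (of_int p * r) - t = of_int (p * m - q * n0) * r - \<tau>"
            unfolding \<tau>_def l m(1) by (simp add: algebra_simps)
          moreover have "\<bar>of_int (p * m - q * n0) * r\<bar> \<le> of_int K * r"
            unfolding abs_mult using m(2) r_pos
            by (intro mult_mono) (auto simp flip: of_int_abs of_int_diff of_int_mult)
          ultimately show "x \<in> ?B" using \<tau> by (auto simp: distrib_right)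
        qed
      qed auto
      finally show "nearsum v n0 K \<le> (\<Sum>m\<in>?B. norm (fiber_sum h m t))" .
    qed (use K(1) in simp)
    finally show "norm (h t) \<le> of_int K *
      (\<Sum>m | \<bar>of_int m * (of_int p * r) - t\<bar> \<le> of_int (K + 1) * r. norm (fiber_sum h m t))" .
  qed (use K(1) r_pos in auto)
qed

end

section \<open>Sets of integers invariant under a rotation with a gap\<close>

lemma strict_mono_int_step:
  fixes f :: "int \<Rightarrow> 'a::order"
  assumes "\<And>i. f i < f (i + 1)"
  shows "strict_mono f"
proof (rule strict_monoI)
  fix i j :: int assume "i < j"
  then show "f i < f j"
  proof (induction j rule: int_gr_induct)
    case (step j)
    then show ?case using assms[of j] by (meson less_trans)
  qed (rule assms)
qed

lemma strict_mono_surj_int_shift: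
  fixes f :: "int \<Rightarrow> int"
  assumes "strict_mono f" "surj f"
  shows "f i = i + f 0"
proof -
  have step: "f (i + 1) = f i + 1" for i
  proof -
    obtain j where j: "f j = f i + 1" using assms(2) by (metis surjD)
    then have "i < j" using assms(1) by (metis less_add_one strict_mono_less)
    moreover have "\<not> i + 1 < j"
    proof
      assume "i + 1 < j"
      then have "f i < f (i + 1)" "f (i + 1) < f j" using assms(1) by (simp_all add: strict_mono_less)
      then show False using j by simp
    qed
    ultimately have "j = i + 1" by simp
    then show ?thesis using j by simp
  qed
  show ?thesis
  proof (induction i rule: int_induct[of _ 0])
    case (step2 i)
    then show ?case using step[of "i - 1"] by simp
  qed (simp_all add: step)
qed

lemma quasi_periodic_mult:
  fixes f :: "int \<Rightarrow> int"
  assumes "\<And>i. f (i + N) = f i + P"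
  shows "f (i + N * t) = f i + P * t"
proof (induction t rule: int_induct[of _ 0])
  case (step1 t)
  then show ?case using assms[of "i + N * t"] by (simp add: algebra_simps)
next
  case (step2 t)
  then show ?case using assms[of "i + N * (t - 1)"] by (simp add: algebra_simps)
qed simp

text \<open>Raising t by one adds a telescoping sum over a full period. It evaluates the total
  displacement of a periodic pattern under a shift of its indices.\<close>

lemma quasi_periodic_sum:
  fixes f :: "int \<Rightarrow> int"
  assumes per: "\<And>i. f (i + N) = f i + P" and N: "0 \<le> N"
  shows "(\<Sum>i\<in>{0..<N}. f (i + t) - f i) = t * P"
proof -
  have tele: "(\<Sum>i\<in>{0..<n}. h (i + 1) - h i) = h n - h 0" if "0 \<le> n" for h :: "int \<Rightarrow> int" and n
    using that
  proof (induction n rule: int_ge_induct)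
    case (step n)
    then have "{0..<n + 1} = insert n {0..<n}" by auto
    then show ?case using step.IH by simp
  qed simp
  have step: "(\<Sum>i\<in>{0..<N}. f (i + (t + 1)) - f i) = (\<Sum>i\<in>{0..<N}. f (i + t) - f i) + P" for t
  proof -
    have "(\<Sum>i\<in>{0..<N}. f (i + (t + 1)) - f i) =
        (\<Sum>i\<in>{0..<N}. f (i + t) - f i) + (\<Sum>i\<in>{0..<N}. f (i + 1 + t) - f (i + t))"
      unfolding sum.distrib[symmetric] by (intro sum.cong) (auto simp: add_ac)
    also have "(\<Sum>i\<in>{0..<N}. f (i + 1 + t) - f (i + t)) = P"
      using tele[OF N, of "\<lambda>i. f (i + t)"] per[of t] by (simp add: add_ac)
    finally show ?thesis .
  qed
  show ?thesis
  proof (induction t rule: int_induct[of _ 0])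
    case (step1 t)
    then show ?case using step[of t] by (simp add: distrib_right)
  next
    case (step2 t)
    then show ?case using step[of "t - 1"] by (simp add: left_diff_distrib)
  qed simp
qed

lemma card_mod_in:
  fixes d m :: int
  assumes "0 < d" "0 \<le> m" "S \<subseteq> {0..<d}"
  shows "int (card {y \<in> {0..<d * m}. y mod d \<in> S}) = m * int (card S)"
proof -
  have "{y \<in> {0..<d * m}. y mod d \<in> S} = (\<lambda>(i, s). d * i + s) ` ({0..<m} \<times> S)"
  proof (intro equalityI subsetI)
    fix y assume y: "y \<in> {y \<in> {0..<d * m}. y mod d \<in> S}"
    have "d * (y div d) \<le> y" using assms(1) pos_mod_sign[of d y] mult_div_mod_eq[of d y] by linarith
    then have "d * (y div d) < d * m" using y by simp
    then have "y div d \<in> {0..<m}" using y assms(1) by (simp add: pos_imp_zdiv_nonneg_iff)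
    then show "y \<in> (\<lambda>(i, s). d * i + s) ` ({0..<m} \<times> S)"
      using y by (intro image_eqI[of _ _ "(y div d, y mod d)"]) auto
  next
    fix y assume "y \<in> (\<lambda>(i, s). d * i + s) ` ({0..<m} \<times> S)"
    then obtain i s where *: "y = d * i + s" "0 \<le> i" "i < m" "s \<in> S" by auto
    then have s: "0 \<le> s" "s < d" using assms(3) by auto
    have "d * (i + 1) \<le> d * m" using * assms(1) by simp
    then have "y < d * m" using s * by (simp add: distrib_left)
    moreover have "0 \<le> y" using s * assms(1) by simp
    ultimately show "y \<in> {y \<in> {0..<d * m}. y mod d \<in> S}" using * s by simp
  qed
  moreover have "inj_on (\<lambda>(i, s). d * i + s) ({0..<m} \<times> S)"
  proof (rule inj_onI, clarify)
    fix i s i' s' assume *: "s \<in> S" "s' \<in> S" "d * i + s = d * i' + s'"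
    then have "0 \<le> s" "s < d" "0 \<le> s'" "s' < d" using assms(3) by auto
    then have "s = s'" using arg_cong[OF *(3), of "\<lambda>y. y mod d"] by simp
    then show "i = i' \<and> s = s'" using * assms(1) by simp
  qed
  ultimately show ?thesis
    using assms(2) by (simp add: card_image card_cartesian_product)
qed

text \<open>The sorted representatives in \<open>[0, p)\<close>, continued by translation. The
  numbering starts at the first nonnegative element, so that the indices 0 to M - 1 are those of the
  elements in \<open>[0, p)\<close>.\<close>

lemma periodic_enumeration:
  fixes E :: "int set"
  assumes p: "0 < p" and per: "\<And>y t. y + p * t \<in> E \<longleftrightarrow> y \<in> E" and ne: "E \<noteq> {}"
  defines "M \<equiv> int (card (E \<inter> {0..<p}))"
  obtains \<xi> :: "int \<Rightarrow> int" where "strict_mono \<xi>" "range \<xi> = E" "\<And>i. \<xi> (i + M) = \<xi> i + p" "0 \<le> \<xi> 0" "\<xi> (- 1) < 0" "0 < M"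
proof -
  define xs where "xs = sorted_list_of_set (E \<inter> {0..<p})"
  have fin: "finite (E \<inter> {0..<p})" by simp
  have set_xs: "set xs = E \<inter> {0..<p}" unfolding xs_def using fin by simp
  have len: "int (length xs) = M" by (simp add: xs_def M_def)
  have srt: "sorted_wrt (<) xs" by (simp add: xs_def)
  have md: "y mod p \<in> E \<longleftrightarrow> y \<in> E" for y using per[of "y mod p" "y div p"] by simp
  obtain y0 where y0: "y0 \<in> E" using ne by blast
  then have "y0 mod p \<in> E \<inter> {0..<p}" using p by (simp add: md)
  then have M: "0 < M" unfolding M_def using fin by (metis card_gt_0_iff empty_iff of_nat_0_less_iff)
  define \<xi> where "\<xi> i = xs ! nat (i mod M) + p * (i div M)" for i
  have nth: "xs ! nat j \<in> E" "0 \<le> xs ! nat j" "xs ! nat j < p" if "0 \<le> j" "j < M" for j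
  proof -
    have "xs ! nat j \<in> set xs" using that len by (intro nth_mem) linarith
    then show "xs ! nat j \<in> E" "0 \<le> xs ! nat j" "xs ! nat j < p" by (auto simp: set_xs)
  qed
  have modM: "0 \<le> i mod M" "i mod M < M" for i using M by simp_all
  have 1: "strict_mono \<xi>"
  proof (rule strict_mono_int_step)
    fix i
    show "\<xi> i < \<xi> (i + 1)"
    proof (cases "i mod M + 1 < M")
      case True
      have e: "(i + 1) mod M = i mod M + 1" "(i + 1) div M = i div M"
        using True modM[of i] M
        by (auto intro!: int_mod_pos_eq[where q = "i div M"] int_div_pos_eq[where r = "i mod M + 1"] simp: algebra_simps)
      have "xs ! nat (i mod M) < xs ! nat (i mod M + 1)"
        using srt True modM(1)[of i] len by (intro sorted_wrt_nth_less[OF srt]) linarith+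
      then show ?thesis by (simp add: \<xi>_def e)
    next
      case False
      then have im: "i mod M + 1 = M" using modM[of i] by linarith
      have "i + 1 = M * (i div M + 1) + 0" using mult_div_mod_eq[of M i] im unfolding distrib_left by linarith
      then have e: "(i + 1) mod M = 0" "(i + 1) div M = i div M + 1" using M by simp_all
      show ?thesis using nth[of "i mod M"] nth[of 0] modM[of i] M by (simp add: \<xi>_def e distrib_left)
    qed
  qed
  have 2: "range \<xi> = E"
  proof (intro equalityI subsetI)
    fix y assume "y \<in> range \<xi>"
    then show "y \<in> E" using nth(1) modM by (auto simp: \<xi>_def per)
  next
    fix y assume "y \<in> E"
    then have "y mod p \<in> set xs" using p by (simp add: set_xs md)
    then obtain j where j: "j < length xs" "xs ! j = y mod p" by (metis in_set_conv_nth)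
    have "\<xi> (int j + M * (y div p)) = y" using j len M by (simp add: \<xi>_def)
    then show "y \<in> range \<xi>" by (metis rangeI)
  qed
  have 3: "\<xi> (i + M) = \<xi> i + p" for i using M by (simp add: \<xi>_def distrib_left)
  have 4: "0 \<le> \<xi> 0" using nth[of 0] M by (simp add: \<xi>_def)
  have "- 1 = M * (- 1) + (M - 1)" by simp
  then have e: "(- 1) mod M = M - 1" "(- 1) div M = - 1"
    using M int_mod_pos_eq[of "- 1" M "- 1" "M - 1"] int_div_pos_eq[of "- 1" M "- 1" "M - 1"] by auto
  have 5: "\<xi> (- 1) < 0" using nth[of "M - 1"] M by (simp add: \<xi>_def e)
  show thesis by (rule that[OF 1 2 3 4 5 M])
qed

text \<open>The combinatorics of condition 8: \<open>N\<close> cyclically ordered gaps are permuted by the shift \<open>\<rho>\<close>.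
  Gap \<open>0\<close> is enlarged and gap \<open>s\<close> is reduced in the process, so the large gaps are \<open>\<rho>, 2 * \<rho>, \<dots>\<close>
  up to \<open>D * \<rho> = s\<close>. In the notation of the theorem, \<open>D = d1 + d2 + 1\<close> and \<open>s = d1 + d3 + 1\<close>.\<close>
locale gap_pattern =
  fixes N \<rho> s D :: int
  assumes coprime_N: "coprime N \<rho>" and s_range: "0 < s" "s < N"
    and D_range: "1 \<le> D" "D < N" and D_mult: "(D * \<rho>) mod N = s"
begin

text \<open>Gap j is the one in front of run j; the orbit \<rho>, ..., D * \<rho> modulo N marks the
  longer gaps.\<close>

definition big :: "int \<Rightarrow> bool" where
  "big j \<longleftrightarrow> (\<exists>n\<in>{1..D}. (n * \<rho>) mod N = j mod N)"

lemma mult_mod_inj: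
  assumes "(n * \<rho>) mod N = (n' * \<rho>) mod N" "\<bar>n - n'\<bar> < N"
  shows "n = n'"
proof -
  have "N dvd n * \<rho> - n' * \<rho>" using assms(1) by (simp add: mod_eq_dvd_iff)
  then have "N dvd (n - n') * \<rho>" by (simp add: left_diff_distrib)
  then have "N dvd n - n'" using coprime_N by (simp add: coprime_dvd_mult_left_iff)
  then show ?thesis using assms(2) zdvd_not_zless[of "\<bar>n - n'\<bar>" N] by (cases "n = n'") auto
qed

lemma big_cong: "i mod N = j mod N \<Longrightarrow> big i = big j"
  by (simp add: big_def)

lemma not_big_0: "\<not> big 0"
proof
  assume "big 0"
  then obtain n where n: "1 \<le> n" "n \<le> D" "(n * \<rho>) mod N = (0 * \<rho>) mod N" by (auto simp: big_def)
  then have "n = 0" using D_range by (intro mult_mod_inj[OF n(3)]) auto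
  then show False using n by simp
qed

lemma big_s: "big s"
  using D_mult s_range D_range by (auto simp: big_def)

text \<open>Shifting the argument by \<rho> replaces the multiples 1 to D of \<rho> by the multiples
  0 to D - 1. The two orbits differ only in the classes 0 and D * \<rho> = s, and the multiples are
  distinct because D < N.\<close>

lemma big_shift:
  "(of_bool (big (j + \<rho>)) :: int) - of_bool (big j) = of_bool (j mod N = 0) - of_bool (j mod N = s)"
proof -
  define A where "A \<longleftrightarrow> (\<exists>n\<in>{1..D - 1}. (n * \<rho>) mod N = j mod N)"
  have split: "{1..D} = insert D {1..D - 1}" "{0..D - 1} = insert 0 {1..D - 1}" using D_range by auto
  have 1: "big j \<longleftrightarrow> A \<or> j mod N = s"
    unfolding big_def A_def split(1) using D_mult by auto
  have "big (j + \<rho>) \<longleftrightarrow> (\<exists>n\<in>{0..D - 1}. (n * \<rho>) mod N = j mod N)"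
  proof
    assume "big (j + \<rho>)"
    then obtain n where n: "n \<in> {1..D}" "(n * \<rho>) mod N = (j + \<rho>) mod N" by (auto simp: big_def)
    then have "((n - 1) * \<rho>) mod N = j mod N" by (simp add: mod_eq_dvd_iff algebra_simps)
    then show "\<exists>n\<in>{0..D - 1}. (n * \<rho>) mod N = j mod N" using n(1) by (intro bexI[of _ "n - 1"]) auto
  next
    assume "\<exists>n\<in>{0..D - 1}. (n * \<rho>) mod N = j mod N"
    then obtain n where n: "n \<in> {0..D - 1}" "(n * \<rho>) mod N = j mod N" by blast
    then have "((n + 1) * \<rho>) mod N = (j + \<rho>) mod N" by (simp add: mod_eq_dvd_iff algebra_simps)
    then show "big (j + \<rho>)" using n(1) unfolding big_def by (intro bexI[of _ "n + 1"]) auto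
  qed
  then have 2: "big (j + \<rho>) \<longleftrightarrow> A \<or> j mod N = 0" unfolding split(2) A_def by auto
  have 3: "\<not> (A \<and> j mod N = 0)"
  proof
    assume "A \<and> j mod N = 0"
    then obtain n where n: "1 \<le> n" "n \<le> D - 1" "(n * \<rho>) mod N = (0 * \<rho>) mod N" by (auto simp: A_def)
    then have "n = 0" using D_range by (intro mult_mod_inj[OF n(3)]) auto
    then show False using n by simp
  qed
  have 4: "\<not> (A \<and> j mod N = s)"
  proof
    assume "A \<and> j mod N = s"
    then obtain n where n: "1 \<le> n" "n \<le> D - 1" "(n * \<rho>) mod N = (D * \<rho>) mod N"
      using D_mult by (auto simp: A_def)
    then have "n = D" using D_range by (intro mult_mod_inj[OF n(3)]) auto
    then show False using n by simp
  qed
  have 5: "\<not> (j mod N = 0 \<and> j mod N = s)" using s_range by auto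
  show ?thesis using 1 2 3 4 5 by (cases A) auto
qed

lemma card_big:
  assumes "J \<subseteq> {0..<N}"
  shows "card {j \<in> J. big j} = card {n \<in> {1..D}. (n * \<rho>) mod N \<in> J}"
proof -
  have "{j \<in> J. big j} = (\<lambda>n. (n * \<rho>) mod N) ` {n \<in> {1..D}. (n * \<rho>) mod N \<in> J}"
  proof (intro equalityI subsetI)
    fix j assume j: "j \<in> {j \<in> J. big j}"
    then obtain n where n: "n \<in> {1..D}" "(n * \<rho>) mod N = j mod N" by (auto simp: big_def)
    moreover have "j mod N = j" using j assms by auto
    ultimately show "j \<in> (\<lambda>n. (n * \<rho>) mod N) ` {n \<in> {1..D}. (n * \<rho>) mod N \<in> J}"
      using j by (intro image_eqI[of _ _ n]) auto
  qed (auto simp: big_def)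
  moreover have "inj_on (\<lambda>n. (n * \<rho>) mod N) {n \<in> {1..D}. (n * \<rho>) mod N \<in> J}"
    using D_range by (intro inj_onI) (rule mult_mod_inj, auto)
  ultimately show ?thesis by (simp add: card_image)
qed

text \<open>The count in clause (e); it is also the number of large gaps strictly between gap 0 and
  gap s (\<open>card_big_below\<close>).\<close>

definition d1 :: nat where
  "d1 = card {n \<in> {1..D}. (n * \<rho>) mod N \<in> {1..<s}}"

lemma card_big_all: "int (card {j \<in> {1..<N}. big j}) = D"
proof -
  have "(n * \<rho>) mod N \<in> {1..<N}" if "n \<in> {1..D}" for n
  proof -
    have "(n * \<rho>) mod N \<noteq> (0 * \<rho>) mod N"
    proof
      assume eq: "(n * \<rho>) mod N = (0 * \<rho>) mod N"
      have "n = 0" using that D_range by (intro mult_mod_inj[OF eq]) auto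
      then show False using that by simp
    qed
    moreover have "0 \<le> (n * \<rho>) mod N" "(n * \<rho>) mod N < N" using D_range by auto
    ultimately show ?thesis by simp
  qed
  then have "{n \<in> {1..D}. (n * \<rho>) mod N \<in> {1..<N}} = {1..D}" by blast
  then show ?thesis using card_big[of "{1..<N}"] D_range by auto
qed

lemma card_big_below: "card {j \<in> {1..<s}. big j} = d1"
  unfolding d1_def using s_range by (intro card_big) auto

lemma card_big_upto: "card {j \<in> {1..s}. big j} = d1 + 1"
proof -
  have eq: "{j \<in> {1..s}. big j} = insert s {j \<in> {1..<s}. big j}" using s_range big_s by auto
  have fin: "finite {j \<in> {1..<s}. big j}" by (rule finite_subset[of _ "{1..<s}"]) auto
  have s: "s \<notin> {j \<in> {1..<s}. big j}" by simp
  show ?thesis unfolding eq card_insert_disjoint[OF fin s] card_big_below by simp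
qed

text \<open>These make \<open>d2\<close>, \<open>d3\<close> and \<open>d4\<close> nonnegative: on
  either side of gap s the large gaps are at most as many as all gaps there.\<close>

lemma d1_bounds: "int d1 \<le> D - 1" "int d1 \<le> s - 1" "D - 1 - int d1 \<le> N - 1 - s"
proof -
  have "card {j \<in> {1..<s}. big j} \<le> card {1..<s}" by (rule card_mono) auto
  then show "int d1 \<le> s - 1" using card_big_below s_range by simp
  have eq: "{j \<in> {1..<N}. big j} = {j \<in> {1..s}. big j} \<union> {j \<in> {s + 1..<N}. big j}" using s_range by auto
  have "card {j \<in> {1..<N}. big j} = card {j \<in> {1..s}. big j} + card {j \<in> {s + 1..<N}. big j}"
    unfolding eq
  proof (rule card_Un_disjoint)
    show "finite {j \<in> {1..s}. big j}" by (rule finite_subset[of _ "{1..s}"]) auto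
    show "finite {j \<in> {s + 1..<N}. big j}" by (rule finite_subset[of _ "{s + 1..<N}"]) auto
  qed auto
  then have eq: "D = int d1 + 1 + int (card {j \<in> {s + 1..<N}. big j})"
    using card_big_all card_big_upto by linarith
  then show "int d1 \<le> D - 1" by simp
  have "card {j \<in> {s + 1..<N}. big j} \<le> card {s + 1..<N}" by (rule card_mono) auto
  then show "D - 1 - int d1 \<le> N - 1 - s" using eq s_range by simp
qed

end

section \<open>The rotation on residues modulo p, and sufficiency of the three conditions\<close>

locale rotation_system = window_system +
  fixes c1 :: int
  assumes c1_mod: "c1 mod p = (k * q) mod p"
begin

abbreviation g :: int where "g \<equiv> q - p"

text \<open>The map that \<open>pr\<close> induces on residues, lifted to the integers so that it
  commutes with translation by p and order can be used. Modulo p, k * q is c1 and the extra q of the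
  low branch is g; lifting it to g rather than q makes \<open>Q\<close> increasing on good
  elements.\<close>

definition Q :: "int \<Rightarrow> int" where
  "Q y = y + c1 + g * of_bool (low y)"

lemma low_add: "low (y + p * t) = low y" by (simp add: low_def)
lemma good_shift: "good (y + p * t) = good y" by (simp add: good_def low_add)
lemma Q_add: "Q (y + p * t) = Q y + p * t" by (simp add: Q_def low_add)

text \<open>The critical case is a low y below a high y'. The removed gap of length g lies between
  them, so y' - y > g absorbs the extra shift of y.\<close>

lemma Q_mono:
  assumes "good y" "good y'" "y < y'"
  shows "Q y < Q y'"
proof (cases "low y \<and> \<not> low y'")
  case True
  define e e' where "e = y mod p" and "e' = y' mod p"
  have e: "e < c0 - g" "c0 \<le> e'" using True assms by (auto simp: e_def e'_def low_def good_def)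
  have y: "y = p * (y div p) + e" "y' = p * (y' div p) + e'" by (simp_all add: e_def e'_def)
  have ee: "0 \<le> e" "e < p" "0 \<le> e'" "e' < p" using p_pos by (simp_all add: e_def e'_def)
  have "y div p \<le> y' div p" using assms(3) p_pos by (intro zdiv_mono1) auto
  then have "p * (y div p) \<le> p * (y' div p)" using p_pos by simp
  then show ?thesis using True y e by (simp add: Q_def)
qed (use assms p_less in \<open>auto simp: Q_def\<close>)

definition einv :: "int set \<Rightarrow> bool" where
  "einv E \<longleftrightarrow> (\<forall>y t. y + p * t \<in> E \<longleftrightarrow> y \<in> E) \<and> (\<forall>y\<in>E. good y \<and> Q y \<in> E)"

definition core :: "int set" where
  "core = {y. \<forall>i. good ((Q ^^ i) y)}"

lemma einv_core: "einv core"
proof -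
  have "(Q ^^ i) (y + p * t) = (Q ^^ i) y + p * t" for i y t
    by (induction i) (simp_all add: Q_add)
  then have "y + p * t \<in> core \<longleftrightarrow> y \<in> core" for y t by (simp add: core_def good_shift)
  moreover have "good y \<and> Q y \<in> core" if "y \<in> core" for y
  proof -
    have *: "good ((Q ^^ i) y)" for i using that by (simp add: core_def)
    show ?thesis using *[of 0] *[of "Suc _"] by (simp add: core_def funpow_swap1)
  qed
  ultimately show ?thesis by (simp add: einv_def)
qed

lemma einv_subset_core:
  assumes "einv E"
  shows "E \<subseteq> core"
proof -
  have "(Q ^^ i) y \<in> E" if "y \<in> E" for i y
    using that by (induction i) (use assms in \<open>auto simp: einv_def\<close>)
  then show ?thesis using assms by (auto simp: core_def einv_def)
qed

lemma Q_pr: "Q (q * n) mod p = (q * pr n) mod p"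
proof -
  have "Q (q * n) - q * pr n = (c1 - k * q) - p * of_bool (low (q * n))"
    by (cases "low (q * n)") (simp_all add: Q_def pr_def algebra_simps)
  moreover have "p dvd c1 - k * q" using c1_mod by (simp add: mod_eq_dvd_iff)
  ultimately have "p dvd Q (q * n) - q * pr n" by simp
  then show ?thesis by (simp add: mod_eq_dvd_iff)
qed

lemma Q_cong: "y mod p = z mod p \<Longrightarrow> Q y mod p = Q z mod p"
  by (metis Q_add mod_eqE mod_mult_self2)

lemma live_core: "live = {n. q * n \<in> core}"
proof -
  have "(Q ^^ i) (q * n) mod p = (q * (pr ^^ i) n) mod p" for i n
  proof (induction i)
    case (Suc i)
    then show ?case using Q_cong[OF Suc] Q_pr by simp
  qed simp
  then have "good ((Q ^^ i) (q * n)) = good (q * (pr ^^ i) n)" for i n by (rule good_cong)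
  then show ?thesis by (simp add: live_def core_def)
qed

lemma einv_mod: "einv E \<Longrightarrow> y mod p = z mod p \<Longrightarrow> y \<in> E \<longleftrightarrow> z \<in> E"
  by (metis einv_def mod_eqE)

lemma invariant_einv:
  assumes "einv E"
  shows "invariant {n. q * n \<in> E}"
  unfolding invariant_def
proof (intro conjI allI ballI)
  fix n t
  have "(q * (n + p * t)) mod p = (q * n) mod p" by (simp add: algebra_simps)
  then show "n + p * t \<in> {n. q * n \<in> E} \<longleftrightarrow> n \<in> {n. q * n \<in> E}" using einv_mod[OF assms] by blast
next
  fix n assume n: "n \<in> {n. q * n \<in> E}"
  then show "good (q * n)" using assms by (simp add: einv_def)
  have "Q (q * n) \<in> E" using n assms by (simp add: einv_def)
  then show "pr n \<in> {n. q * n \<in> E}" using einv_mod[OF assms Q_pr] by simp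
qed

text \<open>The number of chains in an invariant E: all windows contain equally many of its indices
  (\<open>card_win_const\<close>), so row 0 stands for every row.\<close>

definition level :: "int set \<Rightarrow> nat" where
  "level E = card ({n. q * n \<in> E} \<inter> win 0)"

lemma bij_residues: "bij_betw (\<lambda>n. (q * n) mod p) {0..<p} {0..<p}"
proof -
  have inj: "inj_on (\<lambda>n. (q * n) mod p) {0..<p}"
  proof (rule inj_onI)
    fix x y assume xy: "x \<in> {0..<p}" "y \<in> {0..<p}" "(q * x) mod p = (q * y) mod p"
    then have "p dvd q * (x - y)" by (simp add: mod_eq_dvd_iff right_diff_distrib)
    then have "p dvd x - y" using coprime by (simp add: coprime_dvd_mult_right_iff)
    then have "x mod p = y mod p" by (simp add: mod_eq_dvd_iff)
    then show "x = y" using xy by simp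
  qed
  moreover have "(\<lambda>n. (q * n) mod p) ` {0..<p} \<subseteq> {0..<p}" using p_pos by auto
  ultimately show ?thesis by (simp add: bij_betw_def endo_inj_surj)
qed

lemma card_residues: "card {n \<in> {0..<p}. P ((q * n) mod p)} = card {y \<in> {0..<p}. P y}"
proof -
  let ?f = "\<lambda>n. (q * n) mod p" and ?S = "{n \<in> {0..<p}. P ((q * n) mod p)}"
  have "inj_on ?f {0..<p}" and img: "?f ` {0..<p} = {0..<p}" using bij_residues by (simp_all add: bij_betw_def)
  then have "inj_on ?f ?S" by (elim inj_on_subset) blast
  then have "card ?S = card (?f ` ?S)" by (rule card_image[symmetric])
  also have "?f ` ?S = {y \<in> ?f ` {0..<p}. P y}" by blast
  finally show ?thesis unfolding img .
qed

lemma level_count: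
  assumes "einv E"
  shows "p * int (level E) = k * int (card (E \<inter> {0..<p})) + int (card (E \<inter> {0..<c0 - g}))"
proof -
  have md: "y \<in> E \<longleftrightarrow> y mod p \<in> E" for y by (rule einv_mod[OF assms]) simp
  have "card ({n. q * n \<in> E} \<inter> {0..<p}) = card {n \<in> {0..<p}. (q * n) mod p \<in> E}"
    by (rule arg_cong[where f = card]) (auto simp: md[of "q * _"])
  also have "\<dots> = card {y \<in> {0..<p}. y \<in> E}" by (rule card_residues)
  also have "{y \<in> {0..<p}. y \<in> E} = E \<inter> {0..<p}" by auto
  finally have 1: "card ({n. q * n \<in> E} \<inter> {0..<p}) = card (E \<inter> {0..<p})" .
  have "card {n \<in> {n. q * n \<in> E} \<inter> {0..<p}. low (q * n)}
      = card {n \<in> {0..<p}. (q * n) mod p \<in> E \<and> (q * n) mod p < c0 - g}"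
    by (rule arg_cong[where f = card]) (auto simp: md[of "q * _"] low_def)
  also have "\<dots> = card {y \<in> {0..<p}. y \<in> E \<and> y < c0 - g}" by (rule card_residues)
  also have "{y \<in> {0..<p}. y \<in> E \<and> y < c0 - g} = E \<inter> {0..<c0 - g}" using c0_less p_less by auto
  finally have 2: "card {n \<in> {n. q * n \<in> E} \<inter> {0..<p}. low (q * n)} = card (E \<inter> {0..<c0 - g})" .
  show ?thesis
    using card_win_count[OF invariant_einv[OF assms], of 0] unfolding level_def 1 2 .
qed

lemma einv_surj:
  assumes "einv E" "y \<in> E"
  obtains z where "z \<in> E" "Q z = y"
proof -
  have "y mod p \<in> (\<lambda>n. (q * n) mod p) ` {0..<p}"
    using p_pos bij_betw_imp_surj_on[OF bij_residues] by simp
  then obtain n' where n': "(q * n') mod p = y mod p" by auto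
  then have "n' \<in> {n. q * n \<in> E}" using einv_mod[OF assms(1) n'] assms(2) by simp
  then obtain n where n: "q * n \<in> E" "pr n = n'" using invariant_surj[OF invariant_einv[OF assms(1)]] by blast
  have "Q (q * n) mod p = y mod p" using Q_pr[of n] n(2) n' by simp
  then obtain t where "y = Q (q * n) + p * t" by (metis mod_eqE)
  then have "Q (q * n + p * t) = y" by (simp add: Q_add)
  moreover have "q * n + p * t \<in> E" using n(1) assms(1) by (simp add: einv_def)
  ultimately show thesis using that by blast
qed

definition cond6 :: bool where
  "cond6 \<longleftrightarrow> c0 < gcd p c1 \<and> k * (gcd p c1 - c0) \<noteq> gcd p c1"

definition cond7 :: bool where
  "cond7 \<longleftrightarrow> q - c0 < gcd p (c1 + q) \<and> (k + 1) * (gcd p (c1 + q) + c0 - q) \<noteq> gcd p (c1 + q)"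

text \<open>The count reads d * level = w. Hence w > 0 excludes level 0 and w \<noteq> d excludes
  level 1; the latter is the inequation in each of the conditions.\<close>

lemma level_from_density:
  assumes E: "einv E" and d: "0 < d" "d dvd p"
    and eq: "d * (k * int (card (E \<inter> {0..<p})) + int (card (E \<inter> {0..<c0 - g}))) = p * w"
    and w: "0 < w" "w \<noteq> d"
  shows "2 \<le> level E"
proof -
  have "p * (d * int (level E)) = p * w" using level_count[OF E] eq by (simp add: mult.left_commute)
  then have dw: "d * int (level E) = w" using p_pos by simp
  have "level E \<noteq> 0" using dw w(1) by (intro notI) simp
  moreover have "level E \<noteq> 1" using dw w(2) by (intro notI) simp
  ultimately show ?thesis by simp
qed

text \<open>On high elements \<open>Q\<close> is translation by c1, which preserves classes modulo d
  = gcd p c1. Keeping the classes from c0 on avoids the low part and the gap, since reducing modulo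
  a divisor of p cannot increase the residue.\<close>

lemma cond6_sufficient:
  assumes cond6
  shows "\<exists>E. einv E \<and> 2 \<le> level E"
proof -
  define d where "d = gcd p c1"
  have d: "0 < d" "d dvd p" "d dvd c1" "c0 < d" "k * (d - c0) \<noteq> d"
    using assms p_pos by (auto simp: d_def cond6_def)
  obtain m where m: "p = d * m" using d(2) by blast
  have m0: "0 < m" using p_pos d(1) m by (simp add: zero_less_mult_iff)
  define E where "E = {y. c0 \<le> y mod d}"
  have le: "y mod d \<le> y mod p" for y
  proof -
    have "y mod d = (y mod p) mod d" using d(2) by (simp add: mod_mod_cancel)
    also have "\<dots> \<le> y mod p" using p_pos by (intro zmod_le_nonneg_dividend) simp
    finally show ?thesis .
  qed
  have E: "einv E"
    unfolding einv_def
  proof (intro conjI allI ballI)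
    fix y t show "y + p * t \<in> E \<longleftrightarrow> y \<in> E" by (simp add: E_def m mult.assoc)
  next
    fix y assume y: "y \<in> E"
    then have h: "c0 \<le> y mod p" using le[of y] by (simp add: E_def)
    then show "good y" by (simp add: good_def)
    have "\<not> low y" using h p_less by (simp add: low_def)
    then have "Q y = y + c1" by (simp add: Q_def)
    moreover obtain m' where "c1 = d * m'" using d(3) by blast
    ultimately have "Q y mod d = y mod d" by simp
    then show "Q y \<in> E" using y by (simp add: E_def)
  qed
  have "E \<inter> {0..<p} = {y \<in> {0..<d * m}. y mod d \<in> {c0..<d}}"
    using d(1) by (auto simp: E_def m)
  then have "int (card (E \<inter> {0..<p})) = m * int (card {c0..<d})"
    using d(1) m0 c0_gt p_less by (simp only:) (intro card_mod_in, auto)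
  then have 1: "int (card (E \<inter> {0..<p})) = m * (d - c0)" using d(4) by simp
  have "E \<inter> {0..<c0 - g} = {}"
  proof -
    have False if y: "c0 \<le> y mod d" "0 \<le> y" "y < c0 - g" for y
    proof -
      have "y mod d \<le> y" using y(2) by (rule zmod_le_nonneg_dividend)
      then show False using y p_less by linarith
    qed
    then show ?thesis by (auto simp: E_def)
  qed
  then have 2: "int (card (E \<inter> {0..<c0 - g})) = 0" by simp
  have "2 \<le> level E"
  proof (rule level_from_density[OF E d(1,2), of "k * (d - c0)"])
    show "d * (k * int (card (E \<inter> {0..<p})) + int (card (E \<inter> {0..<c0 - g}))) = p * (k * (d - c0))"
      unfolding 1 2 by (simp add: m)
  qed (use d k_ge in auto)
  then show ?thesis using E by blast
qed

text \<open>On low elements \<open>Q\<close> is translation by c1 + g, congruent to c1 + q modulo p.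
  The low part of \<open>[0, p)\<close> stops q - c0 before p, so the first u = d - (q - c0) classes
  of each block of length d stay low even in the last block.\<close>

lemma cond7_sufficient:
  assumes cond7
  shows "\<exists>E. einv E \<and> 2 \<le> level E"
proof -
  define d where "d = gcd p (c1 + q)"
  define u where "u = d - (q - c0)"
  have d: "0 < d" "d dvd p" "d dvd c1 + q" "0 < u" "(k + 1) * u \<noteq> d"
    using assms p_pos by (auto simp: d_def u_def cond7_def algebra_simps)
  have ud: "u < d" using c0_less p_less by (simp add: u_def)
  obtain m where m: "p = d * m" using d(2) by blast
  have m0: "0 < m" using p_pos d(1) m by (simp add: zero_less_mult_iff)
  define E where "E = {y. y mod d < u}"
  have E_low: "low y" if "y \<in> E" for y
  proof (rule ccontr)
    assume "\<not> low y"
    then have h: "c0 - g \<le> y mod p" "y mod p < p" using p_pos by (auto simp: low_def)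
    have "y mod d = (y mod p) mod d" using d(2) by (simp add: mod_mod_cancel)
    also have "y mod p = d * (m - 1) + (y mod p - p + d)" by (simp add: m right_diff_distrib)
    also have "\<dots> mod d = (y mod p - p + d) mod d" by (rule mod_mult_self4)
    also have "\<dots> = y mod p - p + d" using h d(4) by (intro mod_pos_pos_trivial) (auto simp: u_def)
    finally show False using that h by (simp add: E_def u_def)
  qed
  have E: "einv E"
    unfolding einv_def
  proof (intro conjI allI ballI)
    fix y t show "y + p * t \<in> E \<longleftrightarrow> y \<in> E" by (simp add: E_def m mult.assoc)
  next
    fix y assume y: "y \<in> E"
    show "good y" using E_low[OF y] by (simp add: good_def)
    have "Q y = y + ((c1 + q) - p)" using E_low[OF y] by (simp add: Q_def)
    moreover obtain m' where "(c1 + q) - p = d * m'" using d(2,3) by (metis dvd_diff dvdE)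
    ultimately have "Q y mod d = y mod d" by simp
    then show "Q y \<in> E" using y by (simp add: E_def)
  qed
  have "E \<inter> {0..<p} = {y \<in> {0..<d * m}. y mod d \<in> {0..<u}}"
    using d(1) by (auto simp: E_def m)
  then have "int (card (E \<inter> {0..<p})) = m * int (card {0..<u})"
    using d(1) m0 ud by (simp only:) (intro card_mod_in, auto)
  then have 1: "int (card (E \<inter> {0..<p})) = m * u" using d(4) by simp
  have "E \<inter> {0..<c0 - g} = E \<inter> {0..<p}"
  proof -
    have "y < c0 - g" if "y \<in> E" "0 \<le> y" "y < p" for y
      using E_low[OF that(1)] that by (simp add: low_def)
    then show ?thesis using c0_less p_less by auto
  qed
  then have 2: "int (card (E \<inter> {0..<c0 - g})) = m * u" using 1 by simp
  have "2 \<le> level E"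
  proof (rule level_from_density[OF E d(1,2), of "(k + 1) * u"])
    show "d * (k * int (card (E \<inter> {0..<p})) + int (card (E \<inter> {0..<c0 - g}))) = p * ((k + 1) * u)"
      unfolding 1 2 by (simp add: m algebra_simps)
  qed (use d k_ge in auto)
  then show ?thesis using E by blast
qed

text \<open>The set consists of N runs, placed in slots of length H whose starts advance by H or H +
  g. The removed interval \<open>[c0 - g, c0)\<close> falls between runs s - 1 and s. Its end c0
  misses the start of slot s by \<delta>; every run is therefore shortened by |\<delta>|, since the
  rotation carries the runs onto each other.\<close>

lemma cond8_sufficient:
  fixes N \<rho> s D H \<delta> :: int
  assumes pat: "gap_pattern N \<rho> s D"
    and p_eq: "p = N * H + g * D" and rot: "N * c1 + s * g = p * \<rho>"
    and c0_eq: "c0 = (int (gap_pattern.d1 N \<rho> s D) + 1) * g + s * H + \<delta>"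
    and \<delta>: "\<bar>\<delta>\<bar> < H" and ne: "(H - \<bar>\<delta>\<bar>) * (N * k + s) \<noteq> p"
  shows "\<exists>E. einv E \<and> 2 \<le> level E"
proof -
  interpret G: gap_pattern N \<rho> s D by (rule pat)
  define \<mu> where "\<mu> = H - \<bar>\<delta>\<bar>"
  have \<mu>: "0 < \<mu>" using \<delta> by (simp add: \<mu>_def)
  have N0: "0 < N" and H0: "0 < H" and g0: "0 < g" using G.s_range \<delta> p_less by auto
  \<comment> \<open>Large gaps among the gaps 1 to j, continued with increment \<open>D\<close> per
    N gaps; \<open>z j\<close> is the start of slot j.\<close>
  define cnt where "cnt j = (j div N) * D + int (card {i \<in> {1..j mod N}. G.big i})" for j
  define z where "z j = H * j + g * cnt j" for j
  have cnt_step: "cnt (j + 1) = cnt j + of_bool (G.big (j + 1))" for j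
  proof (cases "j mod N + 1 < N")
    case True
    have j: "j + 1 = N * (j div N) + (j mod N + 1)" by simp
    have e: "(j + 1) mod N = j mod N + 1" "(j + 1) div N = j div N"
      by (rule int_mod_pos_eq[OF j], use True N0 in simp_all) (rule int_div_pos_eq[OF j], use True N0 in simp_all)
    define S where "S = {i \<in> {1..j mod N}. G.big i}"
    have ins: "{i \<in> {1..j mod N + 1}. G.big i} = (if G.big (j + 1) then insert (j mod N + 1) S else S)"
    proof -
      have "G.big (j + 1) = G.big (j mod N + 1)" by (rule G.big_cong) (simp add: mod_simps)
      moreover have "{1..j mod N + 1} = insert (j mod N + 1) {1..j mod N}"
        using pos_mod_sign[OF N0, of j] by auto
      ultimately show ?thesis unfolding S_def by auto
    qed
    have fin: "finite S" unfolding S_def by (rule finite_subset[of _ "{1..j mod N}"]) auto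
    have ni: "j mod N + 1 \<notin> S" by (simp add: S_def)
    show ?thesis
      unfolding cnt_def e ins S_def[symmetric] using fin ni by simp
  next
    case False
    then have jm: "j mod N = N - 1" using pos_mod_bound[OF N0, of j] by linarith
    have j: "j + 1 = N * (j div N + 1) + 0" using mult_div_mod_eq[of N j] jm unfolding distrib_left by linarith
    have e: "(j + 1) mod N = 0" "(j + 1) div N = j div N + 1"
      by (rule int_mod_pos_eq[OF j], use N0 in simp_all) (rule int_div_pos_eq[OF j], use N0 in simp_all)
    have "G.big (j + 1) = G.big 0" using e(1) by (intro G.big_cong) simp
    moreover have "{1..N - 1} = {1..<N}" by auto
    ultimately show ?thesis
      unfolding cnt_def e jm using G.card_big_all G.not_big_0 by (simp add: distrib_right)
  qed
  have z_step: "z (j + 1) = z j + H + g * of_bool (G.big (j + 1))" for j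
    unfolding z_def cnt_step by (simp add: algebra_simps)
  have z_mono: "z i \<le> z j" if "i \<le> j" for i j
    using that
  proof (induction j rule: int_ge_induct)
    case (step j)
    then show ?case using z_step[of j] H0 g0 by simp
  qed simp
  have z0: "z 0 = 0" by (simp add: z_def cnt_def)
  have zs: "z s = s * H + g * (int G.d1 + 1)"
    using G.s_range G.card_big_upto by (simp add: z_def cnt_def)
  have c0: "c0 = z s + \<delta>" using c0_eq zs by (simp add: algebra_simps)
  have zs1: "z s = z (s - 1) + H + g" using z_step[of "s - 1"] G.big_s by simp
  have z_per: "z (j + N) = z j + p" for j
  proof -
    have "z (j + N) = z j + (N * H + g * D)" using N0 by (simp add: z_def cnt_def algebra_simps)
    then show ?thesis by (simp only: p_eq[symmetric])
  qed
  have z_per_mult: "z (j + N * t) = z j + p * t" for j t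
    by (rule quasi_periodic_mult) (rule z_per)
  have zN: "z N = p" using z_per[of 0] z0 by simp
  have below_step: "of_bool ((j + 1) mod N < s) - of_bool (j mod N < s)
      = (of_bool ((j + 1) mod N = 0) - of_bool ((j + 1) mod N = s) :: int)" for j
  proof (cases "j mod N + 1 < N")
    case True
    have j: "j + 1 = N * (j div N) + (j mod N + 1)" by simp
    have e: "(j + 1) mod N = j mod N + 1"
      by (rule int_mod_pos_eq[OF j], use True N0 in simp_all)
    then show ?thesis using pos_mod_sign[OF N0, of j] by auto
  next
    case False
    then have jm: "j mod N = N - 1" using pos_mod_bound[OF N0, of j] by linarith
    have j: "j + 1 = N * (j div N + 1) + 0" using mult_div_mod_eq[of N j] jm unfolding distrib_left by linarith
    have e: "(j + 1) mod N = 0"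
      by (rule int_mod_pos_eq[OF j], use N0 in simp_all)
    show ?thesis unfolding e jm using G.s_range by simp
  qed
  \<comment> \<open>By \<open>big_shift\<close>, the change of the step lengths under \<rho> matches
    the change of the branch indicator, so the deviation \<open>f\<close> is constant. Summing over
    one period and using \<rho> * p = N * c1 + s * g identifies it as c1.\<close>
  have z_rot: "z (j + \<rho>) = z j + c1 + g * of_bool (j mod N < s)" for j
  proof -
    define f where "f j = z (j + \<rho>) - z j - g * of_bool (j mod N < s)" for j
    have f_step: "f (j + 1) = f j" for j
    proof -
      have "f (j + 1) - f j = g * ((of_bool (G.big (j + 1 + \<rho>)) - of_bool (G.big (j + 1)))
          - (of_bool ((j + 1) mod N < s) - of_bool (j mod N < s)))"
        using z_step[of j] z_step[of "j + \<rho>"] by (simp add: f_def algebra_simps)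
      also have "\<dots> = 0" unfolding G.big_shift below_step by simp
      finally show ?thesis by simp
    qed
    have f_const: "f j = f 0" for j
    proof (induction j rule: int_induct[of _ 0])
      case (step2 i)
      then show ?case using f_step[of "i - 1"] by simp
    qed (simp_all add: f_step)
    have "(\<Sum>j\<in>{0..<N}. f j) = (\<Sum>j\<in>{0..<N}. z (j + \<rho>) - z j) - g * (\<Sum>j\<in>{0..<N}. of_bool (j mod N < s))"
      by (simp only: f_def sum_subtractf sum_distrib_left)
    also have "(\<Sum>j\<in>{0..<N}. z (j + \<rho>) - z j) = \<rho> * p"
      using N0 by (intro quasi_periodic_sum z_per) simp
    also have "(\<Sum>j\<in>{0..<N}. of_bool (j mod N < s)) = s"
    proof -
      have "(\<Sum>j\<in>{0..<N}. of_bool (j mod N < s)) = (\<Sum>j\<in>{0..<s}. 1 :: int)"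
        using G.s_range by (intro sum.mono_neutral_cong_right) auto
      then show ?thesis using G.s_range by simp
    qed
    finally have "(\<Sum>j\<in>{0..<N}. f j) = N * c1" using rot by (simp add: algebra_simps)
    moreover have "(\<Sum>j\<in>{0..<N}. f j) = (\<Sum>j\<in>{0..<N}. f 0)" by (intro sum.cong refl f_const)
    then have "(\<Sum>j\<in>{0..<N}. f j) = N * f 0" using N0 by simp
    ultimately have "f 0 = c1" using N0 by simp
    then show ?thesis using f_const[of j] by (simp add: f_def)
  qed
  \<comment> \<open>For positive \<delta> the runs start \<delta> late, so that run s does not begin
    before c0; for negative \<delta> they end early, so that run s - 1 stays below c0 - g.\<close>
  define \<epsilon> where "\<epsilon> = max 0 \<delta>"
  have e\<mu>: "\<epsilon> + \<mu> = H + min 0 \<delta>" "0 \<le> \<epsilon>" "min 0 \<delta> = \<delta> - \<epsilon>" by (auto simp: \<epsilon>_def \<mu>_def)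
  have e\<mu>2: "\<epsilon> + \<mu> \<le> H" using e\<mu>(1) by simp
  define E where "E = {y. \<exists>j. \<exists>t\<in>{0..<\<mu>}. y = z j + \<epsilon> + t}"
  have low_pos: "z j + \<epsilon> + t < c0 - g" if "j < s" "t < \<mu>" for j t
  proof -
    have "z j \<le> z (s - 1)" using that by (intro z_mono) simp
    then show ?thesis using zs1 c0 e\<mu> that(2) by linarith
  qed
  have high_pos: "c0 \<le> z j + \<epsilon> + t" if "s \<le> j" "0 \<le> t" for j t
    using z_mono[OF that(1)] c0 e\<mu> that(2) by linarith
  have range_pos: "0 \<le> z j + \<epsilon> + t \<and> z j + \<epsilon> + t < p" if "0 \<le> j" "j < N" "0 \<le> t" "t < \<mu>" for j t
  proof -
    have "0 \<le> z j" using z_mono[OF that(1)] z0 by simp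
    moreover have "z j + H \<le> p"
      using z_mono[of "j + 1" N] z_step[of j] that(2) g0 zN by (cases "G.big (j + 1)") auto
    ultimately show ?thesis using e\<mu> e\<mu>2 that by linarith
  qed
  have mod_pos: "(z j + \<epsilon> + t) mod p = z (j mod N) + \<epsilon> + t" if "0 \<le> t" "t < \<mu>" for j t
  proof -
    have "z j = z (j mod N) + p * (j div N)" using z_per_mult[of "j mod N" "j div N"] by simp
    then have "z j + \<epsilon> + t = (z (j mod N) + \<epsilon> + t) + p * (j div N)" by simp
    then have "(z j + \<epsilon> + t) mod p = (z (j mod N) + \<epsilon> + t) mod p" by (simp only: mod_mult_self2)
    then show ?thesis using range_pos[of "j mod N" t] that N0 by simp
  qed
  have low_iff: "low (z j + \<epsilon> + t) \<longleftrightarrow> j mod N < s" and good_pos: "good (z j + \<epsilon> + t)"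
    if "0 \<le> t" "t < \<mu>" for j t
  proof -
    show "low (z j + \<epsilon> + t) \<longleftrightarrow> j mod N < s"
      unfolding low_def mod_pos[OF that] using low_pos[of "j mod N" t] high_pos[of "j mod N" t] that g0
      by (cases "j mod N < s") auto
    then show "good (z j + \<epsilon> + t)"
      unfolding good_def mod_pos[OF that] using high_pos[of "j mod N" t] that by (cases "j mod N < s") auto
  qed
  have E: "einv E"
    unfolding einv_def
  proof (intro conjI allI ballI)
    fix y t'
    have shift: "y + p * t' \<in> E" if "y \<in> E" for y t'
    proof -
      from that obtain j t where "t \<in> {0..<\<mu>}" "y = z j + \<epsilon> + t" by (auto simp: E_def)
      then have "t \<in> {0..<\<mu>} \<and> y + p * t' = z (j + N * t') + \<epsilon> + t" by (simp add: z_per_mult)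
      then show ?thesis unfolding E_def by blast
    qed
    show "y + p * t' \<in> E \<longleftrightarrow> y \<in> E" using shift[of y t'] shift[of "y + p * t'" "- t'"] by auto
  next
    fix y assume "y \<in> E"
    then obtain j t where jt: "0 \<le> t" "t < \<mu>" "y = z j + \<epsilon> + t" by (auto simp: E_def)
    show "good y" using good_pos jt by simp
    have "Q y = z (j + \<rho>) + \<epsilon> + t"
      unfolding Q_def jt(3) low_iff[OF jt(1,2)] z_rot by simp
    moreover have "t \<in> {0..<\<mu>}" using jt by simp
    ultimately show "Q y \<in> E" unfolding E_def by blast
  qed
  have count: "int (card (E \<inter> {0..<x})) = n * \<mu>"
    if n: "0 \<le> n" "n \<le> N" and x: "x \<le> p"
      and in_x: "\<And>j t. 0 \<le> j \<Longrightarrow> j < N \<Longrightarrow> 0 \<le> t \<Longrightarrow> t < \<mu> \<Longrightarrow> z j + \<epsilon> + t < x \<longleftrightarrow> j < n" for n x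
  proof -
    let ?f = "\<lambda>(j, t). z j + \<epsilon> + t"
    have "E \<inter> {0..<x} = ?f ` ({0..<n} \<times> {0..<\<mu>})"
    proof (intro equalityI subsetI)
      fix y assume y: "y \<in> E \<inter> {0..<x}"
      then obtain j t where jt: "0 \<le> t" "t < \<mu>" "y = z j + \<epsilon> + t" by (auto simp: E_def)
      have "y mod p = y" using y x by simp
      then have y': "y = z (j mod N) + \<epsilon> + t" using mod_pos[OF jt(1,2), of j] jt(3) by simp
      have "j mod N < n" using in_x[of "j mod N" t] y y' jt N0 by simp
      then show "y \<in> ?f ` ({0..<n} \<times> {0..<\<mu>})"
        using jt N0 y' by (intro image_eqI[of _ _ "(j mod N, t)"]) auto
    next
      fix y assume "y \<in> ?f ` ({0..<n} \<times> {0..<\<mu>})"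
      then obtain j t where jt: "0 \<le> j" "j < n" "0 \<le> t" "t < \<mu>" "y = z j + \<epsilon> + t" by auto
      then have "0 \<le> y" "y < x" using range_pos[of j t] in_x[of j t] n by auto
      moreover have "t \<in> {0..<\<mu>}" using jt by simp
      then have "y \<in> E" using jt(5) unfolding E_def by blast
      ultimately show "y \<in> E \<inter> {0..<x}" by simp
    qed
    moreover have "inj_on ?f ({0..<n} \<times> {0..<\<mu>})"
    proof (rule inj_onI, clarify)
      fix i t i' t' assume *: "t \<in> {0..<\<mu>}" "t' \<in> {0..<\<mu>}" "z i + \<epsilon> + t = z i' + \<epsilon> + t'"
      have sep: "z i + \<mu> \<le> z i'" if "i < i'" for i i'
        using z_mono[of "i + 1" i'] z_step[of i] that g0 e\<mu>(2) e\<mu>2 by (cases "G.big (i + 1)") auto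
      have "i = i'" using sep[of i i'] sep[of i' i] * by (cases i i' rule: linorder_cases) auto
      then show "i = i' \<and> t = t'" using * by simp
    qed
    ultimately show ?thesis using n(1) \<mu> by (simp add: card_image card_cartesian_product)
  qed
  have 1: "int (card (E \<inter> {0..<p})) = N * \<mu>"
    using N0 range_pos by (intro count) auto
  have 2: "int (card (E \<inter> {0..<c0 - g})) = s * \<mu>"
  proof (rule count)
    fix j t assume "0 \<le> j" "j < N" "0 \<le> t" "t < \<mu>"
    then show "z j + \<epsilon> + t < c0 - g \<longleftrightarrow> j < s"
      using low_pos[of j t] high_pos[of j t] g0 by (cases "j < s") auto
  qed (use G.s_range c0_less p_less in auto)
  have "2 \<le> level E"
  proof (rule level_from_density[OF E p_pos dvd_refl, of "\<mu> * (N * k + s)"])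
    show "p * (k * int (card (E \<inter> {0..<p})) + int (card (E \<inter> {0..<c0 - g}))) = p * (\<mu> * (N * k + s))"
      unfolding 1 2 by (simp add: algebra_simps)
    show "0 < \<mu> * (N * k + s)" using \<mu> N0 k_ge G.s_range by (intro mult_pos_pos add_nonneg_pos) auto
    show "\<mu> * (N * k + s) \<noteq> p" using ne by (simp add: \<mu>_def)
  qed
  then show ?thesis using E by blast
qed

end

section \<open>Necessity: the shape of an invariant set with at least two chains\<close>

lemma closed_add_gcd:
  fixes E :: "int set"
  assumes p: "0 < p" and per: "\<And>y t. y + p * t \<in> E \<longleftrightarrow> y \<in> E" and cl: "\<And>y. y \<in> E \<Longrightarrow> y + c \<in> E"
    and y: "y \<in> E"
  shows "y + gcd p c * w \<in> E"
proof -
  have iter: "y + c * int n \<in> E" for n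
  proof (induction n)
    case (Suc n)
    then show ?case using cl[of "y + c * int n"] by (simp add: algebra_simps)
  qed (simp add: y)
  obtain u v where uv: "u * p + v * c = gcd p c" using bezout_int[of p c] by blast
  \<comment> \<open>Only forward steps by c are available, so the coefficient from Bezout's identity
    is replaced by its residue modulo p; the difference is a multiple of p, by which E may be
    translated either way.\<close>
  define n where "n = (v * w) mod p"
  have n: "int (nat n) = n" using p by (simp add: n_def)
  have "v * w = p * ((v * w) div p) + n" by (simp add: n_def)
  then have "gcd p c * w = c * n + p * (u * w + c * ((v * w) div p))"
    unfolding uv[symmetric] by (simp add: algebra_simps) (metis distrib_left mult.assoc mult.commute)
  then have "y + gcd p c * w = (y + c * int (nat n)) + p * (u * w + c * ((v * w) div p))"
    unfolding n by simp
  then show ?thesis using iter[of "nat n"] by (simp only: per)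
qed

lemma down_closed_eq:
  fixes A :: "int set"
  assumes fin: "finite A" and nonneg: "A \<subseteq> {0..}" and down: "\<And>i j. i \<in> A \<Longrightarrow> 0 \<le> j \<Longrightarrow> j < i \<Longrightarrow> j \<in> A"
  shows "A = {0..<int (card A)}"
proof (cases "A = {}")
  case False
  have m: "Max A \<in> A" using fin False by simp
  have "A = {0..Max A}"
  proof (intro equalityI subsetI)
    fix x assume "x \<in> {0..Max A}"
    then show "x \<in> A" using down[OF m, of x] m by (cases "x = Max A") auto
  qed (use fin nonneg in auto)
  moreover have "{0..Max A} = {0..<Max A + 1}" by auto
  ultimately have "A = {0..<Max A + 1}" by simp
  moreover have "0 \<le> Max A" using m nonneg by auto
  ultimately have "int (card A) = Max A + 1" by (metis card_atLeastLessThan_int diff_0_right int_nat_eq add_increasing2 zero_le_one)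
  then show ?thesis using \<open>A = {0..<Max A + 1}\<close> by simp
qed simp

context rotation_system
begin

text \<open>Condition 8 in terms of the gap pattern, where X = p * \<rho> and B_d = N * H;
  \<open>cond8_iff\<close> gives the form with d1 to d4.\<close>

definition cond8 :: bool where
  "cond8 \<longleftrightarrow> (\<exists>N \<rho> s D H \<delta>. gap_pattern N \<rho> s D \<and> p = N * H + g * D \<and> N * c1 + s * g = p * \<rho>
    \<and> c0 = (int (gap_pattern.d1 N \<rho> s D) + 1) * g + s * H + \<delta> \<and> \<bar>\<delta>\<bar> < H
    \<and> c0 - p < \<delta> \<and> \<delta> < c0 - g \<and> (H - \<bar>\<delta>\<bar>) * (N * k + s) \<noteq> p)"

text \<open>A set moved only by c1 is closed under translation by d = gcd p c1. Bringing any element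
  into \<open>[0, d)\<close> within the set shows that its class is at least c0. With so few
  classes, two chains fit only if k * (d - c0) is at least 2 * d.\<close>

lemma einv_high:
  assumes E: "einv E" and high: "\<And>y. y \<in> E \<Longrightarrow> \<not> low y" and lev: "2 \<le> level E"
  shows cond6
proof -
  define d where "d = gcd p c1"
  have d: "0 < d" "d dvd p" using p_pos by (auto simp: d_def)
  obtain m where m: "p = d * m" using d(2) by blast
  have m0: "0 < m" using p_pos d(1) m by (simp add: zero_less_mult_iff)
  have per: "y + p * t \<in> E \<longleftrightarrow> y \<in> E" for y t using E by (simp add: einv_def)
  have cl: "y + c1 \<in> E" if "y \<in> E" for y
  proof -
    have "Q y \<in> E" using E that by (simp add: einv_def)
    then show ?thesis using high[OF that] by (simp add: Q_def)
  qed
  have ge: "c0 \<le> y mod d" if "y \<in> E" for y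
  proof -
    have "y + d * (- (y div d)) \<in> E" unfolding d_def by (rule closed_add_gcd[OF p_pos per cl that])
    moreover have "y + d * (- (y div d)) = y mod d" by (simp add: minus_mult_div_eq_mod)
    ultimately have e: "y mod d \<in> E" by simp
    then have "good (y mod d)" "\<not> low (y mod d)" using E high by (auto simp: einv_def)
    moreover have "(y mod d) mod p = y mod d"
    proof (rule mod_pos_pos_trivial)
      show "y mod d < p" using pos_mod_bound[OF d(1), of y] zdvd_imp_le[OF d(2) p_pos] by linarith
    qed (use d in simp)
    ultimately show ?thesis by (simp add: good_def)
  qed
  have "E \<noteq> {}" using lev by (auto simp: level_def)
  then obtain y where "y \<in> E" by blast
  then have c0d: "c0 < d" using ge[of y] pos_mod_bound[OF d(1), of y] by linarith
  have "E \<inter> {0..<c0 - g} = {}"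
  proof (rule equals0I)
    fix y assume y: "y \<in> E \<inter> {0..<c0 - g}"
    then have "low y" using c0_less p_less by (simp add: low_def)
    then show False using high y by blast
  qed
  then have cnt: "p * int (level E) = k * int (card (E \<inter> {0..<p}))" using level_count[OF E] by simp
  have "E \<inter> {0..<p} \<subseteq> {y \<in> {0..<d * m}. y mod d \<in> {c0..<d}}" using ge d(1) by (auto simp: m)
  then have "card (E \<inter> {0..<p}) \<le> card {y \<in> {0..<d * m}. y mod d \<in> {c0..<d}}"
    by (rule card_mono[rotated]) (auto intro: finite_subset[of _ "{0..<d * m}"])
  moreover have "int (card {y \<in> {0..<d * m}. y mod d \<in> {c0..<d}}) = m * int (card {c0..<d})"
    using d(1) m0 c0_gt p_less by (intro card_mod_in) auto
  ultimately have "int (card (E \<inter> {0..<p})) \<le> m * (d - c0)" using c0d by simp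
  then have "k * int (card (E \<inter> {0..<p})) \<le> k * (m * (d - c0))" using k_ge by (intro mult_left_mono) auto
  then have "m * (d * int (level E)) \<le> m * (k * (d - c0))" using cnt by (simp add: m algebra_simps)
  then have "d * int (level E) \<le> k * (d - c0)" using m0 by simp
  moreover have "d * 2 \<le> d * int (level E)" using lev d(1) by simp
  ultimately have "k * (d - c0) \<noteq> d" using d(1) by linarith
  then show ?thesis using c0d by (simp add: cond6_def d_def)
qed

text \<open>Mirror image of \<open>einv_high\<close>: elements are brought into the last block of
  length d below p, where the bound for low elements is most restrictive.\<close>

lemma einv_low:
  assumes E: "einv E" and lowE: "\<And>y. y \<in> E \<Longrightarrow> low y" and lev: "2 \<le> level E"
  shows cond7
proof -
  define d where "d = gcd p (c1 + q)"
  define u where "u = d - (q - c0)"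
  have dg: "d = gcd p (c1 + g)"
  proof -
    have "gcd p (c1 + g + p * 1) = gcd p (c1 + g)" by (metis gcd_add_mult mult.commute add.commute)
    then show ?thesis by (simp add: d_def)
  qed
  have d: "0 < d" "d dvd p" using p_pos by (auto simp: d_def)
  obtain m where m: "p = d * m" using d(2) by blast
  have m0: "0 < m" using p_pos d(1) m by (simp add: zero_less_mult_iff)
  have per: "y + p * t \<in> E \<longleftrightarrow> y \<in> E" for y t using E by (simp add: einv_def)
  have cl: "y + (c1 + g) \<in> E" if "y \<in> E" for y
  proof -
    have "Q y \<in> E" using E that by (simp add: einv_def)
    then show ?thesis using lowE[OF that] by (simp add: Q_def add.assoc)
  qed
  have less: "y mod d < u" if "y \<in> E" for y
  proof -
    have "y + d * (m - 1 - y div d) \<in> E" unfolding dg by (rule closed_add_gcd[OF p_pos per cl that])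
    moreover have "y + d * (m - 1 - y div d) = y mod d + (p - d)"
      unfolding m by (simp add: algebra_simps)
    ultimately have "low (y mod d + (p - d))" using lowE by simp
    moreover have "(y mod d + (p - d)) mod p = y mod d + (p - d)"
    proof (rule mod_pos_pos_trivial)
      show "0 \<le> y mod d + (p - d)" using zdvd_imp_le[OF d(2) p_pos] d(1) by simp
      show "y mod d + (p - d) < p" using pos_mod_bound[OF d(1), of y] by linarith
    qed
    ultimately show ?thesis by (simp add: low_def u_def)
  qed
  have "E \<noteq> {}" using lev by (auto simp: level_def)
  then obtain y where "y \<in> E" by blast
  then have u0: "0 < u" using less[of y] pos_mod_sign[OF d(1), of y] by linarith
  have ud: "u < d" using c0_less p_less by (simp add: u_def)
  have "E \<inter> {0..<c0 - g} = E \<inter> {0..<p}"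
  proof -
    have "y < c0 - g" if "y \<in> E" "0 \<le> y" "y < p" for y
      using lowE[OF that(1)] that by (simp add: low_def)
    then show ?thesis using c0_less p_less by auto
  qed
  then have cnt: "p * int (level E) = (k + 1) * int (card (E \<inter> {0..<p}))"
    using level_count[OF E] by (simp add: distrib_right)
  have "E \<inter> {0..<p} \<subseteq> {y \<in> {0..<d * m}. y mod d \<in> {0..<u}}" using less d(1) by (auto simp: m)
  then have "card (E \<inter> {0..<p}) \<le> card {y \<in> {0..<d * m}. y mod d \<in> {0..<u}}"
    by (rule card_mono[rotated]) (auto intro: finite_subset[of _ "{0..<d * m}"])
  moreover have "int (card {y \<in> {0..<d * m}. y mod d \<in> {0..<u}}) = m * int (card {0..<u})"
    using d(1) m0 ud by (intro card_mod_in) auto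
  ultimately have "int (card (E \<inter> {0..<p})) \<le> m * u" using u0 by simp
  then have "(k + 1) * int (card (E \<inter> {0..<p})) \<le> (k + 1) * (m * u)" using k_ge by (intro mult_left_mono) auto
  then have "m * (d * int (level E)) \<le> m * ((k + 1) * u)" using cnt by (simp add: m algebra_simps)
  then have "d * int (level E) \<le> (k + 1) * u" using m0 by simp
  moreover have "d * 2 \<le> d * int (level E)" using lev d(1) by simp
  ultimately have "(k + 1) * u \<noteq> d" using d(1) by linarith
  moreover have "u = d + c0 - q" by (simp add: u_def)
  ultimately show ?thesis using u0 by (simp add: cond7_def d_def)
qed

text \<open>Enumerating the set turns \<open>Q\<close> into a shift of indices, which transports
  distances rigidly. Maximality enters through \<open>max_shift\<close>, used once inside the runs
  and twice at their ends.\<close>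

lemma einv_mixed:
  assumes maximal: "\<And>Y. einv Y \<Longrightarrow> Y \<subseteq> E" and E: "einv E" and lev: "2 \<le> level E"
    and some_low: "\<exists>y\<in>E. low y" and some_high: "\<exists>y\<in>E. \<not> low y"
  shows cond8
proof -
  define M where "M = int (card (E \<inter> {0..<p}))"
  define S where "S = int (card (E \<inter> {0..<c0 - g}))"
  have per: "y + p * t \<in> E \<longleftrightarrow> y \<in> E" for y t using E by (simp add: einv_def)
  have goodE: "good y" and QE: "Q y \<in> E" if "y \<in> E" for y using E that by (auto simp: einv_def)
  have "E \<noteq> {}" using some_low by blast
  from periodic_enumeration[OF p_pos per this]
  obtain \<xi> where sm: "strict_mono \<xi>" and rng: "range \<xi> = E" and xi_per: "\<And>i. \<xi> (i + M) = \<xi> i + p"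
    and xi0: "0 \<le> \<xi> 0" and xim1: "\<xi> (- 1) < 0" and M0: "0 < M"
    unfolding M_def by metis
  have xiE: "\<xi> i \<in> E" for i using rng by blast
  have xi_less: "\<xi> i < \<xi> j \<longleftrightarrow> i < j" for i j using sm by (rule strict_mono_less)
  have xi_le: "\<xi> i \<le> \<xi> j \<longleftrightarrow> i \<le> j" for i j using sm by (rule strict_mono_less_eq)
  have xi_perm: "\<xi> (i + M * t) = \<xi> i + p * t" for i t
    by (rule quasi_periodic_mult) (rule xi_per)
  have xi_mod: "\<xi> i = \<xi> (i mod M) + p * (i div M)" for i
    using xi_perm[of "i mod M" "i div M"] by simp
  have xi_range: "0 \<le> \<xi> i" "\<xi> i < p" if "0 \<le> i" "i < M" for i
  proof -
    show "0 \<le> \<xi> i" using that(1) xi0 xi_le[of 0 i] by linarith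
    have "\<xi> i \<le> \<xi> (- 1 + M)" using that xi_le by simp
    then show "\<xi> i < p" using xi_per[of "- 1"] xim1 by linarith
  qed
  have consec: "\<not> (\<xi> i < y \<and> y < \<xi> (i + 1))" if y: "y \<in> E" for y i
  proof -
    obtain j where "y = \<xi> j" using rng y by blast
    then show ?thesis by (simp add: xi_less)
  qed
  \<comment> \<open>The low elements are the first \<open>S\<close> of each period of the
    enumeration.\<close>
  have S_iff: "\<xi> i < c0 - g \<longleftrightarrow> i < S" if i: "0 \<le> i" for i
  proof -
    define A where "A = {i. 0 \<le> i \<and> \<xi> i < c0 - g}"
    have "A \<subseteq> {0..<M}"
    proof
      fix i assume i: "i \<in> A"
      have "\<xi> M = \<xi> 0 + p" using xi_per[of 0] by simp
      then have "\<xi> i < \<xi> M" using i xi0 c0_less p_less by (simp add: A_def)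
      then show "i \<in> {0..<M}" using i by (simp add: A_def xi_less)
    qed
    then have fin: "finite A" by (rule finite_subset) simp
    have "\<xi> ` A = E \<inter> {0..<c0 - g}"
    proof (intro equalityI subsetI)
      fix y assume y: "y \<in> E \<inter> {0..<c0 - g}"
      then obtain j where j: "y = \<xi> j" using rng by blast
      then have "\<xi> (- 1) < \<xi> j" using y xim1 by simp
      then show "y \<in> \<xi> ` A" using y j by (simp add: A_def xi_less)
    next
      fix y assume "y \<in> \<xi> ` A"
      then obtain j where j: "0 \<le> j" "\<xi> j < c0 - g" "y = \<xi> j" by (auto simp: A_def)
      then show "y \<in> E \<inter> {0..<c0 - g}" using xiE[of j] xi0 xi_le[of 0 j] by simp
    qed
    moreover have "inj_on \<xi> A" using sm by (intro inj_on_subset[OF strict_mono_imp_inj_on]) auto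
    ultimately have "card A = card (E \<inter> {0..<c0 - g})" by (metis card_image)
    moreover have "A = {0..<int (card A)}"
    proof (rule down_closed_eq[OF fin])
      fix i j assume "i \<in> A" "0 \<le> j" "j < i"
      then show "j \<in> A" using xi_less[of j i] by (simp add: A_def)
    qed (auto simp: A_def)
    ultimately have "A = {0..<S}" by (simp add: S_def)
    moreover have "\<xi> i < c0 - g \<longleftrightarrow> i \<in> A" using i by (simp add: A_def)
    ultimately show ?thesis using i by simp
  qed
  have modM: "0 \<le> i mod M" "i mod M < M" for i using M0 by simp_all
  have pos_mod: "(\<xi> i + \<eta>) mod p = \<xi> (i mod M) + \<eta>" if "0 \<le> \<xi> (i mod M) + \<eta>" "\<xi> (i mod M) + \<eta> < p" for i \<eta>
  proof -
    have "\<xi> i + \<eta> = (\<xi> (i mod M) + \<eta>) + p * (i div M)" using xi_mod[of i] by linarith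
    then have "(\<xi> i + \<eta>) mod p = (\<xi> (i mod M) + \<eta>) mod p" by (simp only: mod_mult_self2)
    then show ?thesis using that by simp
  qed
  have low_xi: "low (\<xi> i) \<longleftrightarrow> i mod M < S" for i
    using pos_mod[of i 0] xi_range[OF modM, of i] S_iff[OF modM(1), of i] by (simp add: low_def)
  have high_xi: "c0 \<le> \<xi> j" if "S \<le> j" "j < M" "0 \<le> j" for j
  proof -
    have "\<xi> j mod p = \<xi> j" using xi_range[OF that(3,2)] by simp
    then have "\<not> low (\<xi> j)" using S_iff[OF that(3)] that(1) by (simp add: low_def)
    then show ?thesis using goodE[OF xiE[of j]] \<open>\<xi> j mod p = \<xi> j\<close> by (simp add: good_def)
  qed
  have S0: "0 < S"
  proof -
    obtain y where "y \<in> E" "low y" using some_low by blast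
    then obtain i where "low (\<xi> i)" using rng by blast
    then show ?thesis using low_xi[of i] modM(1)[of i] by linarith
  qed
  have SM: "S < M"
  proof -
    obtain y where "y \<in> E" "\<not> low y" using some_high by blast
    then obtain i where "\<not> low (\<xi> i)" using rng by blast
    then show ?thesis using low_xi[of i] modM(2)[of i] by linarith
  qed
  \<comment> \<open>\<open>Q\<close> is increasing on E and onto, so it induces an order
    automorphism of the index set, which is a translation.\<close>
  obtain \<rho> where rot: "\<And>i. \<xi> (i + \<rho>) = \<xi> i + c1 + g * of_bool (i mod M < S)"
  proof -
    have "\<exists>j. \<xi> j = Q (\<xi> i)" for i using QE[OF xiE[of i]] rng by (metis imageE)
    then obtain \<sigma> where \<sigma>: "\<And>i. \<xi> (\<sigma> i) = Q (\<xi> i)" by metis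
    have "strict_mono \<sigma>"
    proof (rule strict_monoI)
      fix i j :: int assume "i < j"
      then have "Q (\<xi> i) < Q (\<xi> j)" by (intro Q_mono goodE xiE) (simp add: xi_less)
      then show "\<sigma> i < \<sigma> j" unfolding \<sigma>[symmetric] by (simp add: xi_less)
    qed
    moreover have "surj \<sigma>"
    proof -
      have "\<exists>i. j = \<sigma> i" for j
      proof -
        obtain y where y: "y \<in> E" "Q y = \<xi> j" using einv_surj[OF E xiE[of j]] by blast
        then obtain i where "y = \<xi> i" using rng by blast
        then have "\<xi> (\<sigma> i) = \<xi> j" using \<sigma> y(2) by simp
        then show ?thesis using sm by (metis strict_mono_eq)
      qed
      then show ?thesis by (auto simp: surj_def)
    qed
    ultimately have sh: "\<sigma> i = i + \<sigma> 0" for i by (rule strict_mono_surj_int_shift)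
    have "\<xi> (i + \<sigma> 0) = Q (\<xi> i)" for i using \<sigma>[of i] unfolding sh[of i] .
    then show thesis using that[of "\<sigma> 0"] by (simp add: Q_def low_xi)
  qed
  \<comment> \<open>Indices are linked by adding \<rho> or M, so the orbits are the classes modulo
    \<mu>; this will be the length of a run.\<close>
  define \<mu> where "\<mu> = gcd M \<rho>"
  have \<mu>0: "0 < \<mu>" using M0 by (simp add: \<mu>_def)
  obtain N \<rho>' where N: "M = \<mu> * N" and \<rho>': "\<rho> = \<mu> * \<rho>'" and cop: "coprime N \<rho>'"
  proof -
    have "M = \<mu> * (M div \<mu>)" "\<rho> = \<mu> * (\<rho> div \<mu>)" by (simp_all add: \<mu>_def)
    moreover have "coprime (M div \<mu>) (\<rho> div \<mu>)" unfolding \<mu>_def using M0 by (intro div_gcd_coprime) auto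
    ultimately show thesis using that by blast
  qed
  have N0: "0 < N" using M0 \<mu>0 N by (simp add: zero_less_mult_iff)
  have mod\<mu>: "(i mod M) mod \<mu> = i mod \<mu>" for i by (simp add: N mod_mod_cancel)

  \<comment> \<open>A family of elements whose indices are closed under \<rho> and M is translated
    by \<eta>. If no point changes branch, \<open>Q\<close> acts as before and the translated family
    is invariant, hence contained in E.\<close>
  have max_shift: "\<xi> i + \<eta> \<in> E"
    if i: "i \<in> I" and I\<rho>: "\<And>i. i \<in> I \<Longrightarrow> i + \<rho> \<in> I" and IM: "\<And>i t. i \<in> I \<Longrightarrow> i + M * t \<in> I"
      and pos: "\<And>i. i \<in> I \<Longrightarrow> (i mod M < S \<and> 0 \<le> \<xi> (i mod M) + \<eta> \<and> \<xi> (i mod M) + \<eta> < c0 - g)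
        \<or> (S \<le> i mod M \<and> c0 \<le> \<xi> (i mod M) + \<eta> \<and> \<xi> (i mod M) + \<eta> < p)" for i \<eta> I
  proof -
    define Y where "Y = (\<lambda>i. \<xi> i + \<eta>) ` I"
    have gl: "good (\<xi> i + \<eta>) \<and> (low (\<xi> i + \<eta>) \<longleftrightarrow> i mod M < S)" if "i \<in> I" for i
    proof -
      have "0 \<le> \<xi> (i mod M) + \<eta>" "\<xi> (i mod M) + \<eta> < p" using pos[OF that] c0_less c0_gt p_less p_pos by linarith+
      from pos_mod[OF this] show ?thesis using pos[OF that] p_less by (auto simp: good_def low_def)
    qed
    have "einv Y"
      unfolding einv_def
    proof (intro conjI allI ballI)
      fix y t
      have shift: "y + p * t \<in> Y" if "y \<in> Y" for y t
      proof -
        obtain i where i: "i \<in> I" "y = \<xi> i + \<eta>" using \<open>y \<in> Y\<close> by (auto simp: Y_def)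
        then have "y + p * t = \<xi> (i + M * t) + \<eta>" by (simp add: xi_perm)
        then show ?thesis using IM[OF i(1)] unfolding Y_def by blast
      qed
      show "y + p * t \<in> Y \<longleftrightarrow> y \<in> Y" using shift[of y t] shift[of "y + p * t" "- t"] by auto
    next
      fix y assume "y \<in> Y"
      then obtain i where i: "i \<in> I" "y = \<xi> i + \<eta>" by (auto simp: Y_def)
      then show "good y" using gl by simp
      have "Q y = \<xi> (i + \<rho>) + \<eta>" using gl[OF i(1)] unfolding i(2) Q_def rot by simp
      then show "Q y \<in> Y" using I\<rho>[OF i(1)] unfolding Y_def by blast
    qed
    then show ?thesis using maximal i unfolding Y_def by blast
  qed

  \<comment> \<open>Within the class of a modulo \<mu>, numbered by j, adding \<rho> means adding
    \<rho>' to j, so the total displacement does not depend on a.\<close>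
  have f_sum: "(\<Sum>j\<in>{0..<N}. c1 + g * of_bool ((\<mu> * j + a) mod M < S)) = \<rho>' * p" for a
  proof -
    have "(\<Sum>j\<in>{0..<N}. c1 + g * of_bool ((\<mu> * j + a) mod M < S))
        = (\<Sum>j\<in>{0..<N}. \<xi> (\<mu> * (j + \<rho>') + a) - \<xi> (\<mu> * j + a))"
    proof (intro sum.cong refl)
      fix j
      have eq: "\<mu> * (j + \<rho>') + a = (\<mu> * j + a) + \<rho>" by (simp add: \<rho>' algebra_simps)
      show "c1 + g * of_bool ((\<mu> * j + a) mod M < S) = \<xi> (\<mu> * (j + \<rho>') + a) - \<xi> (\<mu> * j + a)"
        unfolding eq rot by simp
    qed
    also have "\<dots> = \<rho>' * p"
    proof (rule quasi_periodic_sum)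
      fix j
      have "\<mu> * (j + N) + a = (\<mu> * j + a) + M" by (simp add: N algebra_simps)
      then show "\<xi> (\<mu> * (j + N) + a) = \<xi> (\<mu> * j + a) + p" by (simp only: xi_per)
    qed (use N0 in simp)
    finally show ?thesis .
  qed
  have muj: "(\<mu> * j) mod M = \<mu> * (j mod N)" for j by (simp add: N)
  \<comment> \<open>By \<open>f_sum\<close>, the displacements have the same total over each index class modulo \<open>\<mu>\<close>; the classes
    of \<open>0\<close> and \<open>- 1\<close> differ at the index \<open>0\<close>, which only a multiple of \<open>\<mu>\<close> equal to \<open>S\<close> can offset.\<close>
  obtain s where s: "S = \<mu> * s"
  proof (rule ccontr)
    assume "\<not> thesis"
    then have ns: "\<mu> * j \<noteq> S" for j using that by metis
    have eq: "of_bool ((\<mu> * j + 0) mod M < S) - of_bool ((\<mu> * j + (- 1)) mod M < S) = (of_bool (j = 0) :: int)"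
      if "j \<in> {0..<N}" for j
    proof (cases "j = 0")
      case True
      have "- 1 = M * (- 1) + (M - 1)" by simp
      then have "(- 1) mod M = M - 1" by (rule int_mod_pos_eq) (use M0 in simp_all)
      then show ?thesis using True S0 SM by simp
    next
      case False
      have "\<mu> * 1 \<le> \<mu> * j" using that False \<mu>0 by (intro mult_left_mono) auto
      moreover have "\<mu> * j < M" using that \<mu>0 by (simp add: N)
      ultimately have "(\<mu> * j + 0) mod M = \<mu> * j" "(\<mu> * j + (- 1)) mod M = \<mu> * j - 1" using \<mu>0 by simp_all
      then show ?thesis using False ns[of j] by auto
    qed
    have "(\<Sum>j\<in>{0..<N}. c1 + g * of_bool ((\<mu> * j + 0) mod M < S)) - (\<Sum>j\<in>{0..<N}. c1 + g * of_bool ((\<mu> * j + (- 1)) mod M < S))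
      = (\<Sum>j\<in>{0..<N}. g * (of_bool ((\<mu> * j + 0) mod M < S) - of_bool ((\<mu> * j + (- 1)) mod M < S)))"
      unfolding sum_subtractf[symmetric] by (intro sum.cong refl) (simp only: right_diff_distrib add_diff_cancel_left)
    also have "\<dots> = (\<Sum>j\<in>{0..<N}. g * of_bool (j = 0))"
      by (intro sum.cong refl) (simp only: eq)
    also have "\<dots> = (\<Sum>j\<in>{0..<N}. if j = 0 then g else 0)" by (intro sum.cong refl) simp
    also have "\<dots> = g" using N0 by simp
    finally show False unfolding f_sum using p_less by simp
  qed
  have s0: "0 < s" using S0 \<mu>0 s by (simp add: zero_less_mult_iff)
  have sN: "s < N" using SM \<mu>0 by (simp add: s N)
  have rot_eq: "N * c1 + s * g = p * \<rho>'"
  proof -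
    have "(\<Sum>j\<in>{0..<N}. c1 + g * of_bool ((\<mu> * j + 0) mod M < S)) = (\<Sum>j\<in>{0..<N}. c1 + g * of_bool (j < s))"
      using \<mu>0 by (intro sum.cong refl) (simp add: muj s)
    also have "\<dots> = N * c1 + g * (\<Sum>j\<in>{0..<N}. of_bool (j < s))"
      using N0 by (simp only: sum.distrib sum_distrib_left) simp
    also have "(\<Sum>j\<in>{0..<N}. of_bool (j < s)) = (\<Sum>j\<in>{0..<s}. 1 :: int)"
      using sN by (intro sum.mono_neutral_cong_right) auto
    also have "\<dots> = s" using s0 by simp
    finally show ?thesis unfolding f_sum by (simp only: mult.commute)
  qed

  \<comment> \<open>A longer gap would be carried along rigidly, so its points could be added to \<open>E\<close>.\<close>
  have unit_gap: "\<xi> (i + 1) = \<xi> i + 1" if i: "i mod \<mu> \<noteq> \<mu> - 1" for i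
  proof (rule ccontr)
    assume ne: "\<xi> (i + 1) \<noteq> \<xi> i + 1"
    define I where "I = {i. i mod \<mu> \<noteq> \<mu> - 1 \<and> \<xi> (i + 1) \<noteq> \<xi> i + 1}"
    \<comment> \<open>Both M and S are multiples of \<mu>, so a step inside a block of \<mu> indices
      crosses neither the end of the period nor the boundary between the branches.\<close>
    have next_mod: "(i + 1) mod M = i mod M + 1" "i mod M + 1 < M" "i mod M + 1 \<noteq> S" if "i mod \<mu> \<noteq> \<mu> - 1" for i
    proof -
      have last: "(\<mu> * j - 1) mod \<mu> = \<mu> - 1" for j
      proof -
        have "\<mu> * j - 1 = \<mu> * (j - 1) + (\<mu> - 1)" by (simp add: algebra_simps)
        then show ?thesis by (rule int_mod_pos_eq) (use \<mu>0 in simp_all)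
      qed
      have "i mod M \<noteq> M - 1" using that mod\<mu>[of i] last[of N] by (auto simp: N)
      then show lt: "i mod M + 1 < M" using modM(2)[of i] by linarith
      show "i mod M + 1 \<noteq> S"
      proof
        assume "i mod M + 1 = S"
        then have "i mod M = \<mu> * s - 1" using s by linarith
        then show False using that mod\<mu>[of i] last[of s] by simp
      qed
      have "i + 1 = M * (i div M) + (i mod M + 1)" by simp
      then show "(i + 1) mod M = i mod M + 1"
        by (rule int_mod_pos_eq) (use lt modM(1)[of i] in simp_all)
    qed
    have "\<xi> i + 1 \<in> E"
    proof (rule max_shift[of i I])
      show "i \<in> I" using i ne by (simp add: I_def)
    next
      fix i assume i: "i \<in> I"
      then have i1: "i mod \<mu> \<noteq> \<mu> - 1" "\<xi> (i + 1) \<noteq> \<xi> i + 1" by (auto simp: I_def)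
      have "(i + \<rho>) mod \<mu> = i mod \<mu>" by (simp add: \<rho>')
      moreover have "\<xi> (i + \<rho> + 1) - \<xi> (i + \<rho>) = \<xi> (i + 1) - \<xi> i"
      proof -
        have "((i + 1) mod M < S) = (i mod M < S)" using next_mod[OF i1(1)] by auto
        then show ?thesis using rot[of i] rot[of "i + 1"] by (simp add: add_ac)
      qed
      ultimately show "i + \<rho> \<in> I" using i1 by (simp add: I_def)
      fix t
      have "(i + M * t) mod \<mu> = i mod \<mu>" by (simp add: N mult.assoc)
      moreover have "\<xi> (i + M * t + 1) - \<xi> (i + M * t) = \<xi> (i + 1) - \<xi> i"
        using xi_perm[of i t] xi_perm[of "i + 1" t] by (simp add: add_ac)
      ultimately show "i + M * t \<in> I" using i1 by (simp add: I_def)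
    next
      fix i assume i: "i \<in> I"
      then have i1: "i mod \<mu> \<noteq> \<mu> - 1" "\<xi> (i + 1) \<noteq> \<xi> i + 1" by (auto simp: I_def)
      define j where "j = i mod M"
      have j: "0 \<le> j" "j + 1 < M" "j + 1 \<noteq> S" using next_mod[OF i1(1)] modM[of i] by (simp_all add: j_def)
      have "\<xi> j < \<xi> (j + 1)" by (simp add: xi_less)
      moreover have "\<xi> (j + 1) \<noteq> \<xi> j + 1"
      proof -
        have "\<xi> (i + 1) - \<xi> i = \<xi> (j + 1) - \<xi> j"
          using xi_mod[of i] xi_perm[of "j + 1" "i div M"] by (simp add: j_def add_ac)
        then show ?thesis using i1(2) by linarith
      qed
      ultimately have gap: "\<xi> j + 1 < \<xi> (j + 1)" by linarith
      show "(i mod M < S \<and> 0 \<le> \<xi> (i mod M) + 1 \<and> \<xi> (i mod M) + 1 < c0 - g)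
        \<or> (S \<le> i mod M \<and> c0 \<le> \<xi> (i mod M) + 1 \<and> \<xi> (i mod M) + 1 < p)"
      proof (cases "j < S")
        case True
        then have "\<xi> (j + 1) < c0 - g" using S_iff[of "j + 1"] j by simp
        then show ?thesis using True gap xi_range(1)[of j] j by (simp add: j_def)
      next
        case False
        then have "c0 \<le> \<xi> j" "\<xi> (j + 1) < p" using high_xi[of j] xi_range(2)[of "j + 1"] j by auto
        then show ?thesis using False gap by (simp add: j_def)
      qed
    qed
    moreover have "\<xi> i < \<xi> (i + 1)" by (simp add: xi_less)
    ultimately show False using consec[of "\<xi> i + 1" i] ne by linarith
  qed

  \<comment> \<open>The first element of run j.\<close>
  define z where "z j = \<xi> (\<mu> * j)" for j
  have run: "\<xi> (\<mu> * j - 1) = z (j - 1) + (\<mu> - 1)" for j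
  proof -
    have "\<xi> (\<mu> * i + t) = z i + t" if "0 \<le> t" "t \<le> \<mu> - 1" for i t
      using that
    proof (induction t rule: int_ge_induct)
      case (step t)
      then have "(\<mu> * i + t) mod \<mu> = t" by (intro int_mod_pos_eq[of _ _ i]) auto
      then have "\<xi> (\<mu> * i + t + 1) = \<xi> (\<mu> * i + t) + 1" using step by (intro unit_gap) auto
      then show ?case using step by (simp add: add_ac)
    qed (simp add: z_def)
    from this[of "\<mu> - 1" "j - 1"] show ?thesis using \<mu>0 by (simp add: algebra_simps)
  qed
  have z_per: "z (j + N) = z j + p" for j
    using xi_per[of "\<mu> * j"] by (simp add: z_def N algebra_simps)
  have z_rot: "z (j + \<rho>') = z j + c1 + g * of_bool (j mod N < s)" for j
    using rot[of "\<mu> * j"] \<mu>0 by (simp add: z_def muj s \<rho>' distrib_left)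

  \<comment> \<open>s times the inverse of \<rho>' modulo N; it will be the number of large
    gaps.\<close>
  obtain D where D: "0 < D" "D < N" "(D * \<rho>') mod N = s"
  proof -
    obtain u v where uv: "u * N + v * \<rho>' = 1" using cop bezout_int[of N \<rho>'] by (metis coprime_imp_gcd_eq_1)
    define D where "D = (v * s) mod N"
    have "D * \<rho>' mod N = (v * s * \<rho>') mod N" by (simp add: D_def mod_mult_left_eq)
    also have "v * s * \<rho>' = s + N * (- u * s)"
    proof -
      have "s = (u * N + v * \<rho>') * s" by (simp add: uv)
      then show ?thesis by (simp add: algebra_simps)
    qed
    also have "\<dots> mod N = s" unfolding mod_mult_self2 using s0 sN by simp
    finally have 1: "(D * \<rho>') mod N = s" .
    moreover have "D \<noteq> 0" using 1 s0 by auto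
    moreover have "0 \<le> D" "D < N" using N0 by (simp_all add: D_def)
    ultimately show thesis using that[of D] by linarith
  qed
  interpret G: gap_pattern N \<rho>' s D
    by unfold_locales (use cop s0 sN D in auto)

  define H where "H = z 0 - z (- 1)"
  \<comment> \<open>After removing g from the gaps marked by \<open>big\<close>, the step lengths
    are invariant under \<rho>' and N. These generate the integers, so all steps equal
    \<open>H\<close>, the one in front of run 0.\<close>
  have V: "z j - z (j - 1) = H + g * of_bool (G.big j)" for j
  proof -
    define U where "U j = z j - z (j - 1) - g * of_bool (G.big j)" for j
    have below: "of_bool (j mod N < s) - of_bool ((j - 1) mod N < s)
      = (of_bool (j mod N = 0) - of_bool (j mod N = s) :: int)" for j
    proof (cases "j mod N = 0")
      case True
      have "j - 1 = N * (j div N - 1) + (N - 1)" using mult_div_mod_eq[of N j] True by (simp add: algebra_simps)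
      then have "(j - 1) mod N = N - 1" by (rule int_mod_pos_eq) (use N0 in simp_all)
      then show ?thesis using True s0 sN by simp
    next
      case False
      have jm: "0 \<le> j mod N" "j mod N < N" using N0 by simp_all
      have "j - 1 = N * (j div N) + (j mod N - 1)" by simp
      then have "(j - 1) mod N = j mod N - 1" by (rule int_mod_pos_eq) (use jm False in simp_all)
      then show ?thesis using False by auto
    qed
    have U\<rho>: "U (j + \<rho>') = U j" for j
    proof -
      have "U (j + \<rho>') - U j = g * ((of_bool (j mod N < s) - of_bool ((j - 1) mod N < s))
          - (of_bool (G.big (j + \<rho>')) - of_bool (G.big j)))"
        using z_rot[of j] z_rot[of "j - 1"] by (simp add: U_def algebra_simps)
      also have "\<dots> = 0" unfolding G.big_shift below by simp
      finally show ?thesis by simp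
    qed
    have UN: "U (j + N) = U j" for j
      using z_per[of j] z_per[of "j - 1"] G.big_cong[of "j + N" j] by (simp add: U_def algebra_simps)
    obtain u v where uv: "u * N + v * \<rho>' = 1" using cop bezout_int[of N \<rho>'] by (metis coprime_imp_gcd_eq_1)
    have "j = 0 + \<rho>' * (v * j) + N * (u * j)"
    proof -
      have "j = (u * N + v * \<rho>') * j" by (simp add: uv)
      then show ?thesis by (simp add: algebra_simps)
    qed
    then have "U j = U (0 + \<rho>' * (v * j) + N * (u * j))" by simp
    also have "\<dots> = U (0 + \<rho>' * (v * j)) + 0 * (u * j)" by (rule quasi_periodic_mult) (simp add: UN)
    also have "\<dots> = U 0 + 0 * (v * j) + 0 * (u * j)"
      by (subst quasi_periodic_mult[where P = 0]) (simp_all add: U\<rho>)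
    finally have "U j = H" using G.not_big_0 by (simp add: U_def H_def)
    then show ?thesis by (simp add: U_def)
  qed
  have z_sum: "z j = z 0 + j * H + g * int (card {i \<in> {1..j}. G.big i})" if "0 \<le> j" for j
    using that
  proof (induction j rule: int_ge_induct)
    case (step j)
    define A where "A = {i \<in> {1..j}. G.big i}"
    have fin: "finite A" unfolding A_def by (rule finite_subset[of _ "{1..j}"]) auto
    have ni: "j + 1 \<notin> A" by (simp add: A_def)
    have zj: "z (j + 1) = z j + (H + g * of_bool (G.big (j + 1)))"
      using V[of "j + 1"] unfolding add_diff_cancel_right' by linarith
    have "{1..j + 1} = insert (j + 1) {1..j}" using step.hyps by auto
    then have ins: "{i \<in> {1..j + 1}. G.big i} = (if G.big (j + 1) then insert (j + 1) A else A)"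
      unfolding A_def by auto
    show ?case
      unfolding ins zj step.IH[folded A_def] using fin ni
      by (cases "G.big (j + 1)") (simp_all add: algebra_simps)
  qed simp
  have p_eq: "p = N * H + g * D"
  proof -
    have "{1..N} = insert N {1..<N}" using N0 by auto
    moreover have "\<not> G.big N" using G.not_big_0 G.big_cong[of N 0] by simp
    ultimately have "{i \<in> {1..N}. G.big i} = {i \<in> {1..<N}. G.big i}" by auto
    then have "z N = z 0 + N * H + g * D" using z_sum[of N] N0 G.card_big_all by simp
    then show ?thesis using z_per[of 0] by simp
  qed
  have zs: "z s = z 0 + s * H + g * (int G.d1 + 1)"
    using z_sum[of s] s0 G.card_big_upto by simp
  \<comment> \<open>\<open>a0\<close> is the room between 0 and run 0, \<open>b0\<close> the room
    between c0 and run s, and \<omega> the distance across a small gap from the last element of a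
    run to the next run.\<close>
  define a0 b0 \<omega> where "a0 = \<xi> 0" and "b0 = \<xi> S - c0" and "\<omega> = H - \<mu> + 1"
  have z0: "z 0 = a0" by (simp add: z_def a0_def)
  have zS: "z s = b0 + c0" by (simp add: z_def b0_def s)
  have xim1_eq: "\<xi> (- 1) = a0 - \<omega>" using run[of 0] by (simp add: z0 \<omega>_def H_def)
  have xiS1: "\<xi> (S - 1) = b0 + c0 - \<omega> - g"
    using run[of s] V[of s] G.big_s zS by (simp add: s \<omega>_def)
  have a_bounds: "0 \<le> a0" "a0 \<le> \<omega> - 1" "a0 < c0 - g"
    using xi0 xim1 S_iff[of 0] S0 by (simp_all add: xim1_eq) (simp_all add: a0_def)
  have b_bounds: "0 \<le> b0" "b0 \<le> \<omega> - 1" "b0 < p - c0"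
    using high_xi[of S] S0 SM xi_range(2)[of S] S_iff[of "S - 1"] xiS1 by (simp_all add: b0_def)
  \<comment> \<open>By maximality, the runs can be extended neither downwards nor upwards.\<close>
  have dich1: "a0 = 0 \<or> b0 = 0"
  proof (rule ccontr)
    assume "\<not> (a0 = 0 \<or> b0 = 0)"
    then have ab: "1 \<le> a0" "1 \<le> b0" using a_bounds b_bounds by auto
    have "\<xi> 0 + (- 1) \<in> E"
    proof (rule max_shift[of 0 "{i. i mod \<mu> = 0}"])
      fix i :: int assume i: "i \<in> {i. i mod \<mu> = 0}"
      then show "i + \<rho> \<in> {i. i mod \<mu> = 0}" by (simp add: \<rho>')
      show "i + M * t \<in> {i. i mod \<mu> = 0}" for t using i by (simp add: N mult.assoc)
      define j where "j = i mod M"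
      have j: "0 \<le> j" "j < M" using modM[of i] by (simp_all add: j_def)
      show "(i mod M < S \<and> 0 \<le> \<xi> (i mod M) + (- 1) \<and> \<xi> (i mod M) + (- 1) < c0 - g)
        \<or> (S \<le> i mod M \<and> c0 \<le> \<xi> (i mod M) + (- 1) \<and> \<xi> (i mod M) + (- 1) < p)"
      proof (cases "j < S")
        case True
        then have "\<xi> j < c0 - g" using S_iff j by simp
        moreover have "\<xi> 0 \<le> \<xi> j" using j by (simp add: xi_le)
        ultimately show ?thesis using True ab(1) by (simp add: j_def a0_def)
      next
        case False
        then have "\<xi> S \<le> \<xi> j" by (simp add: xi_le)
        then show ?thesis using False ab(2) xi_range(2)[OF j] by (simp add: j_def b0_def)
      qed
    qed simp
    then show False using consec[of "\<xi> 0 + (- 1)" "- 1"] ab(1) xim1 by (simp add: a0_def)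
  qed
  have dich2: "a0 = \<omega> - 1 \<or> b0 = \<omega> - 1"
  proof (rule ccontr)
    assume "\<not> (a0 = \<omega> - 1 \<or> b0 = \<omega> - 1)"
    then have ab: "a0 \<le> \<omega> - 2" "b0 \<le> \<omega> - 2" using a_bounds b_bounds by auto
    have "- 1 = \<mu> * (- 1) + (\<mu> - 1)" by simp
    then have m1: "(- 1) mod \<mu> = \<mu> - 1" by (rule int_mod_pos_eq) (use \<mu>0 in simp_all)
    have "\<xi> (- 1) + 1 \<in> E"
    proof (rule max_shift[of "- 1" "{i. i mod \<mu> = \<mu> - 1}"])
      fix i :: int assume i: "i \<in> {i. i mod \<mu> = \<mu> - 1}"
      then show "i + \<rho> \<in> {i. i mod \<mu> = \<mu> - 1}" by (simp add: \<rho>')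
      show "i + M * t \<in> {i. i mod \<mu> = \<mu> - 1}" for t using i by (simp add: N mult.assoc)
      define j where "j = i mod M"
      have j: "0 \<le> j" "j < M" using modM[of i] by (simp_all add: j_def)
      have up: "\<xi> j < \<xi> (j + 1)" by (simp add: xi_less)
      consider "j = M - 1" | "j = S - 1" | "j + 1 < S" | "S \<le> j" "j + 1 < M" using j by linarith
      then have "(j < S \<and> 0 \<le> \<xi> j + 1 \<and> \<xi> j + 1 < c0 - g) \<or> (S \<le> j \<and> c0 \<le> \<xi> j + 1 \<and> \<xi> j + 1 < p)"
      proof cases
        case 1
        have "\<xi> j = \<xi> (- 1) + p" using xi_per[of "- 1"] 1 by simp
        then show ?thesis using 1 SM high_xi[of j] j ab(1) xim1_eq by auto
      next
        case 2
        then show ?thesis using xiS1 ab(2) xi_range(1)[OF j] by auto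
      next
        case 3
        then have "\<xi> (j + 1) < c0 - g" using S_iff[of "j + 1"] j by simp
        then show ?thesis using 3 up xi_range(1)[OF j] by auto
      next
        case 4
        then show ?thesis using up high_xi[of j] j xi_range(2)[of "j + 1"] by auto
      qed
      then show "(i mod M < S \<and> 0 \<le> \<xi> (i mod M) + 1 \<and> \<xi> (i mod M) + 1 < c0 - g)
        \<or> (S \<le> i mod M \<and> c0 \<le> \<xi> (i mod M) + 1 \<and> \<xi> (i mod M) + 1 < p)"
        unfolding j_def .
    qed (simp add: m1)
    then show False using consec[of "\<xi> (- 1) + 1" "- 1"] ab(1) xim1_eq xi0 by (simp add: a0_def)
  qed
  \<comment> \<open>One of \<open>a0\<close>, \<open>b0\<close> is 0 and one is \<omega> - 1, the
    largest value either can take, so they differ by \<omega> - 1 = H - \<mu>. This is why the run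
    length H - |\<delta>| in condition 8 is exactly \<mu>.\<close>
  define \<delta> where "\<delta> = a0 - b0"
  have \<delta>_abs: "\<bar>\<delta>\<bar> = \<omega> - 1" using dich1 dich2 a_bounds b_bounds by (auto simp: \<delta>_def)
  have "gap_pattern N \<rho>' s D" by (rule G.gap_pattern_axioms)
  moreover have "c0 = (int G.d1 + 1) * g + s * H + \<delta>"
    using zs unfolding zS z0 by (simp add: \<delta>_def algebra_simps)
  moreover have "\<bar>\<delta>\<bar> < H" using \<delta>_abs \<mu>0 by (simp add: \<omega>_def)
  moreover have "c0 - p < \<delta>" "\<delta> < c0 - g" using a_bounds b_bounds by (simp_all add: \<delta>_def)
  moreover have "(H - \<bar>\<delta>\<bar>) * (N * k + s) \<noteq> p"
  proof -
    have "(H - \<bar>\<delta>\<bar>) * (N * k + s) = k * M + S"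
    proof -
      have "H - \<bar>\<delta>\<bar> = \<mu>" using \<delta>_abs by (simp add: \<omega>_def)
      then show ?thesis by (simp add: N s algebra_simps)
    qed
    also have "\<dots> = p * int (level E)" using level_count[OF E] by (simp add: M_def S_def)
    also have "p * int (level E) \<noteq> p"
    proof -
      have "p * 2 \<le> p * int (level E)" using lev p_pos by simp
      then show ?thesis using p_pos by linarith
    qed
    finally show ?thesis .
  qed
  ultimately show ?thesis unfolding cond8_def using p_eq rot_eq by blast
qed

lemma cond_if_level_core:
  assumes "2 \<le> level core"
  shows "cond6 \<or> cond7 \<or> cond8"
  using einv_mixed[OF einv_subset_core einv_core assms] einv_high[OF einv_core _ assms]
    einv_low[OF einv_core _ assms] by blast

end

section \<open>Proof of the theorem\<close>

lemma in_lat_scaled: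
  assumes "0 < r"
  shows "in_lat (of_int d * r) (of_int x * r) \<longleftrightarrow> d dvd x"
proof
  assume "in_lat (of_int d * r) (of_int x * r)"
  then obtain j :: int where "of_int x * r = of_int j * (of_int d * r)" by (auto simp: in_lat_def)
  then have "real_of_int x = of_int (j * d)" using assms by simp
  then have "x = j * d" by (simp only: of_int_eq_iff)
  then show "d dvd x" by simp
next
  assume "d dvd x"
  then obtain j where "x = d * j" by blast
  then show "in_lat (of_int d * r) (of_int x * r)" unfolding in_lat_def by (intro exI[of _ j]) simp
qed

lemma lat_gcd_scaled:
  assumes r: "0 < r" and nz: "gcd x y \<noteq> 0"
  shows "lat_gcd r (of_int x * r) (of_int y * r) = of_int (gcd x y) * r"
  unfolding lat_gcd_def
proof (rule Greatest_equality)
  have "0 < gcd x y" using nz gcd_ge_0_int[of x y] by linarith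
  moreover have "in_lat r (of_int (gcd x y) * r)" by (auto simp: in_lat_def)
  ultimately show "0 < of_int (gcd x y) * r \<and> in_lat r (of_int (gcd x y) * r)
      \<and> in_lat (of_int (gcd x y) * r) (of_int x * r) \<and> in_lat (of_int (gcd x y) * r) (of_int y * r)"
    using r by (simp add: in_lat_scaled)
next
  fix d assume d: "0 < d \<and> in_lat r d \<and> in_lat d (of_int x * r) \<and> in_lat d (of_int y * r)"
  then obtain j :: int where j: "d = of_int j * r" by (auto simp: in_lat_def)
  then have "j dvd gcd x y" using d r by (simp add: in_lat_scaled)
  moreover have "0 < gcd x y" using nz gcd_ge_0_int[of x y] by linarith
  ultimately have "j \<le> gcd x y" by (rule zdvd_imp_le)
  then show "d \<le> of_int (gcd x y) * r" using r by (simp add: j)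
qed

section \<open>Translation of condition 8 into the parameters d1 to d4\<close>

context rotation_system
begin

text \<open>With X = p * \<rho>, clauses (b) to (d) say that \<rho> is an integer, that D * \<rho> =
  s modulo N, and that \<rho> is coprime to N. Clause (g) is cleared of its denominator N * k +
  s.\<close>

lemma cond8_iff:
  "cond8 \<longleftrightarrow> (\<exists>d1 d2 d3 d4 :: nat. \<exists>\<delta>.
    let N = int (d1 + d2 + d3 + d4 + 2); D = int (d1 + d2 + 1); s = int (d1 + d3 + 1);
        B = p - D * g; X = N * c1 + s * g; H = B div N
    in 0 < B \<and> N dvd B \<and> p dvd X \<and> N * p dvd D * X - s * p \<and> gcd X (N * p) = p
      \<and> card {n. 1 \<le> n \<and> n \<le> D \<and> (\<exists>j. 0 < n * X - j * (N * p) \<and> n * X - j * (N * p) < s * p)} = d1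
      \<and> c0 = (int d1 + 1) * g + s * H + \<delta> \<and> - min (p - c0) H < \<delta> \<and> \<delta> < min (c0 - g) H
      \<and> \<bar>\<delta>\<bar> * (N * k + s) + p \<noteq> H * (N * k + s))"
  (is "_ \<longleftrightarrow> ?R")
proof -
  have card_eq: "{n. 1 \<le> n \<and> n \<le> D \<and> (\<exists>j. 0 < n * (p * \<rho>) - j * (N * p) \<and> n * (p * \<rho>) - j * (N * p) < s * p)}
      = {n \<in> {1..D}. (n * \<rho>) mod N \<in> {1..<s}}" if "0 < N" "s < N" for N D s \<rho> :: int
  proof -
    have "(\<exists>j. 0 < n * (p * \<rho>) - j * (N * p) \<and> n * (p * \<rho>) - j * (N * p) < s * p) \<longleftrightarrow> (n * \<rho>) mod N \<in> {1..<s}" for n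
    proof -
      have eq: "n * (p * \<rho>) - j * (N * p) = p * (n * \<rho> - N * j)" for j by (simp add: algebra_simps)
      have pos: "0 < p * x \<and> p * x < s * p \<longleftrightarrow> 0 < x \<and> x < s" for x
        using p_pos by (simp add: zero_less_mult_iff mult.commute[of s])
      have "(\<exists>j. 0 < n * \<rho> - N * j \<and> n * \<rho> - N * j < s) \<longleftrightarrow> (n * \<rho>) mod N \<in> {1..<s}"
      proof
        assume "\<exists>j. 0 < n * \<rho> - N * j \<and> n * \<rho> - N * j < s"
        then obtain j where j: "0 < n * \<rho> - N * j" "n * \<rho> - N * j < s" by blast
        have "n * \<rho> = N * j + (n * \<rho> - N * j)" by simp
        then have "(n * \<rho>) mod N = n * \<rho> - N * j" by (rule int_mod_pos_eq) (use j that in simp_all)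
        then show "(n * \<rho>) mod N \<in> {1..<s}" using j by simp
      next
        assume "(n * \<rho>) mod N \<in> {1..<s}"
        then show "\<exists>j. 0 < n * \<rho> - N * j \<and> n * \<rho> - N * j < s"
          by (intro exI[of _ "(n * \<rho>) div N"]) (simp add: minus_mult_div_eq_mod)
      qed
      then show ?thesis unfolding eq pos .
    qed
    then show ?thesis by auto
  qed
  have gcd_eq: "gcd (p * x) (y * p) = p \<longleftrightarrow> coprime y x" for x y
  proof -
    have "gcd (p * x) (y * p) = gcd (p * x) (p * y)" by (simp only: mult.commute)
    also have "\<dots> = p * gcd x y" using p_pos by (simp add: gcd_mult_distrib_int[symmetric] abs_of_pos)
    finally have "gcd (p * x) (y * p) = p * gcd x y" .
    then show ?thesis using p_pos by (simp add: coprime_iff_gcd_eq_1 gcd.commute)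
  qed
  show ?thesis
  proof
    assume cond8
    then obtain N \<rho> s D H \<delta> where pat: "gap_pattern N \<rho> s D" and p_eq: "p = N * H + g * D"
      and rot: "N * c1 + s * g = p * \<rho>" and c0: "c0 = (int (gap_pattern.d1 N \<rho> s D) + 1) * g + s * H + \<delta>"
      and \<delta>: "\<bar>\<delta>\<bar> < H" "c0 - p < \<delta>" "\<delta> < c0 - g" and ne: "(H - \<bar>\<delta>\<bar>) * (N * k + s) \<noteq> p"
      unfolding cond8_def by blast
    interpret G: gap_pattern N \<rho> s D by (rule pat)
    \<comment> \<open>\<open>d1\<close> and \<open>d2\<close> count the large gaps before and after
      gap s, \<open>d3\<close> and \<open>d4\<close> the small ones; gaps 0 and s account for the 2
      in N.\<close>
    define d2 d3 d4 where "d2 = nat (D - 1 - int G.d1)" and "d3 = nat (s - 1 - int G.d1)"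
      and "d4 = nat (N - 1 - s - (D - 1 - int G.d1))"
    have ds: "N = int (G.d1 + d2 + d3 + d4 + 2)" "D = int (G.d1 + d2 + 1)" "s = int (G.d1 + d3 + 1)"
      using G.d1_bounds by (simp_all add: d2_def d3_def d4_def)
    have N0: "0 < N" using G.s_range by simp
    have H0: "0 < H" using \<delta>(1) by simp
    have B: "p - D * g = N * H" using p_eq by (simp only: mult.commute[of g])
    have HB: "(p - D * g) div N = H" unfolding B using N0 by simp
    have "N dvd D * \<rho> - s"
    proof -
      have "(D * \<rho>) mod N = s mod N" using G.D_mult G.s_range by simp
      then show ?thesis by (simp add: mod_eq_dvd_iff)
    qed
    then have "N * p dvd (D * \<rho> - s) * p" by (rule mult_dvd_mono) simp
    then have dv: "N * p dvd D * (p * \<rho>) - s * p" by (simp add: algebra_simps)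
    show ?R
      unfolding Let_def
    proof (rule exI[of _ G.d1], rule exI[of _ d2], rule exI[of _ d3], rule exI[of _ d4], rule exI[of _ \<delta>],
        unfold ds[symmetric] HB rot, intro conjI)
      show "0 < p - D * g" "N dvd p - D * g" unfolding B using N0 H0 by simp_all
      show "gcd (p * \<rho>) (N * p) = p" using gcd_eq G.coprime_N by simp
      show "card {n. 1 \<le> n \<and> n \<le> D \<and> (\<exists>j. 0 < n * (p * \<rho>) - j * (N * p) \<and> n * (p * \<rho>) - j * (N * p) < s * p)} = G.d1"
        unfolding card_eq[OF N0 G.s_range(2)] G.d1_def ..
      show "\<bar>\<delta>\<bar> * (N * k + s) + p \<noteq> H * (N * k + s)"
        using ne unfolding left_diff_distrib by linarith
    qed (use dv c0 \<delta> in auto)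
  next
    assume ?R
    then obtain d1 d2 d3 d4 :: nat and \<delta> N D s B X H where
      N: "N = int (d1 + d2 + d3 + d4 + 2)" and D: "D = int (d1 + d2 + 1)" and s: "s = int (d1 + d3 + 1)"
      and B: "B = p - D * g" and X: "X = N * c1 + s * g" and H: "H = B div N"
      and c: "0 < B" "N dvd B" "p dvd X" "N * p dvd D * X - s * p" "gcd X (N * p) = p"
      and card: "card {n. 1 \<le> n \<and> n \<le> D \<and> (\<exists>j. 0 < n * X - j * (N * p) \<and> n * X - j * (N * p) < s * p)} = d1"
      and c0: "c0 = (int d1 + 1) * g + s * H + \<delta>" and \<delta>: "- min (p - c0) H < \<delta>" "\<delta> < min (c0 - g) H"
      and ne: "\<bar>\<delta>\<bar> * (N * k + s) + p \<noteq> H * (N * k + s)"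
      unfolding Let_def by blast
    obtain \<rho> where \<rho>: "X = p * \<rho>" using c(3) by blast
    have rng: "0 < N" "s < N" "0 < s" "1 \<le> D" "D < N" by (auto simp: N D s)
    have BH: "B = N * H" using c(2) by (simp add: H)
    have "N * p dvd (D * \<rho> - s) * p" using c(4) by (simp add: \<rho> algebra_simps)
    then have "N dvd D * \<rho> - s" using p_pos by simp
    then have "(D * \<rho>) mod N = s mod N" by (simp add: mod_eq_dvd_iff)
    then have "(D * \<rho>) mod N = s" using rng by simp
    then interpret G: gap_pattern N \<rho> s D
      using rng c(5) gcd_eq[of \<rho> N] by unfold_locales (simp_all add: \<rho>)
    have d1: "G.d1 = d1" using card unfolding \<rho> card_eq[OF rng(1,2)] G.d1_def .
    have "p = N * H + g * D" using BH B by (simp only: mult.commute[of g])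
    moreover have "N * c1 + s * g = p * \<rho>" using X \<rho> by simp
    moreover have "c0 = (int G.d1 + 1) * g + s * H + \<delta>" using c0 by (simp only: d1)
    moreover have "\<bar>\<delta>\<bar> < H" "c0 - p < \<delta>" "\<delta> < c0 - g" using \<delta> by linarith+
    moreover have "(H - \<bar>\<delta>\<bar>) * (N * k + s) \<noteq> p" using ne unfolding left_diff_distrib by linarith
    ultimately show cond8 unfolding cond8_def using G.gap_pattern_axioms by blast
  qed
qed

end

locale lattice_rotation_system = rotation_system + lattice_window_system
begin

theorem not_frame_iff:
  "\<not> gabor_frame \<phi> (of_int p * r) (of_int q * r) \<longleftrightarrow> cond6 \<or> cond7 \<or> cond8"
proof
  assume "\<not> gabor_frame \<phi> (of_int p * r) (of_int q * r)"
  then have "\<not> card (live \<inter> win 0) \<le> 1" using frame by blast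
  then have "2 \<le> level core" by (simp add: level_def live_core)
  then show "cond6 \<or> cond7 \<or> cond8" by (rule cond_if_level_core)
next
  assume "cond6 \<or> cond7 \<or> cond8"
  then have "\<exists>E. einv E \<and> 2 \<le> level E"
  proof (elim disjE)
    assume cond8
    then show ?thesis unfolding cond8_def using cond8_sufficient by blast
  qed (fact cond6_sufficient cond7_sufficient)+
  then obtain E where "einv E" "2 \<le> level E" by blast
  then show "\<not> gabor_frame \<phi> (of_int p * r) (of_int q * r)"
    using not_frame[OF invariant_einv] by (simp add: level_def)
qed

end

theorem theorem2p5:
  fixes a b c :: real and p q :: nat
  defines "k \<equiv> \<lfloor>c / b\<rfloor>"
  defines "c0 \<equiv> c - real_of_int k * b"
  defines "c1 \<equiv> real_of_int k * b - real_of_int \<lfloor>real_of_int k * b / a\<rfloor> * a"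
  assumes pos: "0 < a" and ab: "a < b" and bc: "b < c"
    and c0_bounds: "b - a < c0" "c0 < a"
    and k_ge: "k \<ge> 2"
    and c1_bounds: "0 < c1" "c1 < 2 * a - b"
    and pq: "0 < p" "0 < q" "coprime p q" "a / b = real p / real q"
    and c_lat: "in_lat (b / real q) c"
  shows "\<not> gabor_frame (indicator {0..<c}) a b \<longleftrightarrow>
    ( (c0 < lat_gcd (b / real q) a c1 \<and>
         real_of_int k * (lat_gcd (b / real q) a c1 - c0) \<noteq> lat_gcd (b / real q) a c1)
    \<or> (b - c0 < lat_gcd (b / real q) a (c1 + b) \<and>
         (real_of_int k + 1) * (lat_gcd (b / real q) a (c1 + b) + c0 - b) \<noteq> lat_gcd (b / real q) a (c1 + b))
    \<or> (\<exists>d1 d2 d3 d4 :: nat.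
         let N = real (d1 + d2 + d3 + d4 + 2);
             Bd = a - real (d1 + d2 + 1) * (b - a);
             X = N * c1 + real (d1 + d3 + 1) * (b - a)
         in 0 < Bd \<and> in_lat (N * (b / real q)) Bd
          \<and> in_lat a X
          \<and> in_lat (N * a) (real (d1 + d2 + 1) * X - real (d1 + d3 + 1) * a)
          \<and> lat_gcd (b / real q) X (N * a) = a
          \<and> card {n::int. 1 \<le> n \<and> n \<le> int (d1 + d2 + 1) \<and>
                   (\<exists>j::int. real_of_int n * X - real_of_int j * (N * a) \<in> {0<..<real (d1 + d3 + 1) * a})} = d1
          \<and> (\<exists>\<delta>. c0 = real (d1 + 1) * (b - a) + real (d1 + d3 + 1) * Bd / N + \<delta>
                 \<and> - min (a - c0) (Bd / N) < \<delta> \<and> \<delta> < min (c0 + a - b) (Bd / N)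
                 \<and> \<bar>\<delta>\<bar> + a / (N * real_of_int k + real (d1 + d3 + 1)) \<noteq> Bd / N)))"
proof -
  define r where "r = b / real q"
  define P where "P = int p"
  define T where "T = int q"
  have b0: "0 < b" using pos ab by simp
  have r: "0 < r" using b0 pq(2) by (simp add: r_def)
  have a_r: "a = of_int P * r" using pq(2,4) b0 by (simp add: r_def P_def field_simps)
  have b_r: "b = of_int T * r" using pq(2) by (simp add: r_def T_def)
  \<comment> \<open>In units of r = b / q, the integers \<open>P\<close>, \<open>T\<close>,
    \<open>C'\<close>, \<open>e\<close> and \<open>f\<close> stand for a, b, c, c0 and c1.\<close>
  obtain C' where C': "c = of_int C' * r" using c_lat by (auto simp: in_lat_def r_def)
  define e where "e = C' - k * T"
  define l where "l = \<lfloor>real_of_int k * b / a\<rfloor>"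
  define f where "f = k * T - l * P"
  have c0_r: "c0 = of_int e * r" by (simp add: c0_def e_def C' b_r algebra_simps)
  have c1_r: "c1 = of_int f * r"
  proof -
    have "c1 = of_int k * b - of_int l * a" by (simp only: c1_def l_def)
    then show ?thesis by (simp add: f_def a_r b_r algebra_simps)
  qed
  have scale: "of_int x * r < of_int y * r \<longleftrightarrow> x < y" "of_int x * r = of_int y * r \<longleftrightarrow> x = y" for x y
    using r by simp_all
  have scale0: "0 < of_int x * r \<longleftrightarrow> 0 < x" for x
    using r by (simp add: zero_less_mult_iff)
  interpret lattice_rotation_system P T k e f r
  proof unfold_locales
    show "0 < P" using pq(1) by (simp add: P_def)
    show "P < T" using ab r by (simp add: a_r b_r)
    show "T - P < e" using c0_bounds(1) scale(1)[of "T - P" e] by (simp add: a_r b_r c0_r algebra_simps)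
    show "e < P" using c0_bounds(2) by (simp only: a_r c0_r scale(1))
    show "1 \<le> k" using k_ge by simp
    show "coprime P T" using pq(3) by (simp add: P_def T_def)
    show "f mod P = k * T mod P" by (simp add: f_def mod_eq_dvd_iff)
    show "0 < r" by (rule r)
  qed
  have "C = C'" unfolding C_def by (simp add: e_def)
  then have C_eq: "of_int C * r = c" by (simp only: C')
  have g_r: "b - a = of_int (T - P) * r" by (simp add: a_r b_r algebra_simps)
  have lat1: "lat_gcd r a c1 = of_int (gcd P f) * r"
    unfolding a_r c1_r using r p_pos by (intro lat_gcd_scaled) auto
  have lat2: "lat_gcd r a (c1 + b) = of_int (gcd P (f + T)) * r"
  proof -
    have "c1 + b = of_int (f + T) * r" by (simp add: c1_r b_r algebra_simps)
    then show ?thesis unfolding a_r using r p_pos by (simp only:) (intro lat_gcd_scaled, auto)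
  qed
  have cond6_real: "(c0 < lat_gcd r a c1 \<and> real_of_int k * (lat_gcd r a c1 - c0) \<noteq> lat_gcd r a c1) \<longleftrightarrow> cond6"
  proof -
    have "real_of_int k * (of_int (gcd P f) * r - of_int e * r) = of_int (k * (gcd P f - e)) * r"
      by (simp add: algebra_simps)
    then show ?thesis unfolding lat1 c0_r cond6_def by (simp only: scale)
  qed
  have cond7_real: "(b - c0 < lat_gcd r a (c1 + b) \<and>
      (real_of_int k + 1) * (lat_gcd r a (c1 + b) + c0 - b) \<noteq> lat_gcd r a (c1 + b)) \<longleftrightarrow> cond7"
  proof -
    have "(real_of_int k + 1) * (of_int (gcd P (f + T)) * r + of_int e * r - of_int T * r)
        = of_int ((k + 1) * (gcd P (f + T) + e - T)) * r"
      "of_int T * r - of_int e * r = of_int (T - e) * r"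
      by (simp_all add: algebra_simps)
    then show ?thesis unfolding lat2 c0_r cond7_def unfolding b_r by (simp only: scale)
  qed
  have cond8_real: "(let N' = real (d1 + d2 + d3 + d4 + 2);
             Bd = a - real (d1 + d2 + 1) * (b - a);
             X' = N' * c1 + real (d1 + d3 + 1) * (b - a)
         in 0 < Bd \<and> in_lat (N' * r) Bd
          \<and> in_lat a X'
          \<and> in_lat (N' * a) (real (d1 + d2 + 1) * X' - real (d1 + d3 + 1) * a)
          \<and> lat_gcd r X' (N' * a) = a
          \<and> card {n::int. 1 \<le> n \<and> n \<le> int (d1 + d2 + 1) \<and>
                   (\<exists>j::int. real_of_int n * X' - real_of_int j * (N' * a) \<in> {0<..<real (d1 + d3 + 1) * a})} = d1
          \<and> (\<exists>\<delta>. c0 = real (d1 + 1) * (b - a) + real (d1 + d3 + 1) * Bd / N' + \<delta>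
                 \<and> - min (a - c0) (Bd / N') < \<delta> \<and> \<delta> < min (c0 + a - b) (Bd / N')
                 \<and> \<bar>\<delta>\<bar> + a / (N' * real_of_int k + real (d1 + d3 + 1)) \<noteq> Bd / N'))
    \<longleftrightarrow> (\<exists>\<delta>.
    let N = int (d1 + d2 + d3 + d4 + 2); D = int (d1 + d2 + 1); s = int (d1 + d3 + 1);
        B = P - D * (T - P); X = N * f + s * (T - P); H = B div N
    in 0 < B \<and> N dvd B \<and> P dvd X \<and> N * P dvd D * X - s * P \<and> gcd X (N * P) = P
      \<and> card {n. 1 \<le> n \<and> n \<le> D \<and> (\<exists>j. 0 < n * X - j * (N * P) \<and> n * X - j * (N * P) < s * P)} = d1
      \<and> e = (int d1 + 1) * (T - P) + s * H + \<delta> \<and> - min (P - e) H < \<delta> \<and> \<delta> < min (e - (T - P)) H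
      \<and> \<bar>\<delta>\<bar> * (N * k + s) + P \<noteq> H * (N * k + s))" for d1 d2 d3 d4 :: nat
  proof -
    define N D s B X H where "N = int (d1 + d2 + d3 + d4 + 2)" and "D = int (d1 + d2 + 1)"
      and "s = int (d1 + d3 + 1)" and "B = P - D * (T - P)" and "X = N * f + s * (T - P)" and "H = B div N"
    have N: "real (d1 + d2 + d3 + d4 + 2) = of_int N" and D: "real (d1 + d2 + 1) = of_int D"
      and s: "real (d1 + d3 + 1) = of_int s" and d1: "real (d1 + 1) = of_int (int d1 + 1)"
      by (simp_all add: N_def D_def s_def)
    have N0: "0 < N" and W0: "0 < N * k + s" using k_ge by (simp_all add: N_def s_def add_nonneg_pos)
    have B: "a - of_int D * (b - a) = of_int B * r" unfolding g_r by (simp add: a_r B_def algebra_simps)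
    have X: "of_int N * c1 + of_int s * (b - a) = of_int X * r" unfolding g_r by (simp add: c1_r X_def algebra_simps)
    have Na: "of_int N * a = of_int (N * P) * r" by (simp add: a_r)
    have c: "of_int D * (of_int X * r) - of_int s * a = of_int (D * X - s * P) * r"
      by (simp add: a_r algebra_simps)
    have lat: "lat_gcd r (of_int X * r) (of_int (N * P) * r) = a \<longleftrightarrow> gcd X (N * P) = P"
    proof -
      have "lat_gcd r (of_int X * r) (of_int (N * P) * r) = of_int (gcd X (N * P)) * r"
        using N0 p_pos by (intro lat_gcd_scaled r) auto
      then show ?thesis by (simp only: a_r scale)
    qed
    have lats: "in_lat (of_int N * r) (of_int B * r) \<longleftrightarrow> N dvd B" "in_lat a (of_int X * r) \<longleftrightarrow> P dvd X"
      "in_lat (of_int (N * P) * r) (of_int (D * X - s * P) * r) \<longleftrightarrow> N * P dvd D * X - s * P"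
      unfolding a_r by (rule in_lat_scaled[OF r])+
    have set_eq: "real_of_int n * (of_int X * r) - real_of_int j * (of_int (N * P) * r) \<in> {0<..<of_int s * a}
        \<longleftrightarrow> 0 < n * X - j * (N * P) \<and> n * X - j * (N * P) < s * P" for n j :: int
    proof -
      have "real_of_int n * (of_int X * r) - real_of_int j * (of_int (N * P) * r) = of_int (n * X - j * (N * P)) * r"
        "of_int s * a = of_int (s * P) * r"
        by (simp_all add: a_r algebra_simps)
      then show ?thesis by (simp only: greaterThanLessThan_iff scale scale0)
    qed
    have delta: "(\<exists>\<delta>. c0 = of_int (int d1 + 1) * (b - a) + of_int s * (of_int B * r) / of_int N + \<delta>
          \<and> - min (a - c0) (of_int B * r / of_int N) < \<delta> \<and> \<delta> < min (c0 + a - b) (of_int B * r / of_int N)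
          \<and> \<bar>\<delta>\<bar> + a / (of_int N * real_of_int k + of_int s) \<noteq> of_int B * r / of_int N)
      \<longleftrightarrow> (\<exists>\<delta>. e = (int d1 + 1) * (T - P) + s * H + \<delta> \<and> - min (P - e) H < \<delta> \<and> \<delta> < min (e - (T - P)) H
          \<and> \<bar>\<delta>\<bar> * (N * k + s) + P \<noteq> H * (N * k + s))" if dv: "N dvd B"
    proof -
      \<comment> \<open>Clause (f) determines \<delta>, and its value is a multiple of r; so the
        real and the integer quantifier have a single candidate each, and these correspond.\<close>
      define \<delta>0 where "\<delta>0 = e - (int d1 + 1) * (T - P) - s * H"
      have "B = N * H" using dv by (simp add: H_def)
      then have BN: "of_int B * r / of_int N = of_int H * r" "of_int s * (of_int B * r) / of_int N = of_int (s * H) * r"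
        using N0 by simp_all
      have mins: "min (a - c0) (of_int H * r) = of_int (min (P - e) H) * r"
        "min (c0 + a - b) (of_int H * r) = of_int (min (e - (T - P)) H) * r"
      proof -
        have "a - c0 = of_int (P - e) * r" "c0 + a - b = of_int (e - (T - P)) * r"
          by (simp_all add: a_r b_r c0_r algebra_simps)
        moreover have "min (of_int x * r) (of_int y * r) = of_int (min x y) * r" for x y
          using r by (simp add: min_def)
        ultimately show "min (a - c0) (of_int H * r) = of_int (min (P - e) H) * r"
          "min (c0 + a - b) (of_int H * r) = of_int (min (e - (T - P)) H) * r" by (simp_all only:)
      qed
      have eq: "c0 = of_int (int d1 + 1) * (b - a) + of_int (s * H) * r + \<delta> \<longleftrightarrow> \<delta> = of_int \<delta>0 * r" for \<delta>
        unfolding g_r c0_r \<delta>0_def by (auto simp: algebra_simps)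
      have eqi: "e = (int d1 + 1) * (T - P) + s * H + \<delta> \<longleftrightarrow> \<delta> = \<delta>0" for \<delta> unfolding \<delta>0_def by linarith
      have neg: "- (of_int x * r) < of_int y * r \<longleftrightarrow> - x < y" for x y
        using scale(1)[of "- x" y] by simp
      have last: "\<bar>of_int \<delta>0 * r\<bar> + a / (of_int N * real_of_int k + of_int s) = of_int H * r
          \<longleftrightarrow> \<bar>\<delta>0\<bar> * (N * k + s) + P = H * (N * k + s)"
      proof -
        define W where "W = N * k + s"
        have W: "of_int N * real_of_int k + of_int s = of_int W" by (simp add: W_def)
        have W1: "real_of_int W \<noteq> 0" using W0 unfolding W_def[symmetric] by simp
        have "\<bar>of_int \<delta>0 * r\<bar> + a / of_int W = of_int H * r
          \<longleftrightarrow> of_int (\<bar>\<delta>0\<bar> * W + P) * r = of_int (H * W) * r"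
          using r W1 by (simp add: abs_mult a_r field_simps)
        then show ?thesis unfolding W by (simp only: scale W_def)
      qed
      show ?thesis unfolding BN mins eq eqi
        by (simp only: ex_simps simp_thms scale neg last)
    qed
    \<comment> \<open>\<open>delta\<close> is available only when N divides B; otherwise clause (a)
      fails on both sides.\<close>
    show ?thesis
      unfolding Let_def N D s d1 B X Na c lat set_eq scale0 lats
      unfolding N_def[symmetric] D_def[symmetric] s_def[symmetric] B_def[symmetric] X_def[symmetric] H_def[symmetric]
      by (cases "N dvd B") (simp_all only: delta simp_thms ex_simps)
  qed
  show ?thesis
    unfolding r_def[symmetric] cond6_real cond7_real cond8_real
    using not_frame_iff unfolding cond8_iff C_eq a_r[symmetric] b_r[symmetric] .
qed

end
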